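(* Let $P_1,\ldots,P_N$ be polynomials, either in $m$ real variables, or in $m/2$ complex variables (with $m$ even and $\mathbb{C}^{m/2}$ identified with $\mathbb{R}^m$), and let $f=|P_1|^2+\cdots+|P_N|^2$, regarded as a function $f:\mathbb{R}^m\to\mathbb{R}$. There exists $0<\tau_0<1$, depending only on the dimension $m$ and the degrees of the polynomials $P_1,\ldots,P_N$, such that if $\{x_n\}$ is a sequence constructed by the algorithm New Q-Newton's method Backtracking G (defined in the context) applied to $f$ with exponent $0<\tau\le\tau_0$, then either i) $\lim_{n\to\infty}\|x_n\|=\infty$, or ii) the whole sequence $\{x_n\}$ converges to a critical point of $f$.
   Context: Notation. $\langle\cdot,\cdot\rangle$ and $\|\cdot\|$ are the Euclidean inner product and norm on $\mathbb{R}^m$; $\nabla f$ and $\nabla^2 f$ are the gradient and Hessian of $f$; $Id$ is the $m\times m$ identity matrix. For a symmetric real matrix $A$, $minsp(A):=\min_{\|e\|=1}\|Ae\|$ (equivalently, the minimum of $|\lambda|$ over the eigenvalues $\lambda$ of $A$). Polynomials in real variables have real coefficients and polynomials in complex variables have complex coefficients. Algorithm New Q-Newton's method Backtracking G. Parameters: pairwise distinct real numbers $\delta_0,\ldots,\delta_m$ (chosen randomly, then fixed), $\tau>0$, $0<\gamma_0<1$, and a rule assigning to each $x\in\mathbb{R}^m$ an orthonormal basis $e_1(x),\ldots,e_m(x)$ of $\mathbb{R}^m$. Put $\kappa:=\frac12\min_{i\ne j}|\delta_i-\delta_j|$. Starting from $x_0\in\mathbb{R}^m$, for $k=0,1,2,\ldots$: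 if $\nabla f(x_k)=0$, put $x_{k+1}=x_k$. If $\nabla f(x_k)\neq 0$: - let $j$ be the smallest index in $\{0,\ldots,m\}$ with $minsp(\nabla^2 f(x_k)+\delta_j\|\nabla f(x_k)\|^{\tau}Id)\ge\kappa\|\nabla f(x_k)\|^{\tau}$, and put $A_k:=\nabla^2 f(x_k)+\delta_j\|\nabla f(x_k)\|^{\tau}Id$; - put $e_{i,k}:=e_i(x_k)$, $w_k:=\sum_{i=1}^m\frac{\langle\nabla f(x_k),e_{i,k}\rangle}{\|A_ke_{i,k}\|}e_{i,k}$ and $\widehat{w_k}:=w_k/\max\{1,\|w_k\|\}$; - let $\gamma$ be the first element of the sequence $\gamma_0,\gamma_0/3,\gamma_0/9,\ldots$ satisfying Armijo's condition $f(x_k-\gamma\widehat{w_k})-f(x_k)\le-\frac13\gamma\langle\widehat{w_k},\nabla f(x_k)\rangle$; - put $x_{k+1}:=x_k-\gamma\widehat{w_k}$. *)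

theory Defs
  imports "HOL-Analysis.Analysis" "HOL-Library.Poly_Mapping"
begin

text \<open>Polynomials over 'a in the variables 'v, as finitely supported families of coefficients
  indexed by monomials; a monomial is a finitely supported family of exponents.\<close>

type_synonym ('v, 'a) mpoly = "('v \<Rightarrow>\<^sub>0 nat) \<Rightarrow>\<^sub>0 'a"

definition mpoly_eval :: "('v::finite, 'a::comm_semiring_1) mpoly \<Rightarrow> ('v \<Rightarrow> 'a) \<Rightarrow> 'a" where
  "mpoly_eval P z =
     (\<Sum>u\<in>Poly_Mapping.keys P. Poly_Mapping.lookup P u * (\<Prod>v\<in>UNIV. z v ^ Poly_Mapping.lookup u v))"

text \<open>Total degree; the zero polynomial gets degree 0.\<close>

definition mpoly_degree :: "('v::finite, 'a::zero) mpoly \<Rightarrow> nat" where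
  "mpoly_degree P =
     Max (insert 0 ((\<lambda>u. \<Sum>v\<in>UNIV. Poly_Mapping.lookup u v) ` Poly_Mapping.keys P))"

definition sum_sq_norm :: "('v::finite, 'a::real_normed_field) mpoly list \<Rightarrow> ('v \<Rightarrow> 'a) \<Rightarrow> real" where
  "sum_sq_norm Ps z = (\<Sum>P\<leftarrow>Ps. (norm (mpoly_eval P z))\<^sup>2)"

text \<open>A bijection \<open>\<iota> :: 'k + 'k \<Rightarrow> 'n\<close> identifies \<open>\<complex>\<close>-valued families over 'k with \<open>\<real>\<close>-valued
  families over 'n: \<open>\<iota> (Inl j)\<close> and \<open>\<iota> (Inr j)\<close> are the real coordinates holding the real and
  the imaginary part of the j-th complex coordinate.\<close>

definition complex_coords :: "('k + 'k \<Rightarrow> 'n::finite) \<Rightarrow> real ^ 'n \<Rightarrow> 'k \<Rightarrow> complex" where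
  "complex_coords \<iota> x j = Complex (x $ \<iota> (Inl j)) (x $ \<iota> (Inr j))"

definition grad :: "(real ^ 'n \<Rightarrow> real) \<Rightarrow> real ^ 'n \<Rightarrow> real ^ 'n::finite" where
  "grad f x = (THE D. GDERIV f x :> D)"

lemma grad_eqI:
  assumes "GDERIV f x :> D"
  shows "grad f x = D"
  unfolding grad_def
proof (rule the_equality)
  show "GDERIV f x :> D" by (fact assms)
next
  fix D' assume D': "GDERIV f x :> D'"
  have "(\<lambda>h. h \<bullet> D') = (\<lambda>h. h \<bullet> D)"
    using D' assms unfolding gderiv_def by (rule has_derivative_unique)
  then show "D' = D"
    by (metis vector_eq_ldot)
qed

definition hessian :: "(real ^ 'n \<Rightarrow> real) \<Rightarrow> real ^ 'n \<Rightarrow> real ^ 'n ^ 'n::finite" where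
  "hessian f x = jacobian (grad f) (at x)"

text \<open>The infimum is attained, the unit sphere being compact and nonempty.\<close>

definition minsp :: "real ^ 'n ^ 'n::finite \<Rightarrow> real" where
  "minsp A = (INF v\<in>sphere 0 1. norm (A *v v))"

definition orthonormal_family :: "('n \<Rightarrow> real ^ 'n::finite) \<Rightarrow> bool" where
  "orthonormal_family b \<longleftrightarrow> (\<forall>i j. b i \<bullet> b j = (if i = j then 1 else 0))"

definition nqn_kappa :: "nat \<Rightarrow> (nat \<Rightarrow> real) \<Rightarrow> real" where
  "nqn_kappa m \<delta> = Min {\<bar>\<delta> i - \<delta> j\<bar> | i j. i \<le> m \<and> j \<le> m \<and> i \<noteq> j} / 2"

definition nqn_shift ::
    "(real ^ 'n \<Rightarrow> real) \<Rightarrow> (nat \<Rightarrow> real) \<Rightarrow> real \<Rightarrow> real ^ 'n \<Rightarrow> nat \<Rightarrow> real ^ 'n ^ 'n::finite" where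
  "nqn_shift f \<delta> \<tau> x j = hessian f x + mat (\<delta> j * norm (grad f x) powr \<tau>)"

text \<open>The index below exists: the Hessian is symmetric, and each of its eigenvalues rules out at
  most one of the \<open>CARD('n) + 1\<close> candidates.\<close>

definition nqn_matrix ::
    "(real ^ 'n \<Rightarrow> real) \<Rightarrow> (nat \<Rightarrow> real) \<Rightarrow> real \<Rightarrow> real ^ 'n \<Rightarrow> real ^ 'n ^ 'n::finite" where
  "nqn_matrix f \<delta> \<tau> x =
     nqn_shift f \<delta> \<tau> x
       (LEAST j. j \<le> CARD('n) \<and>
          minsp (nqn_shift f \<delta> \<tau> x j) \<ge> nqn_kappa CARD('n) \<delta> * norm (grad f x) powr \<tau>)"

definition nqn_direction ::
    "(real ^ 'n \<Rightarrow> real) \<Rightarrow> (nat \<Rightarrow> real) \<Rightarrow> real \<Rightarrow> (real ^ 'n \<Rightarrow> 'n \<Rightarrow> real ^ 'n) \<Rightarrow>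
     real ^ 'n \<Rightarrow> real ^ 'n::finite" where
  "nqn_direction f \<delta> \<tau> e x =
     (\<Sum>i\<in>UNIV. ((grad f x \<bullet> e x i) / norm (nqn_matrix f \<delta> \<tau> x *v e x i)) *\<^sub>R e x i)"

definition nqn_unit_direction ::
    "(real ^ 'n \<Rightarrow> real) \<Rightarrow> (nat \<Rightarrow> real) \<Rightarrow> real \<Rightarrow> (real ^ 'n \<Rightarrow> 'n \<Rightarrow> real ^ 'n) \<Rightarrow>
     real ^ 'n \<Rightarrow> real ^ 'n::finite" where
  "nqn_unit_direction f \<delta> \<tau> e x =
     nqn_direction f \<delta> \<tau> e x /\<^sub>R max 1 (norm (nqn_direction f \<delta> \<tau> e x))"

definition armijo :: "(real ^ 'n \<Rightarrow> real) \<Rightarrow> real ^ 'n \<Rightarrow> real ^ 'n::finite \<Rightarrow> real \<Rightarrow> bool" where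
  "armijo f x w \<gamma> \<longleftrightarrow> f (x - \<gamma> *\<^sub>R w) - f x \<le> - (1/3) * \<gamma> * (w \<bullet> grad f x)"

definition backtrack :: "(real ^ 'n \<Rightarrow> real) \<Rightarrow> real \<Rightarrow> real ^ 'n \<Rightarrow> real ^ 'n::finite \<Rightarrow> real" where
  "backtrack f \<gamma>\<^sub>0 x w = \<gamma>\<^sub>0 / 3 ^ (LEAST l. armijo f x w (\<gamma>\<^sub>0 / 3 ^ l))"

definition nqn_step ::
    "(real ^ 'n \<Rightarrow> real) \<Rightarrow> (nat \<Rightarrow> real) \<Rightarrow> real \<Rightarrow> real \<Rightarrow> (real ^ 'n \<Rightarrow> 'n \<Rightarrow> real ^ 'n) \<Rightarrow>
     real ^ 'n \<Rightarrow> real ^ 'n::finite" where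
  "nqn_step f \<delta> \<tau> \<gamma>\<^sub>0 e x =
     (if grad f x = 0 then x
      else let w = nqn_unit_direction f \<delta> \<tau> e x in x - backtrack f \<gamma>\<^sub>0 x w *\<^sub>R w)"

text \<open>The parameters are pairwise distinct \<open>\<delta> 0, \<dots>, \<delta> m\<close>, where \<open>m = CARD('n)\<close>; the
  values of \<open>\<delta>\<close> beyond m are irrelevant. An orthonormal family of m vectors is a basis.\<close>

definition nqn_sequence ::
    "(real ^ 'n \<Rightarrow> real) \<Rightarrow> (nat \<Rightarrow> real) \<Rightarrow> real \<Rightarrow> real \<Rightarrow> (real ^ 'n \<Rightarrow> 'n \<Rightarrow> real ^ 'n) \<Rightarrow>
     (nat \<Rightarrow> real ^ 'n::finite) \<Rightarrow> bool" where
  "nqn_sequence f \<delta> \<tau> \<gamma>\<^sub>0 e x \<longleftrightarrow>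
     inj_on \<delta> {0..CARD('n)} \<and> 0 < \<tau> \<and> 0 < \<gamma>\<^sub>0 \<and> \<gamma>\<^sub>0 < 1 \<and>
     (\<forall>y. orthonormal_family (e y)) \<and>
     (\<forall>k. x (Suc k) = nqn_step f \<delta> \<tau> \<gamma>\<^sub>0 e (x k))"

end

theory Submission
  imports Defs "HOL-Computational_Algebra.Polynomial"
begin

text \<open>
  The descent estimate of one step is
  \<open>f x\<^sub>n - f x\<^sub>n\<^sub>+\<^sub>1 \<ge> c * \<parallel>x\<^sub>n\<^sub>+\<^sub>1 - x\<^sub>n\<parallel> * \<parallel>grad f x\<^sub>n\<parallel> powr (1 + \<tau>/2)\<close>, so convergence follows from a
  Lojasiewicz gradient inequality \<open>\<parallel>grad f x\<parallel> \<ge> c * (f x - f p) powr \<theta>\<close> near a cluster point p,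
  provided that \<open>\<theta> * (1 + \<tau>/2) < 1\<close>. The point is that \<open>\<theta> < 1\<close> depends only on the dimension and the degree.

  To bound \<open>\<theta>\<close>, minimise \<open>G = \<parallel>grad f\<parallel>\<^sup>2\<close> on each level \<open>{f = s}\<close> of a cube. The minimisers are limits
  of minimisers of \<open>G + k * (f - s)\<^sup>2 + (1/k) * \<Sum>x\<^sub>i ^ (2 * D + 2)\<close>, whose critical equations, multiplied by \<open>1 - x\<^sub>i\<^sup>2\<close>
  so that they also hold on the faces of the cube, express the pure powers \<open>x\<^sub>i ^ (2 * D + 3)\<close> by lower terms and
  one free multiplier. Hence all polynomials live, along the
  critical points, in a space of controlled dimension, and counting monomials yields nontrivial
  relations of bounded degree between s and G, and between s and each coordinate of the minimiser; these relations
  survive the limit \<open>k \<longlonglongrightarrow> \<infinity>\<close>.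
  Comparing the two largest terms of the first relation shows that, for small s, either \<open>G \<le> C * s\<^sup>2\<close> or
  \<open>G \<ge> c * s powr (2 - 1/K)\<close>, with K bounded by the degree of the relation. The first case is
  impossible near a noncritical point: it would hold for a whole sequence of levels \<open>s\<^sub>k \<longlonglongrightarrow> s\<close>, but the
  coordinates, being bounded algebraic functions of s, have slopes \<open>o(1/s)\<close>, so that \<open>f\<close> could not
  change by \<open>s\<^sub>k - s\<close> between the corresponding minimisers.
\<close>

subsection \<open>Polynomial functions and algebraic relations\<close>

text \<open>The level \<open>s\<close> enters the critical equations only through the factor
  \<open>f - s\<close>, hence only through the multiplier. So one relation serves all levels at
  once; relations that changed with \<open>s\<close> would say nothing about the dependence on
  \<open>s\<close>. The coefficients depend on \<open>f\<close> and \<open>k\<close>, the number of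
  terms does not. Each relation is scaled so that the absolute values of its coefficients sum to 1,
  so a limit along a subsequence is again nontrivial. That \<theta> stays away from 1 is arithmetic:
  two balancing terms \<open>s^a * G^b\<close> make G comparable to a power of s whose exponent is a
  quotient with denominator below K, and such an exponent is at least 2 or at most
  \<open>2 - 1/K\<close>. The latter means \<theta> = \<open>1 - 1/(2 * K)\<close>, and \<tau> \<le>
  \<open>1/(2 * K)\<close> then gives \<theta> * (1 + \<tau>/2) < 1. The term \<tau>/2 arises
  because the shifted Hessian is only bounded below by \<kappa> * \<parallel>grad f\<parallel> powr
  \<tau>, and the square root of this bound controls the angle between step and gradient. The
  exponent 2 cannot be excluded by counting; this is what the study of slopes is for.\<close>

text \<open>The number \<open>d\<close> is only an upper bound for the degree. Building polynomials
  by one variable at a time lets derivatives, Taylor bounds and the reduction to monomials all be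
  proved by rule induction.\<close>

inductive polyfun :: "nat \<Rightarrow> (real ^ 'n::finite \<Rightarrow> real) \<Rightarrow> bool" where
  const: "polyfun d (\<lambda>x. c)"
| add: "polyfun d f \<Longrightarrow> polyfun d g \<Longrightarrow> polyfun d (\<lambda>x. f x + g x)"
| mulvar: "polyfun d f \<Longrightarrow> polyfun (Suc d) (\<lambda>x. x $ i * f x)"

lemma polyfun_Suc: "polyfun d f \<Longrightarrow> polyfun (Suc d) f"
  by (induction rule: polyfun.induct) (auto intro: polyfun.intros)

lemma polyfun_mono: "polyfun d f \<Longrightarrow> d \<le> e \<Longrightarrow> polyfun e f"
  by (induction e) (auto simp: le_Suc_eq intro: polyfun_Suc)

lemma polyfun_cmult: "polyfun d f \<Longrightarrow> polyfun d (\<lambda>x. c * f x)"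
proof (induction rule: polyfun.induct)
  case (mulvar d f i)
  then show ?case using polyfun.mulvar[of d "\<lambda>x. c * f x" i] by (simp add: ac_simps)
qed (auto simp: distrib_left intro: polyfun.intros)

lemma polyfun_minus: "polyfun d f \<Longrightarrow> polyfun d (\<lambda>x. - f x)"
  using polyfun_cmult[of d f "-1"] by simp

lemma polyfun_diff: "polyfun d f \<Longrightarrow> polyfun d g \<Longrightarrow> polyfun d (\<lambda>x. f x - g x)"
  using polyfun.add[of d f "\<lambda>x. - g x"] polyfun_minus[of d g] by simp

lemma polyfun_var: "polyfun (Suc d) (\<lambda>x. x $ i)"
  using polyfun.mulvar[OF polyfun.const, of d i 1] by simp

lemma polyfun_mult: "polyfun d f \<Longrightarrow> polyfun e g \<Longrightarrow> polyfun (d + e) (\<lambda>x. f x * g x)"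
proof (induction arbitrary: rule: polyfun.induct)
  case (const d c)
  then show ?case using polyfun_mono[OF polyfun_cmult[OF const]] by simp
next
  case (mulvar d f i)
  then show ?case using polyfun.mulvar[of "d + e" "\<lambda>x. f x * g x" i] by (simp add: mult.assoc)
qed (auto simp: distrib_right intro: polyfun.add)

lemma polyfun_sum: "(\<And>i. i \<in> I \<Longrightarrow> polyfun d (f i)) \<Longrightarrow> polyfun d (\<lambda>x. \<Sum>i\<in>I. f i x)"
  by (induction I rule: infinite_finite_induct) (auto intro: polyfun.intros)

lemma polyfun_prod:
  "(\<And>i. i \<in> I \<Longrightarrow> polyfun (d i) (f i)) \<Longrightarrow> polyfun (\<Sum>i\<in>I. d i) (\<lambda>x. \<Prod>i\<in>I. f i x)"
  by (induction I rule: infinite_finite_induct) (auto intro: polyfun.const polyfun_mult)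

lemma polyfun_power: "polyfun d f \<Longrightarrow> polyfun (n * d) (\<lambda>x. f x ^ n)"
  by (induction n) (auto intro: polyfun.const polyfun_mult)

lemma polyfun_shift: "polyfun d f \<Longrightarrow> polyfun d (\<lambda>x. f (p + x))"
proof (induction rule: polyfun.induct)
  case (mulvar d f i)
  have "polyfun (Suc d) (\<lambda>x. p $ i * f (p + x) + x $ i * f (p + x))"
    by (intro polyfun.add polyfun.mulvar polyfun_Suc[OF polyfun_cmult] mulvar.IH)
  then show ?case by (simp add: distrib_right)
qed (auto intro: polyfun.intros)

lemma polyfun_continuous_on: "polyfun d f \<Longrightarrow> continuous_on S f"
  by (induction rule: polyfun.induct) (auto intro!: continuous_intros)

lemma GDERIV_component: "GDERIV (\<lambda>x. x $ i) x :> axis i 1"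
  using bounded_linear_imp_has_derivative[OF bounded_linear_vec_nth] by (simp add: gderiv_def inner_axis)

lemma polyfun_derivatives:
  fixes f :: "real ^ 'n::finite \<Rightarrow> real"
  assumes "polyfun d f"
  obtains g h where "\<And>i. polyfun d (g i)" "\<And>i j. polyfun d (h i j)"
    "\<And>x. GDERIV f x :> (\<chi> i. g i x)" "\<And>i x. GDERIV (g i) x :> (\<chi> j. h i j x)"
    "\<And>i j x. h i j x = h j i x"
proof -
  have "\<exists>g h. (\<forall>i. polyfun d (g i)) \<and> (\<forall>i j. polyfun d (h i j)) \<and> (\<forall>x. GDERIV f x :> (\<chi> i. g i x)) \<and>
     (\<forall>i x. GDERIV (g i) x :> (\<chi> j. h i j x)) \<and> (\<forall>i j x. h i j x = h j i x)"
    using assms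
  proof (induction rule: polyfun.induct)
    case (const d c)
    show ?case
      by (rule exI[of _ "\<lambda>i x. 0"], rule exI[of _ "\<lambda>i j x. 0"])
        (auto intro: polyfun.const simp: GDERIV_const vec_lambda_unique zero_vec_def[symmetric])
  next
    case (add d f1 f2)
    obtain g1 h1 where 1: "\<And>i. polyfun d (g1 i)" "\<And>i j. polyfun d (h1 i j)"
      "\<And>x. GDERIV f1 x :> (\<chi> i. g1 i x)" "\<And>i x. GDERIV (g1 i) x :> (\<chi> j. h1 i j x)" "\<And>i j x. h1 i j x = h1 j i x"
      using add.IH(1) by blast
    obtain g2 h2 where 2: "\<And>i. polyfun d (g2 i)" "\<And>i j. polyfun d (h2 i j)"
      "\<And>x. GDERIV f2 x :> (\<chi> i. g2 i x)" "\<And>i x. GDERIV (g2 i) x :> (\<chi> j. h2 i j x)" "\<And>i j x. h2 i j x = h2 j i x"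
      using add.IH(2) by blast
    have e: "(\<chi> i. g1 i x + g2 i x) = (\<chi> i. g1 i x) + (\<chi> i. g2 i x)"
      "(\<chi> j. h1 i j x + h2 i j x) = (\<chi> j. h1 i j x) + (\<chi> j. h2 i j x)" for x i
      by (simp_all add: vec_eq_iff)
    have "GDERIV (\<lambda>x. f1 x + f2 x) x :> (\<chi> i. g1 i x + g2 i x)" for x
      unfolding e by (intro GDERIV_add 1 2)
    moreover have "GDERIV (\<lambda>x. g1 i x + g2 i x) x :> (\<chi> j. h1 i j x + h2 i j x)" for i x
      unfolding e by (intro GDERIV_add 1 2)
    moreover have "h1 i j x + h2 i j x = h1 j i x + h2 j i x" for i j x
      using 1(5)[of i j] 2(5)[of i j] by simp
    ultimately show ?case
      by (intro exI[of _ "\<lambda>i x. g1 i x + g2 i x"] exI[of _ "\<lambda>i j x. h1 i j x + h2 i j x"])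
        (simp add: polyfun.add 1(1,2) 2(1,2))
  next
    case (mulvar d f k)
    obtain g h where gh: "\<And>i. polyfun d (g i)" "\<And>i j. polyfun d (h i j)"
      "\<And>x. GDERIV f x :> (\<chi> i. g i x)" "\<And>i x. GDERIV (g i) x :> (\<chi> j. h i j x)" "\<And>i j x. h i j x = h j i x"
      using mulvar.IH by blast
    define g' where "g' i x = (if i = k then 1 else 0) * f x + x $ k * g i x" for i and x :: "real ^ 'n"
    define h' where "h' i j x = (if i = k then 1 else 0) * g j x + (if j = k then 1 else 0) * g i x + x $ k * h i j x"
      for i j and x :: "real ^ 'n"
    have "polyfun (Suc d) (g' i)" for i
      unfolding g'_def by (intro polyfun.add polyfun.mulvar polyfun_Suc[OF polyfun_cmult] mulvar.hyps gh)
    moreover have "polyfun (Suc d) (h' i j)" for i j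
      unfolding h'_def by (intro polyfun.add polyfun.mulvar polyfun_Suc[OF polyfun_cmult] mulvar.hyps gh)
    moreover have "GDERIV (\<lambda>x. x $ k * f x) x :> (\<chi> i. g' i x)" for x
    proof -
      have "(\<chi> i. g' i x) = (x $ k) *\<^sub>R (\<chi> i. g i x) + f x *\<^sub>R axis k 1"
        by (simp add: vec_eq_iff g'_def axis_def)
      then show ?thesis using GDERIV_mult[OF GDERIV_component gh(3)] by metis
    qed
    moreover have "GDERIV (g' i) x :> (\<chi> j. h' i j x)" for i x
    proof -
      have e: "(\<chi> j. h' i j x) = ((if i = k then 1 else 0) *\<^sub>R (\<chi> j. g j x) + f x *\<^sub>R 0) +
          ((x $ k) *\<^sub>R (\<chi> j. h i j x) + g i x *\<^sub>R axis k 1)"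
        by (simp add: vec_eq_iff h'_def axis_def)
      show ?thesis unfolding g'_def e
        by (rule GDERIV_add[OF GDERIV_mult[OF GDERIV_const gh(3)] GDERIV_mult[OF GDERIV_component gh(4)]])
    qed
    moreover have "h' i j x = h' j i x" for i j x by (simp add: h'_def gh(5)[of i j])
    ultimately show ?case by blast
  qed
  then show ?thesis using that by blast
qed

text \<open>Gaussian elimination on \<open>J\<close>: a vector \<open>i0\<close> with nonzero entry
  at \<open>j\<close> clears this entry from all others, and a relation among the rest is completed
  by the coefficient \<open>q\<close> of \<open>i0\<close>.\<close>

lemma exists_linear_relation:
  fixes c :: "'i \<Rightarrow> 'j \<Rightarrow> real"
  assumes "finite J" "finite I" "card J < card I"
  shows "\<exists>r. (\<exists>i\<in>I. r i \<noteq> 0) \<and> (\<forall>j\<in>J. (\<Sum>i\<in>I. r i * c i j) = 0)"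
  using assms
proof (induction J arbitrary: I c rule: finite_induct)
  case empty
  then have "I \<noteq> {}" by auto
  then show ?case by (intro exI[of _ "\<lambda>_. 1"]) auto
next
  case (insert j J)
  show ?case
  proof (cases "\<forall>i\<in>I. c i j = 0")
    case True
    obtain r where r: "\<exists>i\<in>I. r i \<noteq> 0" "\<forall>j\<in>J. (\<Sum>i\<in>I. r i * c i j) = 0"
      using insert.IH[of I c] insert.prems insert.hyps by auto
    moreover have "(\<Sum>i\<in>I. r i * c i j) = 0" using True by simp
    ultimately show ?thesis by blast
  next
    case False
    then obtain i0 where i0: "i0 \<in> I" "c i0 j \<noteq> 0" by blast
    define I' where "I' = I - {i0}"
    have I: "I = insert i0 I'" "i0 \<notin> I'" "finite I'" using i0 insert.prems by (auto simp: I'_def)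
    have "card J < card I'" using insert.prems insert.hyps I by simp
    then obtain r where r: "\<exists>i\<in>I'. r i \<noteq> 0"
      "\<forall>k\<in>J. (\<Sum>i\<in>I'. r i * (c i k - c i j / c i0 j * c i0 k)) = 0"
      using insert.IH[OF I(3), of "\<lambda>i k. c i k - c i j / c i0 j * c i0 k"] by auto
    define q where "q = - (\<Sum>i\<in>I'. r i * c i j) / c i0 j"
    define r' where "r' i = (if i = i0 then q else r i)" for i
    have s: "(\<Sum>i\<in>I. r' i * c i k) = q * c i0 k + (\<Sum>i\<in>I'. r i * c i k)" for k
      unfolding I(1) using I by (auto simp: r'_def intro!: sum.cong)
    have "(\<Sum>i\<in>I. r' i * c i k) = 0" if "k \<in> insert j J" for k
    proof (cases "k = j")
      case True
      then show ?thesis using i0(2) by (simp add: s q_def)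
    next
      case False
      then have "(\<Sum>i\<in>I'. r i * c i k) - (\<Sum>i\<in>I'. r i * (c i j / c i0 j * c i0 k)) = 0"
        using r(2) that by (simp add: right_diff_distrib sum_subtractf)
      moreover have "(\<Sum>i\<in>I'. r i * (c i j / c i0 j * c i0 k)) = - q * c i0 k"
        by (simp add: q_def sum_distrib_right sum_divide_distrib mult.assoc)
      ultimately show ?thesis by (simp add: s)
    qed
    moreover have "\<exists>i\<in>I. r' i \<noteq> 0" using r(1) I by (auto simp: r'_def)
    ultimately show ?thesis by blast
  qed
qed

section \<open>Reduction of polynomials to few monomials on the critical set\<close>

text \<open>Membership in a span of functions restricted to \<open>Z\<close>. The coefficients are
  the same at all points of \<open>Z\<close>, so a linear relation among coefficient vectors becomes
  one identity valid on all of \<open>Z\<close>.\<close>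

definition lincomb :: "'j set \<Rightarrow> ('j \<Rightarrow> 'z \<Rightarrow> real) \<Rightarrow> 'z set \<Rightarrow> ('z \<Rightarrow> real) \<Rightarrow> bool" where
  "lincomb I b Z g \<longleftrightarrow> (\<exists>c. \<forall>z\<in>Z. g z = (\<Sum>j\<in>I. c j * b j z))"

lemma lincomb_basis: "finite I \<Longrightarrow> j \<in> I \<Longrightarrow> lincomb I b Z (b j)"
  unfolding lincomb_def by (rule exI[of _ "\<lambda>k. if k = j then 1 else 0"]) (simp add: if_distrib[of "\<lambda>x. x * _"] cong: if_cong)

lemma lincomb_add: "lincomb I b Z f \<Longrightarrow> lincomb I b Z g \<Longrightarrow> lincomb I b Z (\<lambda>z. f z + g z)"
  unfolding lincomb_def by clarify (rule_tac x="\<lambda>j. c j + ca j" in exI, simp add: distrib_right sum.distrib)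

lemma lincomb_cmult: "lincomb I b Z f \<Longrightarrow> lincomb I b Z (\<lambda>z. k * f z)"
  unfolding lincomb_def by clarify (rule_tac x="\<lambda>j. k * c j" in exI, simp add: sum_distrib_left mult.assoc)

lemma lincomb_sum: "(\<And>i. i \<in> A \<Longrightarrow> lincomb I b Z (f i)) \<Longrightarrow> lincomb I b Z (\<lambda>z. \<Sum>i\<in>A. f i z)"
proof (induction A rule: infinite_finite_induct)
  case (insert x F)
  then show ?case by (simp add: lincomb_add)
qed (auto simp: lincomb_def intro!: exI[of _ "\<lambda>_. 0"])

lemma lincomb_cong: "lincomb I b Z f \<Longrightarrow> (\<And>z. z \<in> Z \<Longrightarrow> f z = g z) \<Longrightarrow> lincomb I b Z g"
  unfolding lincomb_def by auto

lemma lincomb_mult: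
  assumes "lincomb I b Z g" and "\<And>j. j \<in> I \<Longrightarrow> lincomb I' b Z (\<lambda>z. \<phi> z * b j z)"
  shows "lincomb I' b Z (\<lambda>z. \<phi> z * g z)"
proof -
  obtain c where c: "\<And>z. z \<in> Z \<Longrightarrow> g z = (\<Sum>j\<in>I. c j * b j z)" using assms(1) unfolding lincomb_def by blast
  have "lincomb I' b Z (\<lambda>z. \<Sum>j\<in>I. c j * (\<phi> z * b j z))"
    by (intro lincomb_sum lincomb_cmult assms(2))
  then show ?thesis by (rule lincomb_cong) (simp add: c sum_distrib_left mult_ac)
qed

definition monom_fun :: "nat \<times> ('n \<Rightarrow> nat) \<Rightarrow> (real ^ 'n::finite) \<times> real \<Rightarrow> real" where
  "monom_fun = (\<lambda>(k, u) (x, l). l ^ k * (\<Prod>i\<in>UNIV. x $ i ^ u i))"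

text \<open>The pair \<open>(k, u)\<close> stands for \<open>l\<^sup>k x\<^sup>u\<close>, where l is the multiplier. Giving l weight one makes the rewriting
  of \<open>x\<^sub>i\<^sup>N\<close> into \<open>a\<^sub>i + l * b\<^sub>i\<close> weight-nonincreasing, so the exponent of l is at most the degree.\<close>

definition reduced_monoms :: "nat \<Rightarrow> nat \<Rightarrow> (nat \<times> ('n::finite \<Rightarrow> nat)) set" where
  "reduced_monoms N d = {(k, u). (\<forall>i. u i < N) \<and> k + (\<Sum>i\<in>UNIV. u i) \<le> d}"

lemma finite_exponents: "finite {u :: 'n::finite \<Rightarrow> nat. \<forall>i. u i < N}"
  and card_exponents: "card {u :: 'n::finite \<Rightarrow> nat. \<forall>i. u i < N} = N ^ CARD('n)"
proof -
  have "{u :: 'n \<Rightarrow> nat. \<forall>i. u i < N} = PiE UNIV (\<lambda>_. {..<N})" by (auto simp: PiE_def)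
  then show "finite {u :: 'n::finite \<Rightarrow> nat. \<forall>i. u i < N}" "card {u :: 'n::finite \<Rightarrow> nat. \<forall>i. u i < N} = N ^ CARD('n)"
    by (simp_all add: finite_PiE card_PiE)
qed

lemma reduced_monoms_subset: "reduced_monoms N d \<subseteq> {..d} \<times> {u. \<forall>i. u i < N}"
  by (auto simp: reduced_monoms_def)

lemma finite_reduced_monoms: "finite (reduced_monoms N d)"
  using finite_subset[OF reduced_monoms_subset] finite_exponents by blast

lemma card_reduced_monoms:
  "card (reduced_monoms N d :: (nat \<times> ('n::finite \<Rightarrow> nat)) set) \<le> Suc d * N ^ CARD('n)"
  using card_mono[OF _ reduced_monoms_subset[where 'a = 'n and N = N and d = d]]
  by (simp add: card_cartesian_product card_exponents finite_exponents)

lemma prod_power_fun_upd: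
  fixes x :: "real ^ 'n::finite"
  shows "(\<Prod>j\<in>UNIV. x $ j ^ (u(i := k)) j) = x $ i ^ k * (\<Prod>j\<in>UNIV - {i}. x $ j ^ u j)"
  by (subst prod.remove[of _ i]) auto

lemma sum_fun_upd_nat:
  fixes u :: "'n::finite \<Rightarrow> nat"
  shows "(\<Sum>j\<in>UNIV. (u(i := k)) j) + u i = (\<Sum>j\<in>UNIV. u j) + k"
proof -
  have "(\<Sum>j\<in>UNIV. (u(i := k)) j) = k + (\<Sum>j\<in>UNIV - {i}. u j)" by (subst sum.remove[of _ i]) auto
  moreover have "(\<Sum>j\<in>UNIV. u j) = u i + (\<Sum>j\<in>UNIV - {i}. u j)" by (subst sum.remove[of _ i]) auto
  ultimately show ?thesis by simp
qed

lemma lincomb_power_param: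
  assumes "lincomb (reduced_monoms N e) monom_fun Z g" "e + k \<le> d"
  shows "lincomb (reduced_monoms N d) monom_fun Z (\<lambda>z. snd z ^ k * g z)"
  using assms(1)
proof (rule lincomb_mult)
  fix j :: "nat \<times> ('a \<Rightarrow> nat)" assume j: "j \<in> reduced_monoms N e"
  obtain k' u where ku: "j = (k', u)" by fastforce
  have "(k + k', u) \<in> reduced_monoms N d" using j assms(2) by (auto simp: reduced_monoms_def ku)
  from lincomb_basis[OF finite_reduced_monoms this, of monom_fun Z]
  show "lincomb (reduced_monoms N d) monom_fun Z (\<lambda>z. snd z ^ k * monom_fun j z)"
    by (rule lincomb_cong) (auto simp: monom_fun_def ku power_add split: prod.splits)
qed

text \<open>Rewriting \<open>x $ i ^ N\<close> produces the polynomials \<open>a i\<close> and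
  \<open>b i\<close>, which are not built from smaller parts of the given one, so rule induction
  alone does not suffice. They come with a lower degree, which the surrounding strong induction on
  \<open>d\<close> covers.\<close>

lemma polyfun_lincomb:
  fixes a b :: "'n::finite \<Rightarrow> real ^ 'n \<Rightarrow> real"
  assumes N: "N > 0" and a: "\<And>i. polyfun (N - 1) (a i)" and b: "\<And>i. polyfun (N - 1) (b i)"
    and Z: "\<And>x l i. (x, l) \<in> Z \<Longrightarrow> x $ i ^ N = a i x + l * b i x"
    and f: "polyfun d f"
  shows "lincomb (reduced_monoms N d) monom_fun Z (\<lambda>z. f (fst z))"
  using f
proof (induction d arbitrary: f rule: less_induct)
  case (less d)
  from less.prems less.IH show ?case
  proof (induction rule: polyfun.induct)
    case (const d c)
    have "(0, \<lambda>_. 0) \<in> reduced_monoms N d" using N by (auto simp: reduced_monoms_def)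
    from lincomb_cmult[OF lincomb_basis[OF finite_reduced_monoms this, of monom_fun Z], of c]
    show ?case by (rule lincomb_cong) (auto simp: monom_fun_def split: prod.splits)
  next
    case (add d f g)
    then show ?case by (intro lincomb_add) auto
  next
    case (mulvar d g i)
    note IH = mulvar.prems
    have "lincomb (reduced_monoms N d) monom_fun Z (\<lambda>z. g (fst z))" using IH[of d g] mulvar.hyps by simp
    then show ?case
    proof (rule lincomb_mult)
      fix j :: "nat \<times> ('n \<Rightarrow> nat)" assume j: "j \<in> reduced_monoms N d"
      obtain k u where ku: "j = (k, u)" by fastforce
      have u: "\<And>i. u i < N" "k + (\<Sum>i\<in>UNIV. u i) \<le> d" using j by (auto simp: reduced_monoms_def ku)
      have m: "(\<Prod>j\<in>UNIV. x $ j ^ u j) = x $ i ^ u i * (\<Prod>j\<in>UNIV - {i}. x $ j ^ u j)" for x :: "real ^ 'n"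
        by (subst prod.remove[of _ i]) auto
      show "lincomb (reduced_monoms N (Suc d)) monom_fun Z (\<lambda>z. fst z $ i * monom_fun j z)"
      proof (cases "Suc (u i) < N")
        case True
        have "(k, u(i := Suc (u i))) \<in> reduced_monoms N (Suc d)"
          using u True sum_fun_upd_nat[of u i "Suc (u i)"] by (auto simp: reduced_monoms_def)
        from lincomb_basis[OF finite_reduced_monoms this, of monom_fun Z] show ?thesis
          by (rule lincomb_cong) (auto simp: monom_fun_def ku prod_power_fun_upd m simp del: fun_upd_apply split: prod.splits)
      next
        case False
        then have ui: "N = Suc (u i)" using u(1)[of i] by simp
        define u' where "u' = u(i := 0)"
        define r where "r x = (\<Prod>j\<in>UNIV. x $ j ^ u' j)" for x :: "real ^ 'n"
        \<comment> \<open>Since \<open>N = Suc (u i)\<close>, this equals the degree of the monomial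
          with exponents \<open>u\<close>. So \<open>e + k\<close> is at most \<open>d\<close>,
          which permits the induction hypothesis and leaves room in \<open>Suc d\<close> for one
          more factor of the multiplier.\<close>
        define e where "e = (\<Sum>j\<in>UNIV. u' j) + (N - 1)"
        have r: "polyfun (\<Sum>j\<in>UNIV. u' j) r"
        proof -
          have "polyfun (u' j * 1) (\<lambda>x :: real ^ 'n. x $ j ^ u' j)" for j
            by (rule polyfun_power) (use polyfun_var[of 0 j] in simp)
          then show ?thesis unfolding r_def by (intro polyfun_prod) simp
        qed
        have e: "e + k \<le> d" using sum_fun_upd_nat[of u i 0] u(2) ui by (simp add: e_def u'_def)
        have "lincomb (reduced_monoms N e) monom_fun Z (\<lambda>z. r (fst z) * a i (fst z))"
          by (rule IH) (use e polyfun_mult[OF r a] in \<open>auto simp: e_def\<close>)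
        from lincomb_power_param[OF this, of k "Suc d"]
        have A: "lincomb (reduced_monoms N (Suc d)) monom_fun Z (\<lambda>z. snd z ^ k * (r (fst z) * a i (fst z)))"
          using e by simp
        have "lincomb (reduced_monoms N e) monom_fun Z (\<lambda>z. r (fst z) * b i (fst z))"
          by (rule IH) (use e polyfun_mult[OF r b] in \<open>auto simp: e_def\<close>)
        from lincomb_power_param[OF this, of "Suc k" "Suc d"]
        have B: "lincomb (reduced_monoms N (Suc d)) monom_fun Z (\<lambda>z. snd z ^ Suc k * (r (fst z) * b i (fst z)))"
          using e by simp
        from lincomb_add[OF A B] show ?thesis
        proof (rule lincomb_cong)
          fix z assume z: "z \<in> Z"
          obtain x l where xl: "z = (x, l)" by fastforce
          have "x $ i * monom_fun j z = l ^ k * r x * (x $ i ^ N)"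
            unfolding r_def u'_def by (simp only: xl ku monom_fun_def prod_power_fun_upd ui) (simp add: m[of x] mult_ac)
          also have "\<dots> = l ^ k * r x * (a i x + l * b i x)" using Z z xl by simp
          finally show "snd z ^ k * (r (fst z) * a i (fst z)) + snd z ^ Suc k * (r (fst z) * b i (fst z)) = fst z $ i * monom_fun j z"
            by (simp add: xl algebra_simps)
        qed
      qed
    qed
  qed
qed

text \<open>The \<open>K^2\<close> products \<open>F^i * G^j\<close> have degree at most
  \<open>2 * E * K\<close> and hence lie, on the critical set, in a span of at most
  \<open>(2 * E * K + 1) * N ^ CARD('n)\<close> monomials. The number of products grows
  quadratically in \<open>K\<close>, the dimension only linearly; the threshold for \<open>K\<close>
  does not see the coefficients of \<open>a\<close>, \<open>b\<close>, \<open>F\<close>,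
  \<open>G\<close>.\<close>

lemma algebraic_relation:
  fixes a b :: "'n::finite \<Rightarrow> real ^ 'n \<Rightarrow> real"
  assumes N: "N > 0" and a: "\<And>i. polyfun (N - 1) (a i)" and b: "\<And>i. polyfun (N - 1) (b i)"
    and F: "polyfun E F" and G: "polyfun E G" and K: "K > (2 * E + 1) * N ^ CARD('n)"
  obtains R :: "nat \<Rightarrow> nat \<Rightarrow> real" where "(\<Sum>i<K. \<Sum>j<K. \<bar>R i j\<bar>) = 1"
    "\<And>x l. (\<And>i. x $ i ^ N = a i x + l * b i x) \<Longrightarrow> (\<Sum>i<K. \<Sum>j<K. R i j * F x ^ i * G x ^ j) = 0"
proof -
  define Z where "Z = {(x, l). \<forall>i. x $ i ^ N = a i x + l * b i x}"
  define d where "d = 2 * E * K"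
  define I where "I = {..<K} \<times> {..<K}"
  have finI: "finite I" by (simp add: I_def)
  have "lincomb (reduced_monoms N d) monom_fun Z (\<lambda>z. F (fst z) ^ fst ij * G (fst z) ^ snd ij)" if "ij \<in> I" for ij
  proof (rule polyfun_lincomb[where f = "\<lambda>x. F x ^ fst ij * G x ^ snd ij", OF N a b])
    have "polyfun (fst ij * E + snd ij * E) (\<lambda>x. F x ^ fst ij * G x ^ snd ij)"
      by (intro polyfun_mult polyfun_power F G)
    moreover have "fst ij * E + snd ij * E \<le> K * E + K * E"
      using that by (intro add_mono mult_right_mono) (auto simp: I_def)
    then have "fst ij * E + snd ij * E \<le> d" by (simp add: d_def mult_ac)
    ultimately show "polyfun d (\<lambda>x. F x ^ fst ij * G x ^ snd ij)" by (rule polyfun_mono)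
  qed (auto simp: Z_def)
  then obtain c where c: "\<And>ij z. ij \<in> I \<Longrightarrow> z \<in> Z \<Longrightarrow>
      F (fst z) ^ fst ij * G (fst z) ^ snd ij = (\<Sum>j\<in>reduced_monoms N d. c ij j * monom_fun j z)"
    unfolding lincomb_def by metis
  have "card (reduced_monoms N d :: (nat \<times> ('n \<Rightarrow> nat)) set) \<le> Suc d * N ^ CARD('n)"
    by (rule card_reduced_monoms)
  also have "\<dots> \<le> K * ((2 * E + 1) * N ^ CARD('n))" using K by (auto simp: d_def algebra_simps)
  also have "\<dots> < K * K" using K by (intro mult_strict_left_mono) auto
  also have "\<dots> = card I" by (simp add: I_def)
  finally have "card (reduced_monoms N d :: (nat \<times> ('n \<Rightarrow> nat)) set) < card I" .
  from exists_linear_relation[OF finite_reduced_monoms finI this, of c]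
  obtain r where r: "\<exists>i\<in>I. r i \<noteq> 0" "\<And>j. j \<in> reduced_monoms N d \<Longrightarrow> (\<Sum>i\<in>I. r i * c i j) = 0" by blast
  define T where "T = (\<Sum>ij\<in>I. \<bar>r ij\<bar>)"
  have T: "T > 0" unfolding T_def using r(1) finI by (metis abs_ge_zero sum_pos2 zero_less_abs_iff)
  define R where "R i j = r (i, j) / T" for i j
  show ?thesis
  proof
    have "(\<Sum>i<K. \<Sum>j<K. \<bar>R i j\<bar>) = (\<Sum>ij\<in>I. \<bar>r ij\<bar> / T)"
      using T by (simp add: R_def I_def sum.cartesian_product split_def)
    then show "(\<Sum>i<K. \<Sum>j<K. \<bar>R i j\<bar>) = 1" using T by (simp add: sum_divide_distrib[symmetric] T_def[symmetric])
  next
    fix x l assume "\<And>i. x $ i ^ N = a i x + l * b i x"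
    then have z: "(x, l) \<in> Z" by (simp add: Z_def)
    have "(\<Sum>i<K. \<Sum>j<K. R i j * F x ^ i * G x ^ j) = (\<Sum>ij\<in>I. r ij * (F x ^ fst ij * G x ^ snd ij)) / T"
      by (simp add: R_def I_def sum.cartesian_product split_def sum_divide_distrib mult.assoc)
    also have "(\<Sum>ij\<in>I. r ij * (F x ^ fst ij * G x ^ snd ij)) =
        (\<Sum>ij\<in>I. r ij * (\<Sum>j\<in>reduced_monoms N d. c ij j * monom_fun j (x, l)))"
      using c[OF _ z] by (intro sum.cong) auto
    also have "\<dots> = (\<Sum>j\<in>reduced_monoms N d. (\<Sum>ij\<in>I. r ij * c ij j) * monom_fun j (x, l))"
      unfolding sum_distrib_left sum_distrib_right by (subst sum.swap) (simp add: mult_ac)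
    also have "\<dots> = 0" using r(2) by simp
    finally show "(\<Sum>i<K. \<Sum>j<K. R i j * F x ^ i * G x ^ j) = 0" by simp
  qed
qed

subsection \<open>Slopes of the roots of a bivariate polynomial\<close>

definition bieval :: "real poly poly \<Rightarrow> real \<Rightarrow> real \<Rightarrow> real" where
  "bieval R s y = poly (poly R [:y:]) s"

text \<open>The outer polynomial variable is y and the coefficients are polynomials in s. So
  \<open>pderiv\<close> is the partial derivative in y, and this is the one in s.\<close>

definition coeff_pderiv :: "real poly poly \<Rightarrow> real poly poly" where
  "coeff_pderiv R = map_poly pderiv R"

lemma bieval_0 [simp]: "bieval 0 s y = 0"
  and bieval_pCons [simp]: "bieval (pCons a R) s y = poly a s + y * bieval R s y"
  and bieval_add: "bieval (P + Q) s y = bieval P s y + bieval Q s y"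
  and bieval_mult: "bieval (P * Q) s y = bieval P s y * bieval Q s y"
  and bieval_smult: "bieval (smult a P) s y = poly a s * bieval P s y"
  by (simp_all add: bieval_def)

lemma coeff_pderiv_0 [simp]: "coeff_pderiv 0 = 0"
  and coeff_pderiv_pCons [simp]: "coeff_pderiv (pCons a R) = pCons (pderiv a) (coeff_pderiv R)"
  by (simp_all add: coeff_pderiv_def map_poly_pCons)

lemma has_derivative_bieval:
  "((\<lambda>z. bieval R (fst z) (snd z)) has_derivative
     (\<lambda>h. fst h * bieval (coeff_pderiv R) (fst z) (snd z) + snd h * bieval (pderiv R) (fst z) (snd z))) (at z within S)"
proof (induction R)
  case 0
  then show ?case by simp
next
  case (pCons a R)
  have "(poly a has_derivative (\<lambda>h. h * poly (pderiv a) (fst z))) (at (fst z))"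
    using poly_DERIV[of a "fst z"] by (simp add: has_field_derivative_def mult.commute[of _ "poly _ _"])
  then have p: "((\<lambda>z. poly a (fst z)) has_derivative (\<lambda>h. fst h * poly (pderiv a) (fst z))) (at z within S)"
    using has_derivative_compose[OF has_derivative_fst[OF has_derivative_ident]] by fastforce
  show ?case
    apply (simp add: pderiv_pCons)
    apply (rule has_derivative_eq_rhs)
     apply (rule has_derivative_add[OF p has_derivative_mult[OF has_derivative_snd[OF has_derivative_ident] pCons.IH]])
    apply (auto simp: algebra_simps bieval_add)
    done
qed

lemma continuous_on_bieval [continuous_intros]:
  assumes "continuous_on S f" "continuous_on S g"
  shows "continuous_on S (\<lambda>x. bieval R (f x) (g x))"
  by (induction R) (auto intro!: continuous_intros assms)

section \<open>Elimination of y and the slope dy/ds along roots\<close>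

text \<open>The Euclidean algorithm over the field of rational functions in s, with denominators
  cleared by pseudo-division. \<open>X\<close>, a nonzero element of least y-degree in the ideal of
  \<open>R\<close> and \<open>P\<close>, is a gcd up to factors in s; the cases are a constant gcd,
  a proper factor of \<open>R\<close>, and \<open>R\<close> itself.\<close>

lemma elimination_cases:
  fixes R P :: "real poly poly"
  assumes "R \<noteq> 0"
  obtains (coprime) A B h where "h \<noteq> 0" "A * R + B * P = [:h:]"
  | (split) a h q where "a \<noteq> 0" "smult a R = h * q" "degree h < degree R" "degree q < degree R"
  | (dvd) a b where "a \<noteq> 0" "smult a P = R * b"
proof -
  define I where "I = {X. \<exists>A B. X = A * R + B * P}"
  have RI: "R \<in> I" unfolding I_def by (auto intro: exI[of _ 1] exI[of _ 0])
  have PI: "P \<in> I" unfolding I_def by (auto intro: exI[of _ 1] exI[of _ 0])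
  obtain X where X: "X \<in> I" "X \<noteq> 0"
    and min: "\<And>Y. Y \<in> I \<Longrightarrow> Y \<noteq> 0 \<Longrightarrow> degree X \<le> degree Y"
    using ex_has_least_nat[of "\<lambda>X. X \<in> I \<and> X \<noteq> 0" R degree] RI assms by auto
  \<comment> \<open>The pseudo-remainder lies in the ideal and has smaller degree than
    \<open>X\<close>, so it vanishes by minimality.\<close>
  have div: "\<exists>a q. a \<noteq> 0 \<and> smult a Y = X * q" if Y: "Y \<in> I" for Y
  proof -
    obtain q r where qr: "pseudo_divmod Y X = (q, r)" by fastforce
    define a where "a = lead_coeff X ^ (Suc (degree Y) - degree X)"
    have a: "a \<noteq> 0" using X by (simp add: a_def)
    have e: "smult a Y = X * q + r" and r: "r = 0 \<or> degree r < degree X"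
      using pseudo_divmod[OF X(2) qr] by (simp_all add: a_def)
    obtain A B A' B' where AB: "Y = A * R + B * P" "X = A' * R + B' * P"
      using Y X unfolding I_def by auto
    have "r = (smult a A - A' * q) * R + (smult a B - B' * q) * P"
      using e unfolding AB by (simp add: algebra_simps smult_add_right) 
    then have "r \<in> I" unfolding I_def by blast
    with r min[of r] have "r = 0" by fastforce
    with e a show ?thesis by auto
  qed
  obtain a q where aq: "a \<noteq> 0" "smult a R = X * q" using div[OF RI] by blast
  obtain a' q' where aq': "a' \<noteq> 0" "smult a' P = X * q'" using div[OF PI] by blast
  have q0: "q \<noteq> 0" using aq assms by auto
  have deg: "degree R = degree X + degree q"
    using arg_cong[OF aq(2), of degree] aq(1) X q0 by (simp add: degree_mult_eq)
  consider "degree X = 0" | "0 < degree X" "degree q > 0" | "degree q = 0" by blast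
  then show ?thesis
  proof cases
    case 1
    then obtain h where h: "X = [:h:]" by (metis degree_eq_zeroE)
    obtain A B where AB: "X = A * R + B * P" using X unfolding I_def by auto
    have "h \<noteq> 0" using h X by auto
    then show ?thesis using coprime[of h A B] AB h by simp
  next
    case 2
    then show ?thesis using split[of a X q] aq deg by auto
  next
    case 3
    then obtain c where c: "q = [:c:]" by (metis degree_eq_zeroE)
    have "c \<noteq> 0" using c q0 by auto
    have "smult (a' * c) P = smult c (smult a' P)" by (simp add: mult.commute)
    also have "\<dots> = (X * q) * q'" using aq' c by (simp add: ac_simps)
    also have "\<dots> = R * smult a q'" using aq(2)[symmetric] by simp
    finally show ?thesis using dvd[of "a' * c" "smult a q'"] \<open>c \<noteq> 0\<close> aq' by auto
  qed
qed

lemma poly_nonzero_near_0: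
  fixes h :: "real poly"
  assumes "h \<noteq> 0"
  obtains s0 where "s0 > 0" "\<And>s. 0 < s \<Longrightarrow> s < s0 \<Longrightarrow> poly h s \<noteq> 0"
proof -
  have fin: "finite {s. poly h s = 0 \<and> s > 0}"
    using poly_roots_finite[OF assms] by (rule rev_finite_subset) auto
  define s0 where "s0 = Min (insert 1 {s. poly h s = 0 \<and> s > 0})"
  show ?thesis
  proof
    show "s0 > 0" unfolding s0_def using fin by (subst Min_gr_iff) auto
    show "poly h s \<noteq> 0" if "0 < s" "s < s0" for s
      using that fin unfolding s0_def by (subst (asm) Min_gr_iff) auto
  qed
qed


lemma eventually_pos_at_right_0:
  fixes f :: "real \<Rightarrow> real"
  assumes "(f has_real_derivative d) (at 0)" "f 0 = 0" "d > 0"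
  shows "eventually (\<lambda>t. f t > 0) (at_right 0)"
  using has_real_derivative_pos_inc_right[OF assms(1,3)] assms(2)
  unfolding eventually_at_right_field by auto

lemma bieval_line_has_derivative:
  "((\<lambda>t. bieval W (s + a * t) (y + b * t)) has_real_derivative (a * bieval (coeff_pderiv W) s y + b * bieval (pderiv W) s y)) (at 0)"
proof -
  have "((\<lambda>t::real. (s + a * t, y + b * t)) has_derivative (\<lambda>t. (a * t, b * t))) (at 0)"
    by (auto intro!: derivative_eq_intros)
  moreover have "((\<lambda>z. bieval W (fst z) (snd z)) has_derivative
     (\<lambda>h. fst h * bieval (coeff_pderiv W) s y + snd h * bieval (pderiv W) s y)) (at (s + a * 0, y + b * 0))"
    using has_derivative_bieval[of W "(s, y)" UNIV] by simp
  ultimately have "((\<lambda>t. bieval W (s + a * t) (y + b * t)) has_derivative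
     (\<lambda>t. a * t * bieval (coeff_pderiv W) s y + b * t * bieval (pderiv W) s y)) (at 0)"
    by (auto dest: has_derivative_compose)
  then show ?thesis
    unfolding has_field_derivative_def by (rule has_derivative_eq_rhs) (auto simp: algebra_simps)
qed

text \<open>Along the root, \<sigma> * y has slope \<open>w\<close> with \<open>w > c / s\<close>,
  where \<open>c / s\<close> is the slope of \<open>c * ln s\<close>. The root over
  \<open>s - t\<close> is caught between two lines of slopes \<open>k < w < k'\<close> by the
  intermediate value theorem, and \<open>k > c / s\<close> already makes the decrease of \<sigma> *
  y exceed that of \<open>c * ln s\<close>.\<close>

lemma steep_root_moves_left:
  fixes W :: "real poly poly"
  assumes sg: "\<sigma> = 1 \<or> \<sigma> = -1" and c: "c > 0" and s: "s > 0"
    and root: "bieval W s y = 0" and simple: "bieval (pderiv W) s y \<noteq> 0"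
    and steep: "\<sigma> * (- s * bieval (coeff_pderiv W) s y) * bieval (pderiv W) s y > c * (bieval (pderiv W) s y)\<^sup>2"
  shows "\<exists>k>0. eventually (\<lambda>t. \<exists>y'. \<bar>y' - y\<bar> \<le> k * t \<and> bieval W (s - t) y' = 0 \<and>
             \<sigma> * y' - c * ln (s - t) < \<sigma> * y - c * ln s) (at_right 0)"
proof -
  define p where "p = bieval (pderiv W) s y"
  define q where "q = bieval (coeff_pderiv W) s y"
  define w where "w = \<sigma> * (- q) / p"
  have p0: "p \<noteq> 0" using simple by (simp add: p_def)
  have "w * p\<^sup>2 * s > c * p\<^sup>2" 
    using steep p0 by (simp add: w_def p_def[symmetric] q_def[symmetric] power2_eq_square field_simps)
  then have ws: "w * s > c" using p0
    by (smt (verit) mult.assoc mult.commute mult_less_cancel_right zero_less_power2)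
  then have w: "w > c / s" using s by (simp add: field_simps)
  obtain k where k: "c / s < k" and kw: "k < w" using dense[OF w] by blast
  define k' where "k' = w + 1"
  have k': "k' > w" by (simp add: k'_def)
  have k0: "0 < k" using k c s by (smt (verit) divide_pos_pos)
  have q: "q = - \<sigma> * w * p" using sg p0 by (auto simp: w_def)
  have d1: "((\<lambda>t. \<sigma> * p * bieval W (s + (-1) * t) (y + (-\<sigma> * k) * t)) has_real_derivative
       \<sigma> * p * ((-1) * q + (-\<sigma> * k) * p)) (at 0)"
    unfolding p_def q_def by (intro DERIV_cmult bieval_line_has_derivative)
  have d2: "((\<lambda>t. - \<sigma> * p * bieval W (s + (-1) * t) (y + (-\<sigma> * k') * t)) has_real_derivative
       - \<sigma> * p * ((-1) * q + (-\<sigma> * k') * p)) (at 0)"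
    unfolding p_def q_def by (intro DERIV_cmult bieval_line_has_derivative)
  have ss: "\<sigma> * \<sigma> = 1" using sg by auto
  have v1: "\<sigma> * p * ((-1) * q + (-\<sigma> * k) * p) = (\<sigma> * \<sigma>) * (p\<^sup>2 * (w - k))"
    unfolding q by (simp add: power2_eq_square algebra_simps)
  have v2: "- \<sigma> * p * ((-1) * q + (-\<sigma> * k') * p) = (\<sigma> * \<sigma>) * (p\<^sup>2 * (k' - w))"
    unfolding q by (simp add: power2_eq_square algebra_simps)
  have e1: "eventually (\<lambda>t. \<sigma> * p * bieval W (s + (-1) * t) (y + (-\<sigma> * k) * t) > 0) (at_right 0)"
    using d1 by (rule eventually_pos_at_right_0) (use root v1 ss kw p0 in auto)
  have e2: "eventually (\<lambda>t. - \<sigma> * p * bieval W (s + (-1) * t) (y + (-\<sigma> * k') * t) > 0) (at_right 0)"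
    using d2 by (rule eventually_pos_at_right_0) (use root v2 ss k' p0 in auto)
  have d3: "((\<lambda>t. k * t + c * ln (s - t) - c * ln s) has_real_derivative (k - c / s)) (at 0)"
    using s by (auto intro!: derivative_eq_intros)
  have e3: "eventually (\<lambda>t. k * t + c * ln (s - t) - c * ln s > 0) (at_right 0)"
    using d3 by (rule eventually_pos_at_right_0) (use k in auto)
  have e4: "eventually (\<lambda>t::real. t > 0) (at_right 0)" by (simp add: eventually_at_right_less)
  have "eventually (\<lambda>t. \<exists>y'. \<bar>y' - y\<bar> \<le> k' * t \<and> bieval W (s - t) y' = 0 \<and>
             \<sigma> * y' - c * ln (s - t) < \<sigma> * y - c * ln s) (at_right 0)"
    using e1 e2 e3 e4
  proof eventually_elim
    case (elim t)
    \<comment> \<open>The factor \<sigma> * p normalises the signs: \<open>g\<close> is positive at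
      depth \<open>k * t\<close> and negative at depth \<open>k' * t\<close>.\<close>
    define g where "g u = \<sigma> * p * bieval W (s - t) (y - \<sigma> * u)" for u
    have "continuous_on {k * t..k' * t} g" unfolding g_def by (intro continuous_intros)
    moreover have "g (k * t) > 0" "g (k' * t) < 0"
      using elim by (simp_all add: g_def mult.assoc)
    moreover have "k * t \<le> k' * t" using kw k' elim by simp
    ultimately obtain u where u: "k * t \<le> u" "u \<le> k' * t" "g u = 0"
      using IVT2'[of g "k' * t" 0 "k * t"] by auto
    have "bieval W (s - t) (y - \<sigma> * u) = 0" using u(3) sg p0 by (auto simp: g_def)
    moreover have "0 \<le> u" using u(1) k0 elim by (smt (verit) mult_pos_pos)
    then have "\<bar>(y - \<sigma> * u) - y\<bar> \<le> k' * t" using sg u by auto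
    moreover have "\<sigma> * (y - \<sigma> * u) = \<sigma> * y - u" using ss by (simp add: algebra_simps)
    then have "\<sigma> * (y - \<sigma> * u) - c * ln (s - t) < \<sigma> * y - c * ln s" using u(1) elim by simp
    ultimately show ?case by blast
  qed
  moreover have "k' > 0" using k0 kw k' by simp
  ultimately show ?thesis by blast
qed

text \<open>If some root were steep, minimise \<open>\<sigma> * y - c * ln s\<close> over the steep roots with \<open>s \<ge> \<epsilon>\<close>: moving a steep
  root to the left decreases this function, so the minimum is attained at \<open>s = \<epsilon>\<close>, and then y is unbounded
  as \<epsilon> tends to 0.\<close>

lemma root_slope_small:
  fixes W :: "real poly poly"
  assumes c: "c > 0" and r: "r > 0"
    and simple: "\<And>s y. \<lbrakk>0 < s; s < s0; \<bar>y\<bar> \<le> r; bieval W s y = 0\<rbrakk> \<Longrightarrow> bieval (pderiv W) s y \<noteq> 0"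
    and slope: "\<And>s y. \<lbrakk>0 < s; s < s0; \<bar>y\<bar> \<le> r; bieval W s y = 0\<rbrakk> \<Longrightarrow>
        s * \<bar>bieval (coeff_pderiv W) s y\<bar> \<noteq> c * \<bar>bieval (pderiv W) s y\<bar>"
    and level: "\<And>s y. \<lbrakk>0 < s; s < s0; \<bar>y\<bar> = r\<rbrakk> \<Longrightarrow> bieval W s y \<noteq> 0"
    and at: "0 < S" "S < s0" "\<bar>Y\<bar> \<le> r" "bieval W S Y = 0"
  shows "S * \<bar>bieval (coeff_pderiv W) S Y\<bar> < c * \<bar>bieval (pderiv W) S Y\<bar>"
proof (rule ccontr)
  assume neg: "\<not> ?thesis"
  \<comment> \<open>Steepness, multiplied by the square of the y-derivative to avoid a quotient.
    \<open>J\<close> never vanishes at a root in range, so \<open>J \<ge> 0\<close> and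
    \<open>J > 0\<close> agree there: the first makes the set of steep roots closed, the second
    keeps nearby roots steep.\<close>
  define J where "J \<sigma> s y = \<sigma> * (- s * bieval (coeff_pderiv W) s y) * bieval (pderiv W) s y - c * (bieval (pderiv W) s y)\<^sup>2"
    for \<sigma> s y
  have J_nz: "J \<sigma> s y \<noteq> 0" if "\<sigma> = 1 \<or> \<sigma> = -1" "0 < s" "s < s0" "\<bar>y\<bar> \<le> r" "bieval W s y = 0" for \<sigma> s y
  proof
    assume "J \<sigma> s y = 0"
    then have "(\<sigma> * (- s * bieval (coeff_pderiv W) s y) - c * bieval (pderiv W) s y) * bieval (pderiv W) s y = 0"
      by (simp add: J_def power2_eq_square left_diff_distrib)
    then have "\<sigma> * (- s * bieval (coeff_pderiv W) s y) = c * bieval (pderiv W) s y"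
      using simple[OF that(2-5)] by simp
    then have "\<bar>\<sigma> * (- s * bieval (coeff_pderiv W) s y)\<bar> = \<bar>c * bieval (pderiv W) s y\<bar>" by simp
    then show False using slope[OF that(2-5)] that(1,2) c by (auto simp: abs_mult)
  qed
  obtain \<sigma> :: real where sg: "\<sigma> = 1 \<or> \<sigma> = -1" and J0: "J \<sigma> S Y > 0"
  proof -
    define \<sigma> :: real where "\<sigma> = (if - bieval (coeff_pderiv W) S Y * bieval (pderiv W) S Y \<ge> 0 then 1 else -1)"
    have "\<sigma> * (- S * bieval (coeff_pderiv W) S Y) * bieval (pderiv W) S Y = S * \<bar>bieval (coeff_pderiv W) S Y\<bar> * \<bar>bieval (pderiv W) S Y\<bar>"
    proof -
      have "\<sigma> * (- (bieval (coeff_pderiv W) S Y * bieval (pderiv W) S Y)) = \<bar>bieval (coeff_pderiv W) S Y * bieval (pderiv W) S Y\<bar>"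
        by (simp add: \<sigma>_def)
      then have "S * (\<sigma> * (- (bieval (coeff_pderiv W) S Y * bieval (pderiv W) S Y))) = S * \<bar>bieval (coeff_pderiv W) S Y * bieval (pderiv W) S Y\<bar>"
        by (rule arg_cong)
      then show ?thesis by (simp add: abs_mult mult_ac)
    qed
    also have "\<dots> \<ge> c * \<bar>bieval (pderiv W) S Y\<bar> * \<bar>bieval (pderiv W) S Y\<bar>"
      using neg by (intro mult_right_mono) auto
    finally have "J \<sigma> S Y \<ge> 0" by (simp add: J_def power2_eq_square)
    moreover have sg: "\<sigma> = 1 \<or> \<sigma> = -1" by (simp add: \<sigma>_def)
    ultimately show ?thesis using that J_nz[OF sg at] by force
  qed
  \<comment> \<open>Chosen so that \<open>c * ln s\<close> drops by \<open>2 * r + 1\<close> between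
    \<open>S\<close> and \<epsilon>, more than \<sigma> * y can vary on
    \<open>[-r, r]\<close>.\<close>
  define \<epsilon> where "\<epsilon> = S * exp (- (2 * r + 1) / c)"
  have "- (2 * r + 1) / c < 0" using r c by (intro divide_neg_pos) auto
  then have eps: "0 < \<epsilon>" "\<epsilon> < S" using at(1) by (simp_all add: \<epsilon>_def)
  have lne: "c * ln \<epsilon> = c * ln S - (2 * r + 1)" using at(1) c by (simp add: \<epsilon>_def ln_mult field_simps)
  define Z where "Z = {z \<in> {\<epsilon>..S} \<times> {-r..r}. bieval W (fst z) (snd z) = 0 \<and> J \<sigma> (fst z) (snd z) \<ge> 0}"
  have contJ: "continuous_on A (\<lambda>z. J \<sigma> (fst z) (snd z))" for A
    unfolding J_def by (intro continuous_intros)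
  have "closed ({\<epsilon>..S} \<times> {-r..r} \<inter> {z. bieval W (fst z) (snd z) = 0} \<inter> {z. J \<sigma> (fst z) (snd z) \<ge> 0})"
    by (intro closed_Int closed_Times closed_Collect_eq closed_Collect_le contJ continuous_intros)
  moreover have "Z = {\<epsilon>..S} \<times> {-r..r} \<inter> {z. bieval W (fst z) (snd z) = 0} \<inter> {z. J \<sigma> (fst z) (snd z) \<ge> 0}"
    by (auto simp: Z_def)
  ultimately have "closed Z" by simp
  moreover have "bounded Z"
    by (rule bounded_subset[of "{\<epsilon>..S} \<times> {-r..r}"]) (auto simp: Z_def intro: bounded_Times)
  ultimately have "compact Z" by (simp add: compact_eq_bounded_closed)
  moreover have inZ: "(S, Y) \<in> Z" using at eps J0 by (auto simp: Z_def)
  moreover have "continuous_on Z (\<lambda>z. \<sigma> * snd z - c * ln (fst z))"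
    using eps by (intro continuous_intros) (auto simp: Z_def)
  ultimately obtain z where z: "z \<in> Z"
    and zmin: "\<And>z'. z' \<in> Z \<Longrightarrow> \<sigma> * snd z - c * ln (fst z) \<le> \<sigma> * snd z' - c * ln (fst z')"
    using continuous_attains_inf[of Z "\<lambda>z. \<sigma> * snd z - c * ln (fst z)"] by blast
  define s y where "s = fst z" and "y = snd z"
  have sy: "\<epsilon> \<le> s" "s \<le> S" "\<bar>y\<bar> \<le> r" "bieval W s y = 0" "J \<sigma> s y \<ge> 0"
    using z by (auto simp: Z_def s_def y_def)
  have s0: "0 < s" "s < s0" using sy eps at by auto
  have J: "J \<sigma> s y > 0" using J_nz[OF sg s0 sy(3,4)] sy(5) by simp
  have yr: "\<bar>y\<bar> < r" using level[OF s0, of y] sy(3,4) by fastforce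
  show False
  proof (cases "s = \<epsilon>")
    case True
    have "\<sigma> * y - c * ln s \<le> \<sigma> * Y - c * ln S" using zmin[OF inZ] by (simp add: s_def y_def)
    moreover have "\<sigma> * y \<ge> - r" "\<sigma> * Y \<le> r" using sg yr at(3) by auto
    ultimately show False using True lne by simp
  next
    case False
    then have "s > \<epsilon>" using sy by simp
    have "\<sigma> * (- s * bieval (coeff_pderiv W) s y) * bieval (pderiv W) s y > c * (bieval (pderiv W) s y)\<^sup>2"
      using J by (simp add: J_def)
    from steep_root_moves_left[OF sg c s0(1) sy(4) simple[OF s0 sy(3,4)] this]
    obtain k where k: "k > 0" and ek: "eventually (\<lambda>t. \<exists>y'. \<bar>y' - y\<bar> \<le> k * t \<and> bieval W (s - t) y' = 0 \<and>
             \<sigma> * y' - c * ln (s - t) < \<sigma> * y - c * ln s) (at_right 0)" by blast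
    have "isCont (\<lambda>z. J \<sigma> (fst z) (snd z)) (s, y)"
      using contJ[of UNIV] by (simp add: continuous_on_eq_continuous_at)
    then have "((\<lambda>z. J \<sigma> (fst z) (snd z)) \<longlongrightarrow> J \<sigma> s y) (at (s, y))" by (simp add: isCont_def)
    from order_tendstoD(1)[OF this J] obtain d where d: "d > 0"
      and dJ: "\<And>z. z \<noteq> (s, y) \<Longrightarrow> dist z (s, y) < d \<Longrightarrow> J \<sigma> (fst z) (snd z) > 0"
      unfolding eventually_at by auto
    have "((\<lambda>t. t + k * t) \<longlongrightarrow> 0 + k * 0) (at_right (0::real))" by (intro tendsto_intros)
    then have e1: "eventually (\<lambda>t. t + k * t < d) (at_right (0::real))"
      using d by (auto dest: order_tendstoD)
    have "((\<lambda>t. k * t) \<longlongrightarrow> k * 0) (at_right (0::real))" by (intro tendsto_intros)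
    then have e2: "eventually (\<lambda>t. k * t < r - \<bar>y\<bar>) (at_right (0::real))"
      using yr order_tendstoD(2)[of "\<lambda>t. k * t" 0 _ "r - \<bar>y\<bar>"] by simp
    have e3: "eventually (\<lambda>t. t < s - \<epsilon>) (at_right (0::real))"
      using \<open>s > \<epsilon>\<close> by (auto simp: eventually_at_right_field intro!: exI[of _ "s - \<epsilon>"])
    have e4: "eventually (\<lambda>t::real. t > 0) (at_right 0)" by (simp add: eventually_at_right_less)
    have "eventually (\<lambda>t::real. False) (at_right 0)"
      using ek e1 e2 e3 e4
    proof eventually_elim
      case (elim t)
      then obtain y' where y': "\<bar>y' - y\<bar> \<le> k * t" "bieval W (s - t) y' = 0"
        "\<sigma> * y' - c * ln (s - t) < \<sigma> * y - c * ln s" by blast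
      have "dist (s - t, y') (s, y) \<le> \<bar>t\<bar> + \<bar>y' - y\<bar>"
        using sqrt_sum_squares_le_sum_abs[of t "y' - y"] by (simp add: dist_Pair_Pair dist_real_def)
      then have "dist (s - t, y') (s, y) < d" using y' elim by simp
      then have "J \<sigma> (s - t) y' > 0" using dJ[of "(s - t, y')"] elim by simp
      moreover have "\<bar>y'\<bar> \<le> r" using y' elim by linarith
      ultimately have "(s - t, y') \<in> Z" using elim y' sy by (auto simp: Z_def)
      from zmin[OF this] y'(3) show False by (simp add: s_def y_def)
    qed
    then show False by simp
  qed
qed


text \<open>Stated for all nearby roots instead of for a branch, so that no implicit function is needed.\<close>

definition slope_bounded :: "real \<Rightarrow> real poly poly \<Rightarrow> real \<Rightarrow> real \<Rightarrow> bool" where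
  "slope_bounded c R s y \<longleftrightarrow>
     (\<exists>d>0. \<forall>s' y'. \<bar>s' - s\<bar> < d \<and> \<bar>y' - y\<bar> < d \<and> bieval R s' y' = 0 \<longrightarrow> s * \<bar>y' - y\<bar> \<le> c * \<bar>s' - s\<bar>)"

lemma dist_le_abs_Pair: "dist (a, b) (s, y) \<le> \<bar>a - s\<bar> + \<bar>b - y\<bar>" for a b s y :: real
  using sqrt_sum_squares_le_sum_abs[of "a - s" "b - y"] by (simp add: dist_Pair_Pair dist_real_def)

lemma slope_bounded_nonroot:
  assumes "bieval R s y \<noteq> 0"
  shows "slope_bounded c R s y"
proof -
  have "continuous_on UNIV (\<lambda>z. bieval R (fst z) (snd z))" by (intro continuous_intros)
  then have "isCont (\<lambda>z. bieval R (fst z) (snd z)) (s, y)" by (simp add: continuous_on_eq_continuous_at)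
  then obtain d where d: "d > 0" "\<And>z. dist z (s, y) < d \<Longrightarrow> bieval R (fst z) (snd z) \<noteq> 0"
    using continuous_at_avoid[of "(s, y)" "\<lambda>z. bieval R (fst z) (snd z)" 0] assms
    by (auto simp: dist_commute)
  have "bieval R s' y' \<noteq> 0" if "\<bar>s' - s\<bar> < d / 2" "\<bar>y' - y\<bar> < d / 2" for s' y'
    using d(2)[of "(s', y')"] dist_le_abs_Pair[of s' y' s y] that by simp
  then show ?thesis using d(1) unfolding slope_bounded_def by (intro exI[of _ "d / 2"]) auto
qed

text \<open>Linearisation at the root: for another root nearby the two first-order terms cancel up
  to a small error, and the strict inequality in \<open>slope\<close> leaves room to absorb
  it.\<close>

lemma slope_bounded_simple_root:
  assumes root: "bieval W s y = 0" and s: "s > 0" and c: "c > 0"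
    and slope: "s * \<bar>bieval (coeff_pderiv W) s y\<bar> < c * \<bar>bieval (pderiv W) s y\<bar>"
  shows "slope_bounded c W s y"
proof -
  define A B where "A = \<bar>bieval (pderiv W) s y\<bar>" and "B = \<bar>bieval (coeff_pderiv W) s y\<bar>"
  \<comment> \<open>The relative error that uses up exactly the available slack: it solves
    \<open>s * (B + e) = c * (A - e)\<close>.\<close>
  define e where "e = (c * A - s * B) / (s + c)"
  have e: "e > 0" using slope s c by (simp add: e_def A_def B_def)
  have e2: "s * (B + e) = c * (A - e)" using s c by (simp add: e_def field_simps)
  have B0: "B \<ge> 0" by (simp add: B_def)
  have Ae: "A - e > 0"
  proof -
    have "s * (B + e) > 0" using s e B0 by simp
    then show ?thesis using e2 c by (simp add: zero_less_mult_iff)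
  qed
  have "((\<lambda>z. bieval W (fst z) (snd z)) has_derivative
     (\<lambda>h. fst h * bieval (coeff_pderiv W) s y + snd h * bieval (pderiv W) s y)) (at (s, y))"
    using has_derivative_bieval[of W "(s, y)" UNIV] by simp
  then obtain d where d: "d > 0" and D: "\<And>z. norm (z - (s, y)) < d \<Longrightarrow>
      norm (bieval W (fst z) (snd z) - bieval W s y - (fst (z - (s, y)) * bieval (coeff_pderiv W) s y + snd (z - (s, y)) * bieval (pderiv W) s y))
      \<le> e * norm (z - (s, y))"
    unfolding has_derivative_at_alt fst_conv snd_conv using e by blast
  have "s * \<bar>y' - y\<bar> \<le> c * \<bar>s' - s\<bar>"
    if "\<bar>s' - s\<bar> < d / 2" "\<bar>y' - y\<bar> < d / 2" and r': "bieval W s' y' = 0" for s' y'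
  proof -
    have n: "norm ((s', y') - (s, y)) \<le> \<bar>s' - s\<bar> + \<bar>y' - y\<bar>"
      using dist_le_abs_Pair[of s' y' s y] by (simp add: dist_norm)
    then have "norm ((s', y') - (s, y)) < d" using that by simp
    from D[OF this] have "\<bar>(s' - s) * bieval (coeff_pderiv W) s y + (y' - y) * bieval (pderiv W) s y\<bar> \<le> e * norm ((s', y') - (s, y))"
      using root r' by simp
    also have "\<dots> \<le> e * (\<bar>s' - s\<bar> + \<bar>y' - y\<bar>)" using n e by (intro mult_left_mono) auto
    finally have "\<bar>y' - y\<bar> * A \<le> \<bar>s' - s\<bar> * B + e * (\<bar>s' - s\<bar> + \<bar>y' - y\<bar>)"
      unfolding A_def B_def abs_mult[symmetric] by linarith
    then have "(A - e) * \<bar>y' - y\<bar> \<le> (B + e) * \<bar>s' - s\<bar>"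
      by (simp add: algebra_simps)
    then have "s * ((A - e) * \<bar>y' - y\<bar>) \<le> s * ((B + e) * \<bar>s' - s\<bar>)"
      using s by (intro mult_left_mono) auto
    also have "\<dots> = c * (A - e) * \<bar>s' - s\<bar>" using e2 by (simp add: mult.assoc[symmetric])
    finally have "(A - e) * (s * \<bar>y' - y\<bar>) \<le> (A - e) * (c * \<bar>s' - s\<bar>)"
      by (simp add: ac_simps)
    then show ?thesis using Ae by simp
  qed
  moreover have "d / 2 > 0" using d by simp
  ultimately show ?thesis unfolding slope_bounded_def by blast
qed

lemma slope_bounded_factors:
  assumes a: "smult a R = h * q" and nz: "\<And>s'. \<lbrakk>0 < s'; s' < s0\<rbrakk> \<Longrightarrow> poly a s' \<noteq> 0"
    and s: "0 < s" "s < s0" and h: "slope_bounded c h s y" and q: "slope_bounded c q s y"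
  shows "slope_bounded c R s y"
proof -
  obtain d1 where d1: "d1 > 0" "\<And>s' y'. \<bar>s' - s\<bar> < d1 \<Longrightarrow> \<bar>y' - y\<bar> < d1 \<Longrightarrow> bieval h s' y' = 0 \<Longrightarrow> s * \<bar>y' - y\<bar> \<le> c * \<bar>s' - s\<bar>"
    using h unfolding slope_bounded_def by blast
  obtain d2 where d2: "d2 > 0" "\<And>s' y'. \<bar>s' - s\<bar> < d2 \<Longrightarrow> \<bar>y' - y\<bar> < d2 \<Longrightarrow> bieval q s' y' = 0 \<Longrightarrow> s * \<bar>y' - y\<bar> \<le> c * \<bar>s' - s\<bar>"
    using q unfolding slope_bounded_def by blast
  define d where "d = min (min d1 d2) (min s (s0 - s))"
  have "s * \<bar>y' - y\<bar> \<le> c * \<bar>s' - s\<bar>"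
    if *: "\<bar>s' - s\<bar> < d" "\<bar>y' - y\<bar> < d" "bieval R s' y' = 0" for s' y'
  proof -
    have "bieval h s' y' = 0 \<or> bieval q s' y' = 0"
      using *(3) arg_cong[OF a, of "\<lambda>X. bieval X s' y'"] by (simp add: bieval_smult bieval_mult)
    moreover have "\<bar>s' - s\<bar> < d1" "\<bar>y' - y\<bar> < d1" "\<bar>s' - s\<bar> < d2" "\<bar>y' - y\<bar> < d2"
      using * by (auto simp: d_def)
    ultimately show ?thesis using d1(2) d2(2) by blast
  qed
  moreover have "d > 0" using d1 d2 s by (simp add: d_def)
  ultimately show ?thesis unfolding slope_bounded_def by blast
qed

text \<open>At a simple root dy/ds is minus the quotient of the s- and y-derivatives, so this
  combination vanishes there exactly when the slope is \<open>k / s\<close>, that is, when y has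
  derivative k with respect to \<open>ln s\<close>.\<close>

definition euler_comb :: "real \<Rightarrow> real poly poly \<Rightarrow> real poly poly" where
  "euler_comb k R = smult [:0, 1:] (coeff_pderiv R) + smult [:k:] (pderiv R)"

lemma bieval_euler_comb: "bieval (euler_comb k R) s y = s * bieval (coeff_pderiv R) s y + k * bieval (pderiv R) s y"
  by (simp add: euler_comb_def bieval_add bieval_smult)

lemma not_dvd_pderiv:
  fixes R :: "real poly poly"
  assumes "degree R > 0" "a \<noteq> 0"
  shows "smult a (pderiv R) \<noteq> R * b"
proof
  assume eq: "smult a (pderiv R) = R * b"
  have "pderiv R \<noteq> 0" using assms(1) by (simp add: pderiv_eq_0_iff)
  then have "R * b \<noteq> 0" using assms(2) eq[symmetric] by simp
  then have "degree (R * b) \<ge> degree R" by (subst degree_mult_eq) auto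
  moreover have "degree (smult a (pderiv R)) < degree R" using assms by (simp add: degree_pderiv)
  ultimately show False using eq by simp
qed

text \<open>Subtracting the two divisibilities cancels the s-derivative. What remains would make
  \<open>R\<close> divide a nonzero multiple of its y-derivative, which has smaller degree in
  y.\<close>

lemma euler_comb_dvd_unique:
  assumes "degree R > 0" "a1 \<noteq> 0" "a2 \<noteq> 0"
    and 1: "smult a1 (euler_comb k1 R) = R * b1" and 2: "smult a2 (euler_comb k2 R) = R * b2"
  shows "k1 = k2"
proof (rule ccontr)
  assume k: "k1 \<noteq> k2"
  have "smult (a1 * a2 * [:k1 - k2:]) (pderiv R) = smult (a1 * a2) (euler_comb k1 R - euler_comb k2 R)"
    by (simp add: euler_comb_def smult_diff_left[symmetric] del: smult_diff_left) 
  also have "\<dots> = smult a2 (smult a1 (euler_comb k1 R)) - smult a1 (smult a2 (euler_comb k2 R))"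
    by (simp add: smult_diff_right mult.commute)
  also have "\<dots> = R * (smult a2 b1 - smult a1 b2)"
    unfolding 1 2 by (simp add: right_diff_distrib)
  finally show False using not_dvd_pderiv[OF assms(1)] k assms(2,3) by auto
qed

text \<open>Induction on the degree in y. A polynomial R that does not split is coprime to its derivative in y, and
  it can divide \<open>s * R\<^sub>s + k * R\<^sub>y\<close> for at most one k; hence for some \<open>k < c\<close> no root has slope exactly \<open>\<plusminus> k/s\<close>
  when s is small.\<close>

lemma roots_slope_bounded:
  fixes R :: "real poly poly"
  assumes c: "c > 0" and "R \<noteq> 0"
  shows "\<exists>s0>0. \<forall>s y. 0 < s \<and> s < s0 \<and> \<bar>y\<bar> \<le> 1 \<longrightarrow> slope_bounded c R s y"
  using \<open>R \<noteq> 0\<close>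
proof (induction "degree R" arbitrary: R rule: less_induct)
  case less
  show ?case
  proof (cases "\<exists>a h q. a \<noteq> 0 \<and> smult a R = h * q \<and> degree h < degree R \<and> degree q < degree R")
    case True
    then obtain a h q where ahq: "a \<noteq> 0" "smult a R = h * q" "degree h < degree R" "degree q < degree R"
      by blast
    have "h \<noteq> 0" "q \<noteq> 0" using ahq less.prems by auto
    then obtain s1 s2 where s1: "s1 > 0" "\<And>s y. 0 < s \<and> s < s1 \<and> \<bar>y\<bar> \<le> 1 \<Longrightarrow> slope_bounded c h s y"
      and s2: "s2 > 0" "\<And>s y. 0 < s \<and> s < s2 \<and> \<bar>y\<bar> \<le> 1 \<Longrightarrow> slope_bounded c q s y"
      using less.hyps[OF ahq(3)] less.hyps[OF ahq(4)] by metis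
    obtain s3 where s3: "s3 > 0" "\<And>s. 0 < s \<Longrightarrow> s < s3 \<Longrightarrow> poly a s \<noteq> 0"
      using poly_nonzero_near_0[OF ahq(1)] by blast
    have "slope_bounded c R s y" if "0 < s" "s < min s1 (min s2 s3)" "\<bar>y\<bar> \<le> 1" for s y
      by (rule slope_bounded_factors[OF ahq(2) s3(2)]) (use that s1(2) s2(2) in auto)
    moreover have "min s1 (min s2 s3) > 0" using s1 s2 s3 by simp
    ultimately show ?thesis by blast
  next
    case nosplit: False
    show ?thesis
    proof (cases "degree R = 0")
      case True
      then obtain h where h: "R = [:h:]" by (metis degree_eq_zeroE)
      then have "h \<noteq> 0" using less.prems by auto
      then obtain s1 where "s1 > 0" "\<And>s. 0 < s \<Longrightarrow> s < s1 \<Longrightarrow> poly h s \<noteq> 0"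
        using poly_nonzero_near_0 by blast
      then show ?thesis using h by (intro exI[of _ s1]) (auto intro!: slope_bounded_nonroot)
    next
      case False
      then have deg: "degree R > 0" by simp
      \<comment> \<open>With splitting and divisibility excluded, elimination leaves a combination
        of \<open>R\<close> and \<open>P\<close> equal to a nonzero polynomial \<open>h\<close> in s
        alone; common roots need \<open>h\<close> to vanish, which does not happen for small
        positive s.\<close>
      have coprime: "\<exists>s1>0. \<forall>s y. 0 < s \<and> s < s1 \<and> bieval R s y = 0 \<longrightarrow> bieval P s y \<noteq> 0"
        if nd: "\<not> (\<exists>a b. a \<noteq> 0 \<and> smult a P = R * b)" for P
      proof (rule elimination_cases[OF less.prems, of P])
        fix A B h assume h: "h \<noteq> 0" "A * R + B * P = [:h:]"
        obtain s1 where "s1 > 0" "\<And>s. 0 < s \<Longrightarrow> s < s1 \<Longrightarrow> poly h s \<noteq> 0"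
          using poly_nonzero_near_0[OF h(1)] by blast
        moreover have "poly h s = 0" if "bieval R s y = 0" "bieval P s y = 0" for s y
          using arg_cong[OF h(2), of "\<lambda>X. bieval X s y"] that by (simp add: bieval_add bieval_mult)
        ultimately show ?thesis by blast
      qed (use nd nosplit in blast)+
      define bad where "bad k \<longleftrightarrow> (\<exists>a b. a \<noteq> 0 \<and> smult a (euler_comb k R) = R * b)" for k
      have bad: "bad k1 \<Longrightarrow> bad k2 \<Longrightarrow> k1 = k2" for k1 k2
        unfolding bad_def using euler_comb_dvd_unique[OF deg] by blast
      \<comment> \<open>Of the four numbers \<open>c/2\<close>, \<open>-c/2\<close>,
        \<open>c/3\<close>, \<open>-c/3\<close> at most one is bad, so one of the two pairs is free
        of bad ones.\<close>
      obtain k where k: "0 < k" "k < c" "\<not> bad k" "\<not> bad (- k)"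
      proof (cases "bad (c / 2) \<or> bad (- (c / 2))")
        case True
        have "c / 2 \<noteq> c / 3" "c / 2 \<noteq> - (c / 3)" "- (c / 2) \<noteq> c / 3" "- (c / 2) \<noteq> - (c / 3)"
          using c by auto
        with True have "\<not> bad (c / 3)" "\<not> bad (- (c / 3))" using bad by blast+
        moreover have "0 < c / 3" "c / 3 < c" using c by auto
        ultimately show ?thesis using that[of "c / 3"] by blast
      next
        case False
        moreover have "0 < c / 2" "c / 2 < c" using c by auto
        ultimately show ?thesis using that[of "c / 2"] by blast
      qed
      have nd0: "\<not> (\<exists>a b. a \<noteq> 0 \<and> smult a (pderiv R) = R * b)"
        using not_dvd_pderiv[OF deg] by blast
      obtain s1 where s1: "s1 > 0" "\<And>s y. 0 < s \<Longrightarrow> s < s1 \<Longrightarrow> bieval R s y = 0 \<Longrightarrow> bieval (pderiv R) s y \<noteq> 0"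
        using coprime[OF nd0] by blast
      obtain s2 where s2: "s2 > 0" "\<And>s y. 0 < s \<Longrightarrow> s < s2 \<Longrightarrow> bieval R s y = 0 \<Longrightarrow> bieval (euler_comb k R) s y \<noteq> 0"
        using coprime[OF k(3)[unfolded bad_def]] by blast
      obtain s3 where s3: "s3 > 0" "\<And>s y. 0 < s \<Longrightarrow> s < s3 \<Longrightarrow> bieval R s y = 0 \<Longrightarrow> bieval (euler_comb (- k) R) s y \<noteq> 0"
        using coprime[OF k(4)[unfolded bad_def]] by blast
      \<comment> \<open>A level \<open>r\<close> slightly above 1 such that \<open>R\<close> at
        \<open>y = r\<close> and at \<open>y = -r\<close> is a nonzero polynomial in s; then no root
        crosses these levels for small s.\<close>
      have "finite {r. poly R [:r:] = 0}"
        using finite_vimageI[OF poly_roots_finite[OF less.prems], of "\<lambda>r. [:r:]"]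
        by (auto simp: vimage_def inj_def)
      moreover have "finite {r. poly R [:- r:] = 0}"
        using finite_vimageI[OF poly_roots_finite[OF less.prems], of "\<lambda>r. [:- r:]"]
        by (auto simp: vimage_def inj_def)
      moreover have "infinite {1<..<2::real}" by simp
      ultimately have "\<exists>r\<in>{1<..<2}. r \<notin> {r. poly R [:r:] = 0} \<union> {r. poly R [:- r:] = 0}"
        using finite_subset[of "{1<..<2::real}" "{r. poly R [:r:] = 0} \<union> {r. poly R [:- r:] = 0}"] by blast
      then obtain r where r: "r > 1" "poly R [:r:] \<noteq> 0" "poly R [:- r:] \<noteq> 0" by auto
      obtain s4 where s4: "s4 > 0" "\<And>s. 0 < s \<Longrightarrow> s < s4 \<Longrightarrow> bieval R s r \<noteq> 0"
        using poly_nonzero_near_0[OF r(2)] unfolding bieval_def by blast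
      obtain s5 where s5: "s5 > 0" "\<And>s. 0 < s \<Longrightarrow> s < s5 \<Longrightarrow> bieval R s (- r) \<noteq> 0"
        using poly_nonzero_near_0[OF r(3)] unfolding bieval_def by blast
      define s0 where "s0 = min (min s1 s2) (min s3 (min s4 s5))"
      have less: "s * \<bar>bieval (coeff_pderiv R) s y\<bar> < k * \<bar>bieval (pderiv R) s y\<bar>"
        if "0 < s" "s < s0" "\<bar>y\<bar> \<le> r" "bieval R s y = 0" for s y
      proof (rule root_slope_small[where ?s0.0 = s0 and r = r])
        show "s * \<bar>bieval (coeff_pderiv R) s y\<bar> \<noteq> k * \<bar>bieval (pderiv R) s y\<bar>"
          if *: "0 < s" "s < s0" "\<bar>y\<bar> \<le> r" "bieval R s y = 0" for s y
        proof
          assume eq: "s * \<bar>bieval (coeff_pderiv R) s y\<bar> = k * \<bar>bieval (pderiv R) s y\<bar>"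
          have "\<bar>s * bieval (coeff_pderiv R) s y\<bar> = \<bar>k * bieval (pderiv R) s y\<bar>" using eq * k by (simp add: abs_mult)
          then have "s * bieval (coeff_pderiv R) s y = k * bieval (pderiv R) s y \<or> s * bieval (coeff_pderiv R) s y = - (k * bieval (pderiv R) s y)"
            by (simp only: abs_eq_iff)
          moreover have "bieval (euler_comb k R) s y \<noteq> 0" "bieval (euler_comb (- k) R) s y \<noteq> 0"
            using s2(2)[of s y] s3(2)[of s y] * by (simp_all add: s0_def)
          ultimately show False by (auto simp: bieval_euler_comb)
        qed
        show "bieval R s y \<noteq> 0" if "0 < s" "s < s0" "\<bar>y\<bar> = r" for s y
        proof -
          have "y = r \<or> y = - r" using that(3) by linarith
          then show ?thesis using that s4(2)[of s] s5(2)[of s] by (auto simp: s0_def)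
        qed
        show "bieval (pderiv R) s y \<noteq> 0" if "0 < s" "s < s0" "bieval R s y = 0" for s y
          using that s1(2)[of s y] by (simp add: s0_def)
      qed (use that k r in simp_all)
      have "slope_bounded c R s y" if "0 < s" "s < s0" "\<bar>y\<bar> \<le> 1" for s y
      proof (cases "bieval R s y = 0")
        case True
        have "k * \<bar>bieval (pderiv R) s y\<bar> \<le> c * \<bar>bieval (pderiv R) s y\<bar>" using k by (intro mult_right_mono) auto
        then show ?thesis using less[of s y] True that r c
          by (intro slope_bounded_simple_root) auto
      qed (rule slope_bounded_nonroot)
      moreover have "s0 > 0" using s1 s2 s3 s4 s5 by (simp add: s0_def)
      ultimately show ?thesis by blast
    qed
  qed
qed

subsection \<open>Sizes of the small roots of a bivariate polynomial\<close>

text \<open>\<open>L\<close> and \<open>V\<close> are the logarithms of s and v. Two comparable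
  terms force \<beta> * V to be within \<open>m\<close> of \<alpha> * L with integers \<alpha> and
  \<beta>, and integrality leaves only \<alpha> \<ge> 2 * \<beta> or \<alpha> \<le> 2 * \<beta> - 1.
  The bound \<open>L < - m\<close> excludes \<beta> = 0, since different powers of s alone are not
  comparable.\<close>

lemma log_two_terms:
  fixes L V m :: real and a b a' b' K :: nat
  assumes ne: "(a, b) \<noteq> (a', b')" and m: "m \<ge> 0" and L: "L < - m" and b: "b < K" "b' \<le> b"
    and le: "\<bar>(real a - real a') * L + (real b - real b') * V\<bar> \<le> m"
  shows "V \<le> 2 * L + m \<or> V \<ge> (2 - 1 / real K) * L - m"
proof (cases "b = b'")
  case True
  then have "\<bar>real a - real a'\<bar> \<ge> 1" using ne by auto
  then have "\<bar>real a - real a'\<bar> * (- L) \<ge> 1 * (- L)" using L m by (intro mult_right_mono) auto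
  then have "\<bar>(real a - real a') * L\<bar> \<ge> - L" using L m by (simp add: abs_mult)
  then show ?thesis using le True L by simp
next
  case False
  define \<beta> where "\<beta> = real b - real b'"
  define \<alpha> where "\<alpha> = real a' - real a"
  have b1: "\<beta> \<ge> 1" "\<beta> \<le> real K" using b False by (auto simp: \<beta>_def)
  have le': "\<bar>\<beta> * V - \<alpha> * L\<bar> \<le> m" using le by (simp add: \<alpha>_def \<beta>_def algebra_simps)
  have mb: "m \<le> \<beta> * m" using b1 m mult_right_mono[of 1 \<beta> m] by simp
  have "\<alpha> \<ge> 2 * \<beta> \<or> \<alpha> \<le> 2 * \<beta> - 1"
  proof (cases "2 * b + a \<le> a' + 2 * b'")
    case True
    then have "real (2 * b + a) \<le> real (a' + 2 * b')" by (rule of_nat_mono)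
    then show ?thesis by (simp add: \<alpha>_def \<beta>_def)
  next
    case False
    then have "real (a' + 2 * b' + 1) \<le> real (2 * b + a)" by (intro of_nat_mono) simp
    then show ?thesis by (simp add: \<alpha>_def \<beta>_def)
  qed
  then show ?thesis
  proof
    assume "\<alpha> \<ge> 2 * \<beta>"
    then have "\<alpha> * L \<le> 2 * \<beta> * L" using L m by (intro mult_right_mono_neg) auto
    then have "\<beta> * V \<le> \<beta> * (2 * L + m)" using le' mb by (simp add: algebra_simps)
    then show ?thesis using b1 by simp
  next
    assume "\<alpha> \<le> 2 * \<beta> - 1"
    then have "\<alpha> * L \<ge> (2 * \<beta> - 1) * L" using L m by (intro mult_right_mono_neg) auto
    moreover have "(2 * \<beta> - 1) * L \<ge> \<beta> * (2 - 1 / real K) * L"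
    proof (rule mult_right_mono_neg)
      show "2 * \<beta> - 1 \<le> \<beta> * (2 - 1 / real K)" using b1 by (simp add: field_simps)
    qed (use L m in simp)
    ultimately have "\<beta> * V \<ge> \<beta> * ((2 - 1 / real K) * L - m)"
      using le' mb by (simp add: algebra_simps)
    then show ?thesis using b1 by simp
  qed
qed

text \<open>The largest term is cancelled by the sum of the others, so one of these is at least its
  \<open>N\<close>-th part.\<close>

lemma comparable_terms:
  fixes t :: "'a \<Rightarrow> real"
  assumes fin: "finite T" and ne: "T \<noteq> {}" and nz: "\<And>x. x \<in> T \<Longrightarrow> t x \<noteq> 0" and sum: "sum t T = 0"
    and N: "real (card T) \<le> N"
  obtains x y where "x \<in> T" "y \<in> T" "x \<noteq> y" "\<bar>t x\<bar> \<le> N * \<bar>t y\<bar>" "\<bar>t y\<bar> \<le> \<bar>t x\<bar>"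
proof -
  obtain x where x: "x \<in> T" "\<And>y. y \<in> T \<Longrightarrow> \<bar>t y\<bar> \<le> \<bar>t x\<bar>"
    using Max_in[of "(\<lambda>y. \<bar>t y\<bar>) ` T"] Max_ge[of "(\<lambda>y. \<bar>t y\<bar>) ` T"] fin ne by fastforce
  have "\<exists>y\<in>T - {x}. \<bar>t x\<bar> \<le> N * \<bar>t y\<bar>"
  proof (rule ccontr)
    assume "\<not> ?thesis"
    then have less: "\<And>y. y \<in> T - {x} \<Longrightarrow> N * \<bar>t y\<bar> \<le> \<bar>t x\<bar>" by (meson linear)
    have N0: "N > 0" using N fin ne by (smt (verit) card_gt_0_iff of_nat_0_less_iff)
    have "t x = - sum t (T - {x})" using sum x(1) fin by (simp add: sum.remove)
    then have "\<bar>t x\<bar> \<le> (\<Sum>y\<in>T - {x}. \<bar>t y\<bar>)" by (simp add: sum_abs)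
    then have "N * \<bar>t x\<bar> \<le> N * (\<Sum>y\<in>T - {x}. \<bar>t y\<bar>)" using N0 by simp
    also have "\<dots> = (\<Sum>y\<in>T - {x}. N * \<bar>t y\<bar>)" by (simp add: sum_distrib_left)
    also have "\<dots> \<le> (\<Sum>y\<in>T - {x}. \<bar>t x\<bar>)" by (intro sum_mono less)
    also have "\<dots> = (real (card T) - 1) * \<bar>t x\<bar>"
      using fin x(1) ne by (simp add: of_nat_diff Suc_leI card_gt_0_iff)
    finally have "N * \<bar>t x\<bar> \<le> (real (card T) - 1) * \<bar>t x\<bar>" .
    then show False using N nz[OF x(1)] by simp
  qed
  then show ?thesis using that x by blast
qed

text \<open>Two comparable terms of the vanishing sum fix the size of \<open>v\<close> up to a
  constant factor, as a power of \<open>s\<close>; the gap between the exponents 2 and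
  \<open>2 - 1/K\<close> is that of \<open>log_two_terms\<close>.\<close>

lemma small_root_dichotomy:
  fixes R :: "nat \<Rightarrow> nat \<Rightarrow> real"
  assumes nz: "a0 < K" "b0 < K" "R a0 b0 \<noteq> 0"
  shows "\<exists>C s0. C > 0 \<and> s0 > 0 \<and>
    (\<forall>s v. 0 < s \<longrightarrow> s < s0 \<longrightarrow> v \<ge> 0 \<longrightarrow> (\<Sum>a<K. \<Sum>b<K. R a b * s ^ a * v ^ b) = 0 \<longrightarrow>
        v \<le> C * s\<^sup>2 \<or> v \<ge> s powr (2 - 1 / real K) / C)"
proof -
  define T where "T = {(a, b). a < K \<and> b < K \<and> R a b \<noteq> 0}"
  have Tsub: "T \<subseteq> {..<K} \<times> {..<K}" by (auto simp: T_def)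
  then have fin: "finite T" by (rule finite_subset) auto
  have ne: "T \<noteq> {}" using nz by (auto simp: T_def)
  have card: "card T \<le> K * K" using card_mono[OF _ Tsub] by simp
  define A where "A = (\<lambda>(a, b). \<bar>R a b\<bar>)"
  define rmax where "rmax = Max (A ` T)"
  define rmin where "rmin = Min (A ` T)"
  have Apos: "A x > 0" if "x \<in> T" for x using that by (auto simp: A_def T_def)
  have bnd: "rmin \<le> A x" "A x \<le> rmax" if "x \<in> T" for x
    using that fin by (auto simp: rmin_def rmax_def)
  have rmin: "rmin > 0" unfolding rmin_def using fin ne Apos by (subst Min_gr_iff) auto
  have rr: "rmin \<le> rmax" using bnd ne by force
  define N where "N = real (K * K)"
  have N1: "N \<ge> 1" using nz by (cases K) (simp_all add: N_def)
  \<comment> \<open>Bounds the ratio, in both directions, of the two monomials without their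
    coefficients: \<open>N\<close> from the number of terms, \<open>rmax / rmin\<close> from the
    coefficients. The range \<open>s < exp (- m)\<close> is \<open>s < 1 / M\<close>.\<close>
  define M where "M = N * rmax / rmin"
  have M1: "M \<ge> 1" using mult_mono[of 1 N rmin rmax] N1 rr rmin by (simp add: M_def field_simps)
  define m where "m = ln M"
  have m: "m \<ge> 0" using M1 by (simp add: m_def)
  show ?thesis
  proof (rule exI[of _ M], rule exI[of _ "exp (- m)"], intro conjI allI impI)
    show "M > 0" using M1 by simp
    show "exp (- m) > 0" by simp
    fix s v :: real
    assume s: "0 < s" "s < exp (- m)" and v: "v \<ge> 0"
      and 0: "(\<Sum>a<K. \<Sum>b<K. R a b * s ^ a * v ^ b) = 0"
    show "v \<le> M * s\<^sup>2 \<or> v \<ge> s powr (2 - 1 / real K) / M"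
    proof (cases "v = 0")
      case True
      then show ?thesis using M1 by simp
    next
      case False
      then have v: "v > 0" using v by simp
      define P where "P = (\<lambda>(a, b). s ^ a * v ^ b :: real)"
      define t where "t = (\<lambda>(a, b). R a b * s ^ a * v ^ b)"
      have Ppos: "P x > 0" for x using s v by (auto simp: P_def split: prod.splits)
      have tA: "\<bar>t x\<bar> = A x * P x" for x using s v by (auto simp: t_def A_def P_def abs_mult split: prod.splits)
      have "sum t T = sum t ({..<K} \<times> {..<K})"
        by (rule sum.mono_neutral_left) (use Tsub in \<open>auto simp: T_def t_def\<close>)
      also have "\<dots> = 0" using 0 by (simp add: t_def sum.cartesian_product)
      finally have sum0: "sum t T = 0" .
      have tnz: "t x \<noteq> 0" if "x \<in> T" for x using that s v by (auto simp: t_def T_def)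
      have cN: "real (card T) \<le> N" using card unfolding N_def by (rule of_nat_mono)
      obtain x y where xy: "x \<in> T" "y \<in> T" "x \<noteq> y" "\<bar>t x\<bar> \<le> N * \<bar>t y\<bar>" "\<bar>t y\<bar> \<le> \<bar>t x\<bar>"
        using comparable_terms[OF fin ne tnz sum0 cN] by blast
      have "rmin * P x \<le> A x * P x" using bnd(1)[OF xy(1)] Ppos[of x] by (intro mult_right_mono) auto
      also have "\<dots> \<le> N * (A y * P y)" using xy(4) by (simp add: tA)
      also have "\<dots> \<le> N * (rmax * P y)"
        using bnd(2)[OF xy(2)] Ppos[of y] N1 by (intro mult_left_mono mult_right_mono) auto
      finally have Pxy: "P x \<le> M * P y" using rmin by (simp add: M_def field_simps)
      have "rmin * P y \<le> A y * P y" using bnd(1)[OF xy(2)] Ppos[of y] by (intro mult_right_mono) auto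
      also have "\<dots> \<le> A x * P x" using xy(5) by (simp add: tA)
      also have "\<dots> \<le> rmax * P x" using bnd(2)[OF xy(1)] Ppos[of x] by (intro mult_right_mono) auto
      also have "\<dots> \<le> N * (rmax * P x)" using N1 rmin rr Ppos[of x] by simp
      finally have Pyx: "P y \<le> M * P x" using rmin by (simp add: M_def field_simps)
      define L V where "L = ln s" and "V = ln v"
      have lnP: "ln (P (a, b)) = real a * L + real b * V" for a b
        using s v by (simp add: P_def L_def V_def ln_mult ln_realpow)
      have l1: "ln (P x) \<le> m + ln (P y)"
      proof -
        have "ln (P x) \<le> ln (M * P y)" using Pxy Ppos[of x] Ppos[of y] M1 by (subst ln_le_cancel_iff) auto
        then show ?thesis using Ppos[of y] M1 by (simp add: m_def ln_mult_pos)
      qed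
      have l2: "ln (P y) \<le> m + ln (P x)"
      proof -
        have "ln (P y) \<le> ln (M * P x)" using Pyx Ppos[of y] Ppos[of x] M1 by (subst ln_le_cancel_iff) auto
        then show ?thesis using Ppos[of x] M1 by (simp add: m_def ln_mult_pos)
      qed
      obtain a b a' b' where xy': "x = (a, b)" "y = (a', b')" by fastforce
      have bK: "b < K" "b' < K" using xy xy' by (auto simp: T_def)
      have "L < ln (exp (- m))" unfolding L_def using s by (subst ln_less_cancel_iff) auto
      then have Lm: "L < - m" by simp
      have "V \<le> 2 * L + m \<or> V \<ge> (2 - 1 / real K) * L - m"
      proof (cases "b' \<le> b")
        case True
        show ?thesis
          by (rule log_two_terms[of a b a' b', OF _ m Lm bK(1) True])
            (use xy(3) xy' l1 l2 in \<open>auto simp: lnP algebra_simps\<close>)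
      next
        case False
        then have "b \<le> b'" by simp
        show ?thesis
          by (rule log_two_terms[of a' b' a b, OF _ m Lm bK(2) \<open>b \<le> b'\<close>])
            (use xy(3) xy' l1 l2 in \<open>auto simp: lnP algebra_simps\<close>)
      qed
      then show ?thesis
      proof
        assume "V \<le> 2 * L + m"
        then have "exp V \<le> exp (2 * L + m)" by simp
        also have "exp (2 * L + m) = M * s\<^sup>2"
          using s M1 by (simp add: L_def m_def exp_add exp_double power2_eq_square)
        finally show ?thesis using v by (simp add: V_def)
      next
        assume "V \<ge> (2 - 1 / real K) * L - m"
        then have "exp ((2 - 1 / real K) * L - m) \<le> exp V" by simp
        moreover have "exp ((2 - 1 / real K) * L - m) = s powr (2 - 1 / real K) / M"
          using s M1 by (simp add: L_def m_def exp_diff powr_def)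
        ultimately show ?thesis using v by (simp add: V_def)
      qed
    qed
  qed
qed

subsection \<open>Minimisation of the gradient on the levels of a polynomial\<close>

lemma GDERIV_line:
  assumes "GDERIV f x :> D"
  shows "((\<lambda>t. f (x + t *\<^sub>R v)) has_real_derivative (v \<bullet> D)) (at 0)"
proof -
  have "((\<lambda>t::real. x + t *\<^sub>R v) has_derivative (\<lambda>t. t *\<^sub>R v)) (at 0)"
    by (auto intro!: derivative_eq_intros)
  from has_derivative_compose[OF this, of f "\<lambda>h. h \<bullet> D"] assms
  have "((\<lambda>t. f (x + t *\<^sub>R v)) has_derivative (\<lambda>t. (t *\<^sub>R v) \<bullet> D)) (at 0)" by (simp add: gderiv_def)
  then show ?thesis
    unfolding has_field_derivative_def by (rule has_derivative_eq_rhs) (simp add: fun_eq_iff)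
qed

definition unit_cube :: "(real ^ 'n::finite) set" where
  "unit_cube = {x. \<forall>i. \<bar>x $ i\<bar> \<le> 1}"

lemma compact_unit_cube: "compact (unit_cube :: (real ^ 'n::finite) set)"
proof -
  have "(unit_cube :: (real ^ 'n) set) = cbox (\<chi> i. -1) (\<chi> i. 1)"
    by (auto simp: unit_cube_def mem_box_cart abs_le_iff)
  moreover have "compact (cbox (\<chi> i. -1) (\<chi> i. 1) :: (real ^ 'n) set)" by (rule compact_cbox)
  ultimately show ?thesis by simp
qed

text \<open>The factor vanishes on the two faces belonging to \<open>i\<close>; off them the
  \<open>i\<close>-th coordinate can move both ways inside the cube, so the partial derivative
  vanishes. One equation thus covers interior and boundary minima.\<close>

lemma cube_minimum_critical:
  assumes z: "z \<in> unit_cube" and min: "\<And>x. x \<in> unit_cube \<Longrightarrow> H z \<le> H x" and D: "GDERIV H z :> D"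
  shows "(1 - (z $ i)\<^sup>2) * D $ i = 0"
proof (cases "\<bar>z $ i\<bar> = 1")
  case True
  then have "(z $ i)\<^sup>2 = 1" using power2_abs[of "z $ i"] by simp
  then show ?thesis by simp
next
  case False
  define d where "d = 1 - \<bar>z $ i\<bar>"
  have d: "d > 0" using False z by (auto simp: d_def unit_cube_def order_le_less)
  have "((\<lambda>t. H (z + t *\<^sub>R axis i 1)) has_real_derivative (axis i 1 \<bullet> D)) (at 0)"
    by (rule GDERIV_line[OF D])
  moreover have "\<forall>t. \<bar>0 - t\<bar> < d \<longrightarrow> H (z + 0 *\<^sub>R axis i 1) \<le> H (z + t *\<^sub>R axis i 1)"
  proof (intro allI impI)
    fix t assume t: "\<bar>0 - t\<bar> < d"
    have "\<bar>(z + t *\<^sub>R axis i 1) $ j\<bar> \<le> 1" for j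
      using t z by (cases "j = i") (auto simp: d_def unit_cube_def axis_def)
    then show "H (z + 0 *\<^sub>R axis i 1) \<le> H (z + t *\<^sub>R axis i 1)"
      using min by (simp add: unit_cube_def)
  qed
  ultimately have "axis i 1 \<bullet> D = 0" using d by (intro DERIV_local_min)
  then show ?thesis by (simp add: inner_axis')
qed

lemma simultaneous_convergent_subsequence:
  fixes a :: "nat \<Rightarrow> 'j \<Rightarrow> real"
  assumes "finite J" and "\<And>k j. j \<in> J \<Longrightarrow> \<bar>a k j\<bar> \<le> B"
  shows "\<exists>r l. strict_mono r \<and> (\<forall>j\<in>J. (\<lambda>k. a (r k) j) \<longlonglongrightarrow> l j)"
  using assms
proof (induction J rule: finite_induct)
  case empty
  then show ?case by (auto intro!: exI[of _ id] simp: strict_mono_id)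
next
  case (insert j J)
  then obtain r l where r: "strict_mono r" "\<And>i. i \<in> J \<Longrightarrow> (\<lambda>k. a (r k) i) \<longlonglongrightarrow> l i"
    using insert.IH[OF insert.prems] by blast
  have "\<forall>k. a (r k) j \<in> {-B..B}" using insert.prems[of j] by (auto simp: abs_le_iff minus_le_iff)
  from compact_Icc[of "-B" B, unfolded compact_def, THEN spec, THEN mp, OF this]
  obtain m r' where r': "strict_mono r'" "((\<lambda>k. a (r k) j) \<circ> r') \<longlonglongrightarrow> m" by blast
  have "(\<lambda>k. a ((r \<circ> r') k) i) \<longlonglongrightarrow> (l(j := m)) i" if "i \<in> insert j J" for i
  proof (cases "i = j")
    case True
    then show ?thesis using r'(2) by (simp add: o_def)
  next
    case False
    then show ?thesis using LIMSEQ_subseq_LIMSEQ[OF r(2) r'(1), of i] that by (simp add: o_def)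
  qed
  moreover have "strict_mono (r \<circ> r')" using r(1) r'(1) by (rule strict_mono_o)
  ultimately show ?case by blast
qed

definition sq_norm_fun :: "('n \<Rightarrow> real ^ 'n::finite \<Rightarrow> real) \<Rightarrow> real ^ 'n \<Rightarrow> real" where
  "sq_norm_fun g x = (\<Sum>i\<in>UNIV. (g i x)\<^sup>2)"

text \<open>Indexing the squared gradient and the coordinates by one finite type lets a single
  subsequence and a single point serve all relations.\<close>

definition observable :: "('n \<Rightarrow> real ^ 'n::finite \<Rightarrow> real) \<Rightarrow> 'n option \<Rightarrow> real ^ 'n \<Rightarrow> real" where
  "observable g q x = (case q of None \<Rightarrow> sq_norm_fun g x | Some i \<Rightarrow> x $ i)"

lemma GDERIV_sq_norm_fun:
  assumes "\<And>i. GDERIV (g i) x :> (\<chi> j. h i j x)"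
  shows "GDERIV (sq_norm_fun g) x :> (\<chi> j. \<Sum>i\<in>UNIV. 2 * g i x * h i j x)"
proof -
  have "((\<lambda>x. \<Sum>i\<in>UNIV. (g i x)\<^sup>2) has_derivative (\<lambda>v. \<Sum>i\<in>UNIV. 2 * g i x * (v \<bullet> (\<chi> j. h i j x)))) (at x)"
    by (rule has_derivative_sum, rule has_derivative_eq_rhs[OF has_derivative_power[OF assms[unfolded gderiv_def]]]) auto
  moreover have "(\<Sum>i\<in>UNIV. 2 * g i x * (v \<bullet> (\<chi> j. h i j x))) = v \<bullet> (\<chi> j. \<Sum>i\<in>UNIV. 2 * g i x * h i j x)" for v
    by (simp add: inner_vec_def sum_distrib_left, subst sum.swap) (simp add: mult_ac)
  ultimately show ?thesis by (simp add: gderiv_def sq_norm_fun_def[abs_def])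
qed

text \<open>The order of quantifiers is the point: the relations \<open>R\<close> are fixed before
  \<open>x\<close>, so they hold for the chosen points on all levels simultaneously.\<close>

lemma level_selection:
  fixes F :: "real ^ 'n::finite \<Rightarrow> real"
  assumes F: "polyfun D F" and g: "\<And>i. polyfun D (g i)" and h: "\<And>i j. polyfun D (h i j)"
    and Fg: "\<And>x. GDERIV F x :> (\<chi> i. g i x)" and gh: "\<And>i x. GDERIV (g i) x :> (\<chi> j. h i j x)"
    and K: "K > (2 * (2 * D + 1) + 1) * (2 * D + 3) ^ CARD('n)"
  obtains R :: "'n option \<Rightarrow> nat \<Rightarrow> nat \<Rightarrow> real"
  where "\<And>q. (\<Sum>a<K. \<Sum>b<K. \<bar>R q a b\<bar>) = 1"
    and "\<And>x. x \<in> unit_cube \<Longrightarrow> \<exists>z\<in>unit_cube. F z = F x \<and> sq_norm_fun g z \<le> sq_norm_fun g x \<and>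
            (\<forall>q. (\<Sum>a<K. \<Sum>b<K. R q a b * F z ^ a * observable g q z ^ b) = 0)"
proof -
  define G where "G = sq_norm_fun g"
  define dG where "dG j x = (\<Sum>i\<in>UNIV. 2 * g i x * h i j x)" for j x
  have G: "polyfun (2 * D) G"
    unfolding G_def sq_norm_fun_def[abs_def] by (intro polyfun_sum polyfun_power g)
  have dG: "polyfun (2 * D) (dG j)" for j
  proof -
    have "polyfun (D + D) (dG j)"
      unfolding dG_def[abs_def] by (intro polyfun_sum polyfun_mult polyfun_cmult g h)
    then show ?thesis by (simp add: mult_2)
  qed
  have Gd: "GDERIV G x :> (\<chi> j. dG j x)" for x
    unfolding G_def dG_def by (rule GDERIV_sq_norm_fun[OF gh])
  \<comment> \<open>\<open>N - 1 = 2 * D + 2\<close> is the degree bound of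
    \<open>(1 - (x $ i)^2) * dG i x\<close>, the largest among \<open>a\<close> and
    \<open>b\<close>. \<open>E\<close> bounds \<open>F\<close>, \<open>G\<close> of degree
    \<open>2 * D\<close>, and the coordinates, also when \<open>D = 0\<close>.\<close>
  define N where "N = 2 * D + 3"
  define E where "E = 2 * D + 1"
  have obs: "polyfun E (observable g q)" for q
  proof (cases q)
    case None
    then show ?thesis using polyfun_mono[OF G, of E] by (simp add: observable_def[abs_def] G_def E_def)
  next
    case (Some i)
    then show ?thesis using polyfun_var[of "2 * D" i] by (simp add: observable_def[abs_def] E_def)
  qed
  have FE: "polyfun E F" by (rule polyfun_mono[OF F]) (simp add: E_def)
  have sq: "polyfun 2 (\<lambda>x :: real ^ 'n. 1 - (x $ i)\<^sup>2)" for i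
    using polyfun_diff[OF polyfun.const polyfun_power[OF polyfun_var[of 0 i], of 2]] by simp
  define b where "b i x = (1 - (x $ i)\<^sup>2) * g i x" for i x
  have b: "polyfun (N - 1) (b i)" for i
    unfolding b_def[abs_def] by (rule polyfun_mono[OF polyfun_mult[OF sq g]]) (simp add: N_def)
  define w where "w k = real (Suc k)" for k
  define c where "c = real (2 * D + 2)"
  have c: "c > 0" by (simp add: c_def)
  define a where "a k i x = x $ i ^ (2 * D + 1) + (w k / c) * ((1 - (x $ i)\<^sup>2) * dG i x)" for k i x
  have a: "polyfun (N - 1) (a k i)" for k i
    unfolding a_def[abs_def]
  proof (rule polyfun.add)
    show "polyfun (N - 1) (\<lambda>x. x $ i ^ (2 * D + 1))"
      by (rule polyfun_mono[OF polyfun_power[OF polyfun_var[of 0 i]]]) (simp add: N_def)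
    show "polyfun (N - 1) (\<lambda>x. (w k / c) * ((1 - (x $ i)\<^sup>2) * dG i x))"
      by (rule polyfun_mono[OF polyfun_cmult[OF polyfun_mult[OF sq dG]]]) (simp add: N_def)
  qed
  \<comment> \<open>The relation may depend on the penalty weight \<open>k\<close> and on the
    observable, but it holds for every multiplier \<open>l\<close> and so for every level.\<close>
  define P where "P k q R \<longleftrightarrow> (\<Sum>i<K. \<Sum>j<K. \<bar>R i j\<bar>) = 1 \<and>
    (\<forall>x l. (\<forall>i. x $ i ^ N = a k i x + l * b i x) \<longrightarrow> (\<Sum>i<K. \<Sum>j<K. R i j * F x ^ i * observable g q x ^ j) = 0)"
    for k q and R :: "nat \<Rightarrow> nat \<Rightarrow> real"
  have "\<exists>R. P k q R" for k q
  proof -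
    have N0: "N > 0" by (simp add: N_def)
    have K': "K > (2 * E + 1) * N ^ CARD('n)" using K by (simp add: E_def N_def)
    show "\<exists>R. P k q R"
    proof (rule algebraic_relation[where a = "a k" and b = b, OF N0 a b FE obs K'])
      fix R :: "nat \<Rightarrow> nat \<Rightarrow> real"
      assume R1: "(\<Sum>i<K. \<Sum>j<K. \<bar>R i j\<bar>) = 1" and
        R2: "\<And>x l. (\<And>i. x $ i ^ N = a k i x + l * b i x) \<Longrightarrow> (\<Sum>i<K. \<Sum>j<K. R i j * F x ^ i * observable g q x ^ j) = 0"
      have "P k q R" unfolding P_def using R1 by (intro conjI allI impI R2) auto
      then show "\<exists>R. P k q R" by (rule exI[of _ R])
    qed
  qed
  then obtain S where S: "\<And>k q. P k q (S k q)" by metis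
  have S1: "(\<Sum>i<K. \<Sum>j<K. \<bar>S k q i j\<bar>) = 1" for k q
    using S[of k q] unfolding P_def by (rule conjunct1)
  have S0: "(\<Sum>i<K. \<Sum>j<K. S k q i j * F x ^ i * observable g q x ^ j) = 0"
    if "\<And>i. x $ i ^ N = a k i x + l * b i x" for k q x l
    using S[of k q, unfolded P_def, THEN conjunct2, THEN spec, THEN spec, THEN mp] that by fast
  \<comment> \<open>All coefficients of all relations together: finitely many numbers in
    \<open>[-1, 1]\<close>, hence convergent along one subsequence, with the normalisation kept in
    the limit.\<close>
  define J where "J = (UNIV :: 'n option set) \<times> {..<K} \<times> {..<K}"
  have Sle: "\<bar>S k (fst j) (fst (snd j)) (snd (snd j))\<bar> \<le> 1" if jJ: "j \<in> J" for k j
  proof -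
    obtain q i l where j: "j = (q, i, l)" "i < K" "l < K" using jJ by (auto simp: J_def)
    have "\<bar>S k q i l\<bar> \<le> (\<Sum>l<K. \<bar>S k q i l\<bar>)" using j by (intro member_le_sum) auto
    also have "\<dots> \<le> (\<Sum>i<K. \<Sum>l<K. \<bar>S k q i l\<bar>)"
      using j by (intro member_le_sum[of i "{..<K}" "\<lambda>i. \<Sum>l<K. \<bar>S k q i l\<bar>"] sum_nonneg) auto
    finally show ?thesis using S1[of k q] j by simp
  qed
  have finJ: "finite J" by (simp add: J_def)
  obtain r L where r: "strict_mono r"
    and L: "\<And>j. j \<in> J \<Longrightarrow> (\<lambda>k. S (r k) (fst j) (fst (snd j)) (snd (snd j))) \<longlonglongrightarrow> L j"
    using simultaneous_convergent_subsequence[where a = "\<lambda>k j. S k (fst j) (fst (snd j)) (snd (snd j))", OF finJ Sle]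
    by blast
  define R where "R q i j = L (q, i, j)" for q i j
  have R: "(\<lambda>k. S (r k) q i j) \<longlonglongrightarrow> R q i j" if "i < K" "j < K" for q i j
    using L[of "(q, i, j)"] that by (simp add: J_def R_def)
  show ?thesis
  proof
    fix q
    have "(\<lambda>k. \<Sum>i<K. \<Sum>j<K. \<bar>S (r k) q i j\<bar>) \<longlonglongrightarrow> (\<Sum>i<K. \<Sum>j<K. \<bar>R q i j\<bar>)"
      by (intro tendsto_sum tendsto_rabs R) auto
    then show "(\<Sum>i<K. \<Sum>j<K. \<bar>R q i j\<bar>) = 1" by (simp add: S1 LIMSEQ_const_iff)
  next
    fix x0 :: "real ^ 'n" assume x0: "x0 \<in> unit_cube"
    define s where "s = F x0"
    \<comment> \<open>The second term forces the level in the limit. The last one tends to zero and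
      only serves to put the pure power of each coordinate on top of its critical equation.\<close>
    define H where "H k x = G x + w k * (F x - s)\<^sup>2 + (1 / w k) * (\<Sum>i\<in>UNIV. (x $ i) ^ (2 * D + 2))" for k x
    have w: "w k > 0" for k by (simp add: w_def)
    have cont: "continuous_on unit_cube (H k)" for k
      unfolding H_def by (intro continuous_intros polyfun_continuous_on[OF F] polyfun_continuous_on[OF G])
    have "\<exists>z\<in>unit_cube. \<forall>x\<in>unit_cube. H k z \<le> H k x" for k
      using continuous_attains_inf[OF compact_unit_cube _ cont] x0 by blast
    then obtain z where z: "\<And>k. z k \<in> unit_cube" and zmin: "\<And>k x. x \<in> unit_cube \<Longrightarrow> H k (z k) \<le> H k x"
      by metis
    have rel: "(\<Sum>i<K. \<Sum>j<K. S k q i j * F (z k) ^ i * observable g q (z k) ^ j) = 0" for k q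
    proof (rule S0)
      fix i
      define x where "x = z k"
      define p where "p = (\<chi> j. dG j x) + (w k * (2 * (F x - s))) *\<^sub>R (\<chi> j. g j x) +
         (1 / w k) *\<^sub>R (\<chi> j. c * (x $ j) ^ (2 * D + 1))"
      have d1: "((\<lambda>x. w k * (F x - s)\<^sup>2) has_derivative (\<lambda>v. v \<bullet> ((w k * (2 * (F x - s))) *\<^sub>R (\<chi> j. g j x)))) (at x)"
        by (rule has_derivative_eq_rhs, rule has_derivative_mult_right, rule has_derivative_power,
            rule has_derivative_diff[OF Fg[unfolded gderiv_def] has_derivative_const]) auto
      have d2: "((\<lambda>x. (1 / w k) * (\<Sum>i\<in>UNIV. (x $ i) ^ (2 * D + 2))) has_derivative
          (\<lambda>v. v \<bullet> ((1 / w k) *\<^sub>R (\<chi> j. c * (x $ j) ^ (2 * D + 1))))) (at x)"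
        by (rule has_derivative_eq_rhs, rule has_derivative_mult_right, rule has_derivative_sum,
            rule has_derivative_power, rule bounded_linear_imp_has_derivative[OF bounded_linear_vec_nth])
          (auto simp: c_def inner_vec_def fun_eq_iff sum_divide_distrib mult_ac)
      have "GDERIV (H k) x :> p"
        unfolding gderiv_def H_def p_def inner_add_right
        by (intro has_derivative_add d1 d2 Gd[unfolded gderiv_def])
      from cube_minimum_critical[where H = "H k" and z = "z k", OF z zmin, of p i] this
      have "(1 - (x $ i)\<^sup>2) * p $ i = 0" by (simp add: x_def)
      then have "(1 - (x $ i)\<^sup>2) * (dG i x + (w k * (2 * (F x - s))) * g i x) +
          (1 - (x $ i)\<^sup>2) * (c * (x $ i) ^ (2 * D + 1)) / w k = 0"
        by (simp add: p_def algebra_simps)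
      then have "w k * ((1 - (x $ i)\<^sup>2) * (dG i x + (w k * (2 * (F x - s))) * g i x)) +
          (1 - (x $ i)\<^sup>2) * (c * (x $ i) ^ (2 * D + 1)) = 0"
        using w[of k] by (simp add: field_simps)
      moreover have "(1 - (x $ i)\<^sup>2) * (c * (x $ i) ^ (2 * D + 1)) =
         c * ((x $ i) ^ (2 * D + 1) - (x $ i) ^ N)"
        by (simp add: N_def power2_eq_square power3_eq_cube power_add algebra_simps)
      ultimately have "c * (x $ i) ^ N = c * (x $ i) ^ (2 * D + 1) +
          w k * ((1 - (x $ i)\<^sup>2) * (dG i x + (w k * (2 * (F x - s))) * g i x))"
        by (simp add: algebra_simps)
      then have "(x $ i) ^ N = (c * (x $ i) ^ (2 * D + 1) +
          w k * ((1 - (x $ i)\<^sup>2) * (dG i x + (w k * (2 * (F x - s))) * g i x))) / c"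
        using c by (simp only: eq_divide_eq) (simp add: mult.commute)
      \<comment> \<open>Here \<open>s\<close> is confined to the coefficient of
        \<open>b i x\<close>, which is the same for all \<open>i\<close> and is taken as the
        multiplier.\<close>
      also have "\<dots> = a k i x + (w k / c) * (w k * (2 * (F x - s))) * b i x"
        using c by (simp add: a_def b_def field_simps)
      finally show "z k $ i ^ N = a k i (z k) + (w k / c) * (w k * (2 * (F (z k) - s))) * b i (z k)"
        by (simp add: x_def)
    qed
    \<comment> \<open>Comparison with a point of the level itself, where the penalty vanishes and
      the last term of \<open>H\<close> is at most \<open>CARD('n) / w k\<close> because the point
      lies in the cube.\<close>
    have Hbound: "G (z k) + w k * (F (z k) - s)\<^sup>2 \<le> G x + CARD('n) / w k" if x: "x \<in> unit_cube" "F x = s" for k x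
    proof -
      have "0 \<le> (\<Sum>i\<in>UNIV. (z k $ i) ^ (2 * D + 2))" by (intro sum_nonneg zero_le_even_power) simp
      then have "0 \<le> (1 / w k) * (\<Sum>i\<in>UNIV. (z k $ i) ^ (2 * D + 2))" using w[of k] by simp
      moreover have "(\<Sum>i\<in>UNIV. (x $ i) ^ (2 * D + 2)) \<le> (\<Sum>i\<in>(UNIV :: 'n set). 1)"
      proof (rule sum_mono)
        fix i
        have "\<bar>x $ i\<bar> ^ (2 * D + 2) \<le> 1" using x by (intro power_le_one) (auto simp: unit_cube_def)
        then show "(x $ i) ^ (2 * D + 2) \<le> 1" by (simp add: power_abs[symmetric]) 
      qed
      then have "(1 / w k) * (\<Sum>i\<in>UNIV. (x $ i) ^ (2 * D + 2)) \<le> CARD('n) / w k"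
        using w[of k] by (simp add: divide_right_mono)
      ultimately show ?thesis using zmin[OF x(1), of k] x(2) by (simp add: H_def)
    qed
    have "\<forall>k. (z \<circ> r) k \<in> unit_cube" using z by simp
    from compact_unit_cube[unfolded compact_def, THEN spec, THEN mp, OF this]
    obtain y r' where y: "y \<in> unit_cube" and r': "strict_mono r'" and lim: "((z \<circ> r) \<circ> r') \<longlonglongrightarrow> y"
      by blast
    define \<rho> where "\<rho> = r \<circ> r'"
    have rho: "strict_mono \<rho>" unfolding \<rho>_def by (rule strict_mono_o[OF r r'])
    have zl: "(\<lambda>k. z (\<rho> k)) \<longlonglongrightarrow> y" using lim by (simp add: o_def \<rho>_def)
    have contl: "(\<lambda>k. f (z (\<rho> k))) \<longlonglongrightarrow> f y" if "polyfun e f" for e and f :: "real ^ 'n \<Rightarrow> real"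
    proof (rule isCont_tendsto_compose[OF _ zl])
      show "isCont f y" using polyfun_continuous_on[OF that, of UNIV] by (simp add: continuous_on_eq_continuous_at)
    qed
    have "(\<lambda>k. inverse (real (Suc k))) \<longlonglongrightarrow> 0" by (rule LIMSEQ_inverse_real_of_nat)
    then have wl: "(\<lambda>k. 1 / w (\<rho> k)) \<longlonglongrightarrow> 0"
      using LIMSEQ_subseq_LIMSEQ[OF _ rho] by (fastforce simp: w_def o_def inverse_eq_divide)
    have Gpos: "G x \<ge> 0" for x by (simp add: G_def sq_norm_fun_def sum_nonneg)
    have Fy: "F y = s"
    proof -
      have "(F (z k) - s)\<^sup>2 \<le> (G x0 + CARD('n)) * (1 / w k)" for k
      proof -
        have "w k * (F (z k) - s)\<^sup>2 \<le> G x0 + CARD('n) / w k"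
          using Hbound[OF x0, of k] Gpos[of "z k"] by (simp add: s_def)
        also have "\<dots> \<le> G x0 + CARD('n)" by (simp add: w_def field_simps)
        finally show ?thesis using w[of k] by (simp add: field_simps)
      qed
      then have "(F y - s)\<^sup>2 \<le> (G x0 + real CARD('n)) * 0"
        by (intro LIMSEQ_le[OF tendsto_power[OF tendsto_diff[OF contl[OF F] tendsto_const]]
              tendsto_mult[OF tendsto_const wl]]) auto
      then show ?thesis by simp
    qed
    have Gy: "G y \<le> G x0"
    proof -
      have "G (z (\<rho> k)) \<le> G x0 + CARD('n) * (1 / w (\<rho> k))" for k
      proof -
        have "0 \<le> w (\<rho> k) * (F (z (\<rho> k)) - s)\<^sup>2" using w[of "\<rho> k"] by simp
        then show ?thesis using Hbound[OF x0, of "\<rho> k"] by (simp add: s_def)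
      qed
      then have "G y \<le> G x0 + real CARD('n) * 0"
        by (intro LIMSEQ_le[OF contl[OF G] tendsto_add[OF tendsto_const tendsto_mult[OF tendsto_const wl]]]) auto
      then show ?thesis by simp
    qed
    have "(\<Sum>i<K. \<Sum>j<K. R q i j * F y ^ i * observable g q y ^ j) = 0" for q
    proof -
      have "(\<lambda>k. \<Sum>i<K. \<Sum>j<K. S (\<rho> k) q i j * F (z (\<rho> k)) ^ i * observable g q (z (\<rho> k)) ^ j) \<longlonglongrightarrow>
         (\<Sum>i<K. \<Sum>j<K. R q i j * F y ^ i * observable g q y ^ j)"
      proof (intro tendsto_sum tendsto_mult tendsto_power contl[OF F] contl[OF obs])
        fix i j assume "i \<in> {..<K}" "j \<in> {..<K}"
        then show "(\<lambda>k. S (\<rho> k) q i j) \<longlonglongrightarrow> R q i j"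
          using LIMSEQ_subseq_LIMSEQ[OF R r', of i j q] by (simp add: o_def \<rho>_def)
      qed
      then show ?thesis by (simp add: rel LIMSEQ_const_iff)
    qed
    then show "\<exists>z\<in>unit_cube. F z = F x0 \<and> sq_norm_fun g z \<le> sq_norm_fun g x0 \<and>
            (\<forall>q. (\<Sum>a<K. \<Sum>b<K. R q a b * F z ^ a * observable g q z ^ b) = 0)"
      using y Fy Gy by (auto simp: s_def G_def)
  qed
qed

subsection \<open>The gradient inequality\<close>

definition bivariate_poly :: "nat \<Rightarrow> (nat \<Rightarrow> nat \<Rightarrow> real) \<Rightarrow> real poly poly" where
  "bivariate_poly K R = (\<Sum>b<K. monom (\<Sum>a<K. monom (R a b) a) b)"

lemma bieval_monom: "bieval (monom p b) s y = poly p s * y ^ b"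
  by (simp add: bieval_def poly_monom)

lemma bieval_sum: "bieval (\<Sum>i\<in>I. P i) s y = (\<Sum>i\<in>I. bieval (P i) s y)"
  by (induction I rule: infinite_finite_induct) (auto simp: bieval_add)

lemma bieval_bivariate_poly: "bieval (bivariate_poly K R) s y = (\<Sum>a<K. \<Sum>b<K. R a b * s ^ a * y ^ b)"
  unfolding bivariate_poly_def bieval_sum bieval_monom poly_sum poly_monom sum_distrib_right
  by (rule sum.swap)

lemma bivariate_poly_nonzero:
  assumes "a < K" "b < K" "R a b \<noteq> 0"
  shows "bivariate_poly K R \<noteq> 0"
proof -
  have "coeff (coeff (bivariate_poly K R) b) a = R a b"
    using assms by (simp add: bivariate_poly_def coeff_sum if_distrib if_distribR cong: if_cong)
  then show ?thesis using assms(3) by auto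
qed

text \<open>With \<open>u\<close> the change of \<open>F\<close>, the slopes give a displacement of
  at most \<open>u / (4 * B * F z)\<close>: the factor \<open>CARD('n)\<close> in the slope constant
  pays for summing the coordinates. The gradient, of norm at most \<open>B * F z\<close>, and an
  equally large linearisation error then allow \<open>F\<close> to change by at most
  \<open>u / 2\<close>.\<close>

lemma slope_bounded_sequence:
  fixes F :: "real ^ 'n::finite \<Rightarrow> real" and B :: real
  assumes D: "GDERIV F z :> D" and nD: "norm D \<le> B * F z" and pos: "F z > 0" and B: "B > 0"
    and lim: "X \<longlonglongrightarrow> z" and ne: "\<And>k. F (X k) \<noteq> F z"
    and root: "\<And>k i. bieval (P i) (F (X k)) (X k $ i) = 0"
    and slope: "\<And>i. slope_bounded (1 / (4 * real CARD('n) * B)) (P i) (F z) (z $ i)"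
  shows False
proof -
  define s where "s = F z"
  define n where "n = real CARD('n)"
  have n: "n > 0" by (simp add: n_def)
  have contF: "isCont F z" using D unfolding gderiv_def by (rule has_derivative_continuous)
  have sl: "(\<lambda>k. F (X k)) \<longlonglongrightarrow> s" unfolding s_def by (rule isCont_tendsto_compose[OF contF lim])
  have "eventually (\<lambda>k. s * \<bar>X k $ i - z $ i\<bar> \<le> 1 / (4 * n * B) * \<bar>F (X k) - s\<bar>) sequentially" for i
  proof -
    obtain d where d: "d > 0" "\<forall>s' y'. \<bar>s' - s\<bar> < d \<and> \<bar>y' - z $ i\<bar> < d \<and> bieval (P i) s' y' = 0 \<longrightarrow>
        s * \<bar>y' - z $ i\<bar> \<le> 1 / (4 * n * B) * \<bar>s' - s\<bar>"
      using slope[of i, folded s_def n_def] unfolding slope_bounded_def by (elim exE conjE)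
    have "(\<lambda>k. X k $ i) \<longlonglongrightarrow> z $ i" by (intro tendsto_intros lim)
    then have e1: "eventually (\<lambda>k. \<bar>X k $ i - z $ i\<bar> < d) sequentially"
      using tendstoD[OF _ d(1)] by (fastforce simp: dist_real_def)
    have e2: "eventually (\<lambda>k. \<bar>F (X k) - s\<bar> < d) sequentially"
      using tendstoD[OF sl d(1)] by (simp add: dist_real_def)
    show ?thesis using e1 e2 by eventually_elim (use d(2) root in blast)
  qed
  then have e1: "eventually (\<lambda>k. \<forall>i. s * \<bar>X k $ i - z $ i\<bar> \<le> 1 / (4 * n * B) * \<bar>F (X k) - s\<bar>) sequentially"
    by (simp add: eventually_all_finite)
  have "B * s > 0" using B pos by (simp add: s_def)
  then obtain d where d: "d > 0" "\<And>y. norm (y - z) < d \<Longrightarrow> norm (F y - F z - (y - z) \<bullet> D) \<le> B * s * norm (y - z)"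
    using D unfolding gderiv_def has_derivative_at_alt by blast
  have e2: "eventually (\<lambda>k. norm (X k - z) < d) sequentially"
    using tendstoD[OF lim d(1)] by (simp add: dist_norm)
  have "eventually (\<lambda>k::nat. False) sequentially"
    using e1 e2
  proof eventually_elim
    case (elim k)
    define u where "u = \<bar>F (X k) - s\<bar>"
    have u: "u > 0" using ne[of k] by (simp add: u_def s_def)
    have "s * norm (X k - z) \<le> s * (\<Sum>i\<in>UNIV. \<bar>(X k - z) $ i\<bar>)"
      using pos norm_le_l1_cart[of "X k - z"] by (simp add: s_def)
    also have "\<dots> = (\<Sum>i\<in>UNIV. s * \<bar>X k $ i - z $ i\<bar>)" by (simp add: sum_distrib_left)
    also have "\<dots> \<le> (\<Sum>i\<in>(UNIV :: 'n set). 1 / (4 * n * B) * u)" using elim by (intro sum_mono) (auto simp: u_def)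
    also have "\<dots> = u / (4 * B)" using n B by (simp add: n_def)
    finally have N: "s * norm (X k - z) \<le> u / (4 * B)" .
    have "u \<le> \<bar>(X k - z) \<bullet> D\<bar> + B * s * norm (X k - z)"
      using d(2)[of "X k"] elim by (simp add: u_def s_def abs_le_iff) (smt (verit))
    also have "\<bar>(X k - z) \<bullet> D\<bar> \<le> norm (X k - z) * norm D" by (rule Cauchy_Schwarz_ineq2)
    also have "\<dots> \<le> norm (X k - z) * (B * s)" using nD by (intro mult_left_mono) (auto simp: s_def)
    finally have "u \<le> 2 * B * (s * norm (X k - z))" by (simp add: algebra_simps)
    also have "\<dots> \<le> 2 * B * (u / (4 * B))" using N B by (intro mult_left_mono) auto
    also have "\<dots> = u / 2" using B by simp
    finally show False using u by simp
  qed
  then show False by simp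
qed

text \<open>A violation at a noncritical point is an open condition, so it persists at nearby points
  of slightly higher levels. The selected points of these levels fall into the alternative
  \<open>G \<le> C * F^2\<close>, and their limit contradicts
  \<open>slope_bounded_sequence\<close>.\<close>

lemma gradient_inequality_cube:
  fixes F :: "real ^ 'n::finite \<Rightarrow> real"
  assumes F: "polyfun D F" and g: "\<And>i. polyfun D (g i)" and h: "\<And>i j. polyfun D (h i j)"
    and Fg: "\<And>x. GDERIV F x :> (\<chi> i. g i x)" and gh: "\<And>i x. GDERIV (g i) x :> (\<chi> j. h i j x)"
    and K: "K > (2 * (2 * D + 1) + 1) * (2 * D + 3) ^ CARD('n)"
  obtains C s0 where "C > 0" "s0 > 0"
    "\<And>x. \<lbrakk>\<And>i. \<bar>x $ i\<bar> < 1; 0 < F x; F x < s0; (\<chi> i. g i x) \<noteq> 0\<rbrakk> \<Longrightarrow>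
        sq_norm_fun g x \<ge> F x powr (2 - 1 / real K) / C"
proof -
  define G where "G = sq_norm_fun g"
  have Gnorm: "G x = (norm (\<chi> i. g i x))\<^sup>2" for x
    by (simp add: G_def sq_norm_fun_def norm_vec_def L2_set_def sum_nonneg)
  have Gpoly: "polyfun (2 * D) G"
    unfolding G_def sq_norm_fun_def[abs_def] by (intro polyfun_sum polyfun_power g)
  have cont: "isCont f x" if "polyfun e f" for e and f :: "real ^ 'n \<Rightarrow> real" and x
    using polyfun_continuous_on[OF that, of UNIV] by (simp add: continuous_on_eq_continuous_at)
  have "\<exists>R :: 'n option \<Rightarrow> nat \<Rightarrow> nat \<Rightarrow> real. (\<forall>q. (\<Sum>a<K. \<Sum>b<K. \<bar>R q a b\<bar>) = 1) \<and>
     (\<forall>x\<in>unit_cube. \<exists>z\<in>unit_cube. F z = F x \<and> G z \<le> G x \<and>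
            (\<forall>q. (\<Sum>a<K. \<Sum>b<K. R q a b * F z ^ a * observable g q z ^ b) = 0))"
  proof (rule level_selection[OF F g h Fg gh K])
    fix R :: "'n option \<Rightarrow> nat \<Rightarrow> nat \<Rightarrow> real"
    assume R1: "\<And>q. (\<Sum>a<K. \<Sum>b<K. \<bar>R q a b\<bar>) = 1" and
      R0: "\<And>x. x \<in> unit_cube \<Longrightarrow> \<exists>z\<in>unit_cube. F z = F x \<and> sq_norm_fun g z \<le> sq_norm_fun g x \<and>
            (\<forall>q. (\<Sum>a<K. \<Sum>b<K. R q a b * F z ^ a * observable g q z ^ b) = 0)"
    show ?thesis unfolding G_def by (intro exI[of _ R] conjI allI ballI R1 R0)
  qed
  then obtain R :: "'n option \<Rightarrow> nat \<Rightarrow> nat \<Rightarrow> real" where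
    R1': "\<forall>q. (\<Sum>a<K. \<Sum>b<K. \<bar>R q a b\<bar>) = 1" and
    R0': "\<forall>x\<in>unit_cube. \<exists>z\<in>unit_cube. F z = F x \<and> G z \<le> G x \<and>
            (\<forall>q. (\<Sum>a<K. \<Sum>b<K. R q a b * F z ^ a * observable g q z ^ b) = 0)"
    by (elim exE conjE)
  note R1 = R1'[THEN spec] and R0 = R0'[THEN bspec]
  have Rnz: "\<exists>a<K. \<exists>b<K. R q a b \<noteq> 0" for q
  proof (rule ccontr)
    assume "\<not> ?thesis"
    then have "(\<Sum>a<K. \<Sum>b<K. \<bar>R q a b\<bar>) = 0" by simp
    then show False using R1[of q] by simp
  qed
  obtain a0 b0 where ab: "a0 < K" "b0 < K" "R None a0 b0 \<noteq> 0" using Rnz by blast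
  from small_root_dichotomy[where R = "R None" and K = K, OF ab] obtain C s1 where
    C: "C > 0" and s1: "s1 > 0" and
    dich: "\<forall>s v. 0 < s \<longrightarrow> s < s1 \<longrightarrow> v \<ge> 0 \<longrightarrow> (\<Sum>a<K. \<Sum>b<K. R None a b * s ^ a * v ^ b) = 0 \<longrightarrow>
        v \<le> C * s\<^sup>2 \<or> v \<ge> s powr (2 - 1 / real K) / C"
    by (elim exE conjE)
  \<comment> \<open>Turns \<open>G \<le> C * F^2\<close> into a bound \<open>B * F\<close> for the
    norm of the gradient. The slope constant may depend on \<open>B\<close>, since slopes can be
    made as small as desired by shrinking s.\<close>
  define B where "B = sqrt C"
  have B: "B > 0" using C by (simp add: B_def)
  define P where "P i = bivariate_poly K (R (Some i))" for i
  have "\<exists>t>0. \<forall>s y. 0 < s \<and> s < t \<and> \<bar>y\<bar> \<le> 1 \<longrightarrow> slope_bounded (1 / (4 * real CARD('n) * B)) (P i) s y" for i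
  proof (rule roots_slope_bounded)
    obtain a b where "a < K" "b < K" "R (Some i) a b \<noteq> 0" using Rnz by blast
    then show "P i \<noteq> 0" unfolding P_def by (rule bivariate_poly_nonzero)
  qed (use B in simp)
  then obtain t where t: "\<And>i. t i > 0"
    "\<And>i s y. 0 < s \<Longrightarrow> s < t i \<Longrightarrow> \<bar>y\<bar> \<le> 1 \<Longrightarrow> slope_bounded (1 / (4 * real CARD('n) * B)) (P i) s y"
    by metis
  define s2 where "s2 = Min (range t)"
  have s2: "s2 > 0" unfolding s2_def using t(1) by (subst Min_gr_iff) auto
  have s2t: "s2 \<le> t i" for i unfolding s2_def by simp
  define s0 where "s0 = min s1 s2"
  show ?thesis
  proof
    show "C > 0" by fact
    show "s0 > 0" using s1 s2 by (simp add: s0_def)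
    fix x :: "real ^ 'n"
    assume cube: "\<And>i. \<bar>x $ i\<bar> < 1" and Fx: "0 < F x" "F x < s0" and nc: "(\<chi> i. g i x) \<noteq> 0"
    show "sq_norm_fun g x \<ge> F x powr (2 - 1 / real K) / C"
    proof (rule ccontr)
      assume "\<not> ?thesis"
      then have small: "G x < F x powr (2 - 1 / real K) / C" by (simp add: G_def)
      define v where "v = (\<chi> i. g i x)"
      \<comment> \<open>Points approached along the gradient, so that the levels of the
        \<open>X k\<close> lie strictly above that of \<open>x\<close> and converge to it.\<close>
      define X where "X k = x + (1 / real (Suc k)) *\<^sub>R v" for k
      have "(\<lambda>k. 1 / real (Suc k)) \<longlonglongrightarrow> 0"
        using LIMSEQ_inverse_real_of_nat by (simp add: inverse_eq_divide)
      then have "X \<longlonglongrightarrow> x + 0 *\<^sub>R v" unfolding X_def by (intro tendsto_intros)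
      then have Xl: "X \<longlonglongrightarrow> x" by simp
      have FXl: "(\<lambda>k. F (X k)) \<longlonglongrightarrow> F x" by (rule isCont_tendsto_compose[OF cont[OF F] Xl])
      have GXl: "(\<lambda>k. G (X k)) \<longlonglongrightarrow> G x" by (rule isCont_tendsto_compose[OF cont[OF Gpoly] Xl])
      have "((\<lambda>t. F (x + t *\<^sub>R v) - F x) has_real_derivative (v \<bullet> v)) (at 0)"
        using DERIV_diff[OF GDERIV_line[OF Fg, of x v] DERIV_const] by (simp add: v_def)
      then have "eventually (\<lambda>t. F (x + t *\<^sub>R v) - F x > 0) (at_right 0)"
        by (rule eventually_pos_at_right_0) (use nc in \<open>auto simp: v_def\<close>)
      moreover have "filterlim (\<lambda>k. 1 / real (Suc k)) (at_right 0) sequentially"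
        using LIMSEQ_inverse_real_of_nat
        by (auto simp: filterlim_at inverse_eq_divide intro!: always_eventually)
      ultimately have "eventually (\<lambda>k. F (x + (1 / real (Suc k)) *\<^sub>R v) - F x > 0) sequentially"
        by (rule eventually_compose_filterlim)
      then have e1: "eventually (\<lambda>k. F (X k) > F x) sequentially" by (simp add: X_def)
      have e2: "eventually (\<lambda>k. F (X k) < s0) sequentially" using order_tendstoD(2)[OF FXl Fx(2)] .
      have "(\<lambda>k. F (X k) powr (2 - 1 / real K) / C - G (X k)) \<longlonglongrightarrow> F x powr (2 - 1 / real K) / C - G x"
        using Fx C by (intro tendsto_intros FXl GXl) auto
      then have e3: "eventually (\<lambda>k. F (X k) powr (2 - 1 / real K) / C - G (X k) > 0) sequentially"
        by (rule order_tendstoD(1)) (use small in simp)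
      have bieval: "eventually (\<lambda>k. \<bar>X k $ i\<bar> < 1) sequentially" for i
      proof (rule order_tendstoD(2)[OF _ cube[of i]])
        show "(\<lambda>k. \<bar>X k $ i\<bar>) \<longlonglongrightarrow> \<bar>x $ i\<bar>" by (intro tendsto_intros Xl)
      qed
      have e4: "eventually (\<lambda>k. X k \<in> unit_cube) sequentially"
        unfolding unit_cube_def mem_Collect_eq
      proof (intro eventually_all_finite)
        fix i
        show "eventually (\<lambda>k. \<bar>X k $ i\<bar> \<le> 1) sequentially"
          using bieval[of i] by (rule eventually_mono) simp
      qed
      have "eventually (\<lambda>k. F (X k) > F x \<and> F (X k) < s0 \<and> G (X k) < F (X k) powr (2 - 1 / real K) / C \<and> X k \<in> unit_cube) sequentially"
        using e1 e2 e3 e4 by eventually_elim auto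
      then obtain k0 where k0: "\<And>k. k \<ge> k0 \<Longrightarrow> F (X k) > F x" "\<And>k. k \<ge> k0 \<Longrightarrow> F (X k) < s0"
        "\<And>k. k \<ge> k0 \<Longrightarrow> G (X k) < F (X k) powr (2 - 1 / real K) / C" "\<And>k. k \<ge> k0 \<Longrightarrow> X k \<in> unit_cube"
        unfolding eventually_sequentially by blast
      define Q where "Q k z \<longleftrightarrow> F z = F (X (k + k0)) \<and> G z \<le> G (X (k + k0)) \<and>
            (\<forall>q. (\<Sum>a<K. \<Sum>b<K. R q a b * F z ^ a * observable g q z ^ b) = 0)" for k z
      have "\<exists>z\<in>unit_cube. Q k z" for k
        unfolding Q_def by (rule R0) (simp add: k0(4))
      then obtain Z where Z_cube: "\<And>k. Z k \<in> unit_cube" and ZQ: "\<And>k. Q k (Z k)" by metis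
      have Z: "F (Z k) = F (X (k + k0))" "G (Z k) \<le> G (X (k + k0))"
        "(\<Sum>a<K. \<Sum>b<K. R q a b * F (Z k) ^ a * observable g q (Z k) ^ b) = 0" for k q
        using ZQ[of k] unfolding Q_def by blast+
      have FZ: "F (Z k) > F x" "F (Z k) < s0" for k using k0(1,2)[of "k + k0"] by (simp_all add: Z(1))
      have GZ: "G (Z k) \<le> C * (F (Z k))\<^sup>2" for k
      proof -
        have "G (Z k) < F (Z k) powr (2 - 1 / real K) / C"
          using Z(2)[of k] k0(3)[of "k + k0"] by (simp add: Z(1))
        moreover have "G (Z k) \<le> C * (F (Z k))\<^sup>2 \<or> G (Z k) \<ge> F (Z k) powr (2 - 1 / real K) / C"
          using FZ[of k] Fx Z(3)[where q = None and k = k]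
          by (intro dich[rule_format]) (auto simp: s0_def observable_def G_def sq_norm_fun_def sum_nonneg)
        ultimately show ?thesis by simp
      qed
      have "\<forall>k. Z k \<in> unit_cube" using Z_cube by simp
      from compact_unit_cube[unfolded compact_def, THEN spec, THEN mp, OF this]
      obtain z r where z: "z \<in> unit_cube" and r: "strict_mono r" and lim: "(Z \<circ> r) \<longlonglongrightarrow> z"
        by blast
      have zl: "(\<lambda>k. Z (r k)) \<longlonglongrightarrow> z" using lim by (simp add: o_def)
      have "(\<lambda>k. F (X (k + k0))) \<longlonglongrightarrow> F x" using FXl by (rule LIMSEQ_ignore_initial_segment)
      from LIMSEQ_subseq_LIMSEQ[OF this r] have "(\<lambda>k. F (Z (r k))) \<longlonglongrightarrow> F x" by (simp add: o_def Z(1))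
      moreover have FZl: "(\<lambda>k. F (Z (r k))) \<longlonglongrightarrow> F z" by (rule isCont_tendsto_compose[OF cont[OF F] zl])
      ultimately have Fz: "F z = F x" using LIMSEQ_unique by blast
      have "G z \<le> C * (F z)\<^sup>2"
        by (rule LIMSEQ_le[OF isCont_tendsto_compose[OF cont[OF Gpoly] zl]
              tendsto_mult[OF tendsto_const tendsto_power[OF FZl]]]) (use GZ in auto)
      then have "sqrt (G z) \<le> sqrt (C * (F z)\<^sup>2)" by (rule real_sqrt_le_mono)
      then have nD: "norm (\<chi> i. g i z) \<le> B * F z"
        using Fz Fx by (simp add: Gnorm B_def real_sqrt_mult)
      show False
      proof (rule slope_bounded_sequence[OF Fg nD _ B zl])
        show "F z > 0" using Fz Fx by simp
        show "F (Z (r k)) \<noteq> F z" for k using FZ(1)[of "r k"] Fz by simp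
        show "bieval (P i) (F (Z (r k))) (Z (r k) $ i) = 0" for k i
          using Z(3)[where k = "r k" and q = "Some i"] by (simp add: P_def bieval_bivariate_poly observable_def)
        show "slope_bounded (1 / (4 * real CARD('n) * B)) (P i) (F z) (z $ i)" for i
          using z Fz Fx s2t[of i] by (intro t(2)) (auto simp: s0_def unit_cube_def)
      qed
    qed
  qed
qed

subsection \<open>The shift of the Hessian\<close>

lemma mat_mult_vec: "mat k *v x = k *\<^sub>R (x :: real ^ 'n::finite)"
  by (simp add: vec_eq_iff matrix_vector_mult_def mat_def if_distrib if_distribR cong: if_cong)

lemma symmetric_dot:
  fixes A :: "real ^ 'n ^ 'n::finite"
  assumes "transpose A = A"
  shows "(A *v x) \<bullet> y = x \<bullet> (A *v y)"
  using dot_lmul_matrix[of x A y] transpose_matrix_vector[of A x] assms by simp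

text \<open>First variation at a minimum: near \<open>t = 0\<close> a nonzero linear term would
  outweigh the quadratic one.\<close>

lemma linear_coefficient_zero:
  fixes \<alpha> \<beta> :: real
  assumes "\<And>t. 2 * t * \<alpha> + t\<^sup>2 * \<beta> \<ge> 0"
  shows "\<alpha> = 0"
proof (rule ccontr)
  assume a: "\<alpha> \<noteq> 0"
  define q where "q = \<alpha> / (\<bar>\<beta>\<bar> + 1)"
  have q: "\<alpha> = q * (\<bar>\<beta>\<bar> + 1)" by (simp add: q_def)
  have "2 * (- q) * \<alpha> + (- q)\<^sup>2 * \<beta> = q\<^sup>2 * (\<beta> - 2 * (\<bar>\<beta>\<bar> + 1))"
    unfolding q by (simp add: power2_eq_square algebra_simps)
  moreover have "q\<^sup>2 > 0" using a q by auto
  moreover have "\<beta> - 2 * (\<bar>\<beta>\<bar> + 1) < 0"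
    using abs_ge_self[of \<beta>] abs_ge_zero[of \<beta>] by argo
  ultimately have "2 * (- q) * \<alpha> + (- q)\<^sup>2 * \<beta> < 0" by (simp add: mult_pos_neg)
  then show False using assms[of "- q"] by simp
qed

lemma minsp_attained:
  fixes B :: "real ^ 'n ^ 'n::finite"
  obtains v where "norm v = 1" "minsp B = norm (B *v v)" "\<And>u. norm (B *v u) \<ge> minsp B * norm u"
proof -
  have cont: "continuous_on (sphere 0 1) (\<lambda>v. norm (B *v v))"
    by (intro continuous_on_norm linear_continuous_on matrix_vector_mul_bounded_linear)
  have ne: "sphere (0 :: real ^ 'n) 1 \<noteq> {}" by simp
  obtain v where v: "v \<in> sphere 0 1" and vmin: "\<And>u. u \<in> sphere 0 1 \<Longrightarrow> norm (B *v v) \<le> norm (B *v u)"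
    using continuous_attains_inf[OF compact_sphere ne cont] by blast
  have m: "minsp B = norm (B *v v)"
    unfolding minsp_def by (rule cInf_eq_minimum) (use v vmin in auto)
  have "norm (B *v u) \<ge> minsp B * norm u" for u
  proof (cases "u = 0")
    case False
    have "norm (B *v v) \<le> norm (B *v (u /\<^sub>R norm u))" by (rule vmin) (use False in simp)
    then show ?thesis using False by (simp add: m matrix_vector_mult_scaleR field_simps)
  qed simp
  then show ?thesis using that v m by simp
qed

text \<open>At a unit vector \<open>v\<close> minimising \<open>norm (B *v v)\<close> the first
  variation gives that \<open>B\<close> squared maps \<open>v\<close> to \<mu>^2 times
  \<open>v\<close>. Then \<open>w = B *v v + \<mu> v\<close> is an eigenvector for \<mu>, or it
  vanishes and \<open>v\<close> is one for -\<mu>.\<close>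

lemma minsp_eigenvalue:
  fixes B :: "real ^ 'n ^ 'n::finite"
  assumes sym: "transpose B = B"
  obtains v l where "v \<noteq> 0" "B *v v = l *\<^sub>R v" "\<bar>l\<bar> = minsp B"
proof -
  obtain v where v: "norm v = 1" "minsp B = norm (B *v v)" and ge: "\<And>u. norm (B *v u) \<ge> minsp B * norm u"
    using minsp_attained by blast
  define \<mu> where "\<mu> = minsp B"
  have mu: "\<mu> \<ge> 0" by (simp add: \<mu>_def v(2))
  have ge2: "\<mu>\<^sup>2 * (u \<bullet> u) \<le> (B *v u) \<bullet> (B *v u)" for u
    using power_mono[OF ge[of u], of 2] mu by (simp add: \<mu>_def power_mult_distrib power2_norm_eq_inner)
  have eq2: "(B *v v) \<bullet> (B *v v) = \<mu>\<^sup>2 * (v \<bullet> v)"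
    using v by (simp add: \<mu>_def power2_norm_eq_inner norm_eq_1)
  have "(B *v v) \<bullet> (B *v u) - \<mu>\<^sup>2 * (v \<bullet> u) = 0" for u
  proof (rule linear_coefficient_zero)
    fix t :: real
    have "0 \<le> (B *v (v + t *\<^sub>R u)) \<bullet> (B *v (v + t *\<^sub>R u)) - \<mu>\<^sup>2 * ((v + t *\<^sub>R u) \<bullet> (v + t *\<^sub>R u))"
      using ge2[of "v + t *\<^sub>R u"] by simp
    also have "\<dots> = 2 * t * ((B *v v) \<bullet> (B *v u) - \<mu>\<^sup>2 * (v \<bullet> u)) +
        t\<^sup>2 * ((B *v u) \<bullet> (B *v u) - \<mu>\<^sup>2 * (u \<bullet> u)) + ((B *v v) \<bullet> (B *v v) - \<mu>\<^sup>2 * (v \<bullet> v))"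
      by (simp add: matrix_vector_right_distrib matrix_vector_mult_scaleR inner_simps inner_commute
          power2_eq_square algebra_simps)
    finally show "0 \<le> 2 * t * ((B *v v) \<bullet> (B *v u) - \<mu>\<^sup>2 * (v \<bullet> u)) +
        t\<^sup>2 * ((B *v u) \<bullet> (B *v u) - \<mu>\<^sup>2 * (u \<bullet> u))" using eq2 by simp
  qed
  then have "(B *v (B *v v)) \<bullet> u = (\<mu>\<^sup>2 *\<^sub>R v) \<bullet> u" for u
    using symmetric_dot[OF sym, of "B *v v" u] by simp
  then have BB: "B *v (B *v v) = \<mu>\<^sup>2 *\<^sub>R v" using vector_eq_rdot by blast
  define w where "w = B *v v + \<mu> *\<^sub>R v"
  show ?thesis
  proof (cases "w = 0")
    case True
    then have "B *v v = (- \<mu>) *\<^sub>R v" by (simp add: w_def eq_neg_iff_add_eq_0)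
    moreover have "v \<noteq> 0" using v by auto
    ultimately show ?thesis using that[of v "- \<mu>"] mu by (simp add: \<mu>_def)
  next
    case False
    have "B *v w = \<mu> *\<^sub>R w"
      by (simp add: w_def matrix_vector_right_distrib matrix_vector_mult_scaleR BB power2_eq_square algebra_simps)
    then show ?thesis using that[of w \<mu>] False mu by (simp add: \<mu>_def)
  qed
qed

lemma finite_nqn_kappa_set: "finite {\<bar>\<delta> i - \<delta> j :: real\<bar> | i j. i \<le> m \<and> j \<le> m \<and> i \<noteq> (j :: nat)}"
  by (rule finite_subset[of _ "(\<lambda>(i, j). \<bar>\<delta> i - \<delta> j\<bar>) ` ({..m} \<times> {..m})"]) auto

lemma nqn_kappa_le:
  assumes "i \<le> m" "j \<le> m" "i \<noteq> j"
  shows "2 * nqn_kappa m \<delta> \<le> \<bar>\<delta> i - \<delta> j\<bar>"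
  unfolding nqn_kappa_def using assms by (auto intro!: Min_le finite_nqn_kappa_set)

lemma nqn_kappa_pos:
  assumes "inj_on \<delta> {0..m}" "m > 0"
  shows "nqn_kappa m \<delta> > 0"
proof -
  have "{\<bar>\<delta> i - \<delta> j\<bar> | i j. i \<le> m \<and> j \<le> m \<and> i \<noteq> j} \<noteq> {}" using assms(2) by auto
  then show ?thesis
    unfolding nqn_kappa_def using assms(1)
    by (auto simp: Min_gr_iff[OF finite_nqn_kappa_set] inj_on_def)
qed

text \<open>Each rejected index \<open>j\<close> yields an eigenvalue of \<open>H\<close> within
  \<kappa> * s of \<open>- \<delta> j * s\<close>. Since the \<delta> differ by at least 2 *
  \<kappa>, different indices yield different eigenvalues, and rejecting all
  \<open>CARD('n) + 1\<close> of them would give too many orthogonal eigenvectors.\<close>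

lemma shift_index_exists:
  fixes H :: "real ^ 'n ^ 'n::finite"
  assumes sym: "transpose H = H" and s: "s > 0" and inj: "inj_on \<delta> {0..CARD('n)}"
  shows "\<exists>j\<le>CARD('n). minsp (H + mat (\<delta> j * s)) \<ge> nqn_kappa CARD('n) \<delta> * s"
proof (rule ccontr)
  define \<kappa> where "\<kappa> = nqn_kappa CARD('n) \<delta>"
  assume "\<not> ?thesis"
  then have small: "minsp (H + mat (\<delta> j * s)) < \<kappa> * s" if "j \<le> CARD('n)" for j
    using that unfolding \<kappa>_def by (meson not_le)
  have "\<exists>v l. v \<noteq> 0 \<and> H *v v = l *\<^sub>R v \<and> \<bar>l + \<delta> j * s\<bar> < \<kappa> * s" if j: "j \<le> CARD('n)" for j
  proof -
    have "transpose (H + mat (\<delta> j * s)) = transpose H + transpose (mat (\<delta> j * s))"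
      by (simp add: vec_eq_iff transpose_def)
    then have "transpose (H + mat (\<delta> j * s)) = H + mat (\<delta> j * s)" by (simp add: sym transpose_mat)
    from minsp_eigenvalue[OF this] obtain v l where v: "v \<noteq> 0" "(H + mat (\<delta> j * s)) *v v = l *\<^sub>R v"
      "\<bar>l\<bar> = minsp (H + mat (\<delta> j * s))" by blast
    have "H *v v = (l - \<delta> j * s) *\<^sub>R v"
      using v(2) by (simp add: matrix_vector_mult_add_rdistrib mat_mult_vec algebra_simps)
    then show ?thesis using v small[OF j] by (intro exI[of _ v] exI[of _ "l - \<delta> j * s"]) auto
  qed
  then obtain v l where vl: "\<And>j. j \<le> CARD('n) \<Longrightarrow> v j \<noteq> 0" "\<And>j. j \<le> CARD('n) \<Longrightarrow> H *v v j = l j *\<^sub>R v j"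
    "\<And>j. j \<le> CARD('n) \<Longrightarrow> \<bar>l j + \<delta> j * s\<bar> < \<kappa> * s" by metis
  have orth: "v i \<bullet> v j = 0" if ij: "i \<le> CARD('n)" "j \<le> CARD('n)" "i \<noteq> j" for i j
  proof -
    have "l i * (v i \<bullet> v j) = l j * (v i \<bullet> v j)"
      using symmetric_dot[OF sym, of "v i" "v j"] vl(2) ij by simp
    moreover have "l i \<noteq> l j"
    proof
      assume eq: "l i = l j"
      have "\<bar>(\<delta> i - \<delta> j) * s\<bar> = \<bar>(l i + \<delta> i * s) - (l j + \<delta> j * s)\<bar>" by (simp add: eq algebra_simps)
      also have "\<dots> < 2 * \<kappa> * s" using vl(3)[OF ij(1)] vl(3)[OF ij(2)] by linarith
      finally have "\<bar>\<delta> i - \<delta> j\<bar> * s < 2 * \<kappa> * s" using s by (simp add: abs_mult)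
      then show False using nqn_kappa_le[OF ij, of \<delta>] s by (simp add: \<kappa>_def)
    qed
    ultimately show ?thesis by simp
  qed
  have inj_v: "inj_on v {..CARD('n)}"
  proof (rule inj_onI, rule ccontr)
    fix i j assume "i \<in> {..CARD('n)}" "j \<in> {..CARD('n)}" "v i = v j" "i \<noteq> j"
    then show False using orth[of i j] vl(1)[of j] by simp
  qed
  have "pairwise orthogonal (v ` {..CARD('n)})"
    using orth inj_v by (auto simp: pairwise_def orthogonal_def)
  then have "independent (v ` {..CARD('n)})"
    by (rule pairwise_orthogonal_independent) (use vl(1) in auto)
  from independent_bound[OF this] show False by (simp add: card_image[OF inj_v])
qed

subsection \<open>One step of the algorithm\<close>

lemma polyfun_bounded:
  fixes f :: "real ^ 'n::finite \<Rightarrow> real"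
  assumes "polyfun d f"
  shows "\<exists>M\<ge>0. \<forall>x. norm x \<le> B \<longrightarrow> \<bar>f x\<bar> \<le> M"
proof -
  have "compact (f ` cball 0 B)"
    by (intro compact_continuous_image polyfun_continuous_on[OF assms] compact_cball)
  then have "bounded (f ` cball 0 B)" by (rule compact_imp_bounded)
  then obtain M where "\<And>x. x \<in> f ` cball 0 B \<Longrightarrow> norm x \<le> M" unfolding bounded_iff by blast
  then have "\<bar>f x\<bar> \<le> max M 0" if "norm x \<le> B" for x using that by force
  then show ?thesis by (intro exI[of _ "max M 0"]) auto
qed

lemma abs_two_products: "\<bar>a * b + c * d\<bar> \<le> \<bar>a\<bar> * \<bar>b\<bar> + \<bar>c\<bar> * \<bar>d\<bar>" for a b c d :: real
  using abs_triangle_ineq[of "a * b" "c * d"] by (simp add: abs_mult)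

lemma polyfun_Lipschitz:
  fixes f :: "real ^ 'n::finite \<Rightarrow> real"
  assumes "polyfun d f"
  shows "\<exists>L\<ge>0. \<forall>x y. norm x \<le> B \<longrightarrow> norm y \<le> B \<longrightarrow> \<bar>f y - f x\<bar> \<le> L * norm (y - x)"
  using assms
proof (induction rule: polyfun.induct)
  case (const d c)
  then show ?case by (auto intro!: exI[of _ 0])
next
  case (add d f1 f2)
  obtain L1 L2 where L: "L1 \<ge> 0" "\<And>x y. norm x \<le> B \<Longrightarrow> norm y \<le> B \<Longrightarrow> \<bar>f1 y - f1 x\<bar> \<le> L1 * norm (y - x)"
    "L2 \<ge> 0" "\<And>x y. norm x \<le> B \<Longrightarrow> norm y \<le> B \<Longrightarrow> \<bar>f2 y - f2 x\<bar> \<le> L2 * norm (y - x)"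
    using add.IH by blast
  have "\<bar>f1 y + f2 y - (f1 x + f2 x)\<bar> \<le> (L1 + L2) * norm (y - x)" if "norm x \<le> B" "norm y \<le> B" for x y
    using L(2)[OF that] L(4)[OF that] by (simp add: distrib_right)
  then show ?case using L(1,3) by (intro exI[of _ "L1 + L2"]) auto
next
  case (mulvar d f k)
  obtain L where L: "L \<ge> 0" "\<And>x y. norm x \<le> B \<Longrightarrow> norm y \<le> B \<Longrightarrow> \<bar>f y - f x\<bar> \<le> L * norm (y - x)"
    using mulvar.IH by blast
  obtain M where M: "M \<ge> 0" "\<And>x. norm x \<le> B \<Longrightarrow> \<bar>f x\<bar> \<le> M" using polyfun_bounded[OF mulvar.hyps] by blast
  have "\<bar>y $ k * f y - x $ k * f x\<bar> \<le> (M + \<bar>B\<bar> * L) * norm (y - x)" if xy: "norm x \<le> B" "norm y \<le> B" for x y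
  proof -
    have "y $ k * f y - x $ k * f x = (y - x) $ k * f y + x $ k * (f y - f x)" by (simp add: algebra_simps)
    then have "\<bar>y $ k * f y - x $ k * f x\<bar> \<le> \<bar>(y - x) $ k\<bar> * \<bar>f y\<bar> + \<bar>x $ k\<bar> * \<bar>f y - f x\<bar>"
      by (simp only: abs_two_products)
    also have "\<dots> \<le> norm (y - x) * M + \<bar>B\<bar> * (L * norm (y - x))"
      using component_le_norm_cart[of "y - x" k] component_le_norm_cart[of x k] xy M(2)[OF xy(2)] L(2)[OF xy] L(1) M(1)
      by (intro add_mono mult_mono) auto
    finally show ?thesis by (simp add: algebra_simps)
  qed
  then show ?case using L(1) M(1) by (intro exI[of _ "M + \<bar>B\<bar> * L"]) auto
qed

lemma polyfun_GDERIV_grad: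
  assumes "polyfun d f"
  shows "GDERIV f x :> grad f x"
proof -
  obtain g where "\<And>x. GDERIV f x :> (\<chi> i. g i x)" using polyfun_derivatives[OF assms] by metis
  then show ?thesis using grad_eqI by metis
qed

text \<open>The Taylor remainder of \<open>x $ k * f x\<close> is \<open>x $ k\<close> times that of
  \<open>f\<close>, plus the product of the increments of \<open>x $ k\<close> and \<open>f\<close>,
  which is quadratic by the Lipschitz bound.\<close>

lemma polyfun_second_order:
  fixes f :: "real ^ 'n::finite \<Rightarrow> real"
  assumes "polyfun d f"
  shows "\<exists>L\<ge>0. \<forall>x y. norm x \<le> B \<longrightarrow> norm y \<le> B \<longrightarrow>
           \<bar>f y - f x - (y - x) \<bullet> grad f x\<bar> \<le> L * (norm (y - x))\<^sup>2"
  using assms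
proof (induction rule: polyfun.induct)
  case (const d c)
  have "grad (\<lambda>x :: real ^ 'n. c) x = 0" for x by (rule grad_eqI[OF GDERIV_const])
  then show ?case by (auto intro!: exI[of _ 0])
next
  case (add d f1 f2)
  have gr: "grad (\<lambda>x. f1 x + f2 x) x = grad f1 x + grad f2 x" for x
    by (intro grad_eqI GDERIV_add polyfun_GDERIV_grad[OF add.hyps(1)] polyfun_GDERIV_grad[OF add.hyps(2)])
  obtain L1 L2 where L: "L1 \<ge> 0" "L2 \<ge> 0"
    "\<And>x y. norm x \<le> B \<Longrightarrow> norm y \<le> B \<Longrightarrow> \<bar>f1 y - f1 x - (y - x) \<bullet> grad f1 x\<bar> \<le> L1 * (norm (y - x))\<^sup>2"
    "\<And>x y. norm x \<le> B \<Longrightarrow> norm y \<le> B \<Longrightarrow> \<bar>f2 y - f2 x - (y - x) \<bullet> grad f2 x\<bar> \<le> L2 * (norm (y - x))\<^sup>2"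
    using add.IH by blast
  have "\<bar>f1 y + f2 y - (f1 x + f2 x) - (y - x) \<bullet> grad (\<lambda>x. f1 x + f2 x) x\<bar> \<le> (L1 + L2) * (norm (y - x))\<^sup>2"
    if "norm x \<le> B" "norm y \<le> B" for x y
    using L(3)[OF that] L(4)[OF that] by (simp add: gr distrib_right inner_add_right)
  then show ?case using L(1,2) by (intro exI[of _ "L1 + L2"]) auto
next
  case (mulvar d f k)
  have gr: "grad (\<lambda>x. x $ k * f x) x = (x $ k) *\<^sub>R grad f x + f x *\<^sub>R axis k 1" for x
    by (intro grad_eqI GDERIV_mult GDERIV_component polyfun_GDERIV_grad[OF mulvar.hyps])
  obtain L where L: "L \<ge> 0" "\<And>x y. norm x \<le> B \<Longrightarrow> norm y \<le> B \<Longrightarrow>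
      \<bar>f y - f x - (y - x) \<bullet> grad f x\<bar> \<le> L * (norm (y - x))\<^sup>2"
    using mulvar.IH by blast
  obtain M where M: "M \<ge> 0" "\<And>x y. norm x \<le> B \<Longrightarrow> norm y \<le> B \<Longrightarrow> \<bar>f y - f x\<bar> \<le> M * norm (y - x)"
    using polyfun_Lipschitz[OF mulvar.hyps] by blast
  have "\<bar>y $ k * f y - x $ k * f x - (y - x) \<bullet> grad (\<lambda>x. x $ k * f x) x\<bar> \<le> (M + \<bar>B\<bar> * L) * (norm (y - x))\<^sup>2"
    if xy: "norm x \<le> B" "norm y \<le> B" for x y
  proof -
    have "y $ k * f y - x $ k * f x - (y - x) \<bullet> grad (\<lambda>x. x $ k * f x) x =
        (y - x) $ k * (f y - f x) + x $ k * (f y - f x - (y - x) \<bullet> grad f x)"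
      unfolding gr by (simp add: inner_add_right inner_axis algebra_simps)
    then have "\<bar>y $ k * f y - x $ k * f x - (y - x) \<bullet> grad (\<lambda>x. x $ k * f x) x\<bar> \<le>
        \<bar>(y - x) $ k\<bar> * \<bar>f y - f x\<bar> + \<bar>x $ k\<bar> * \<bar>f y - f x - (y - x) \<bullet> grad f x\<bar>"
      by (simp only: abs_two_products)
    also have "\<dots> \<le> norm (y - x) * (M * norm (y - x)) + \<bar>B\<bar> * (L * (norm (y - x))\<^sup>2)"
      using component_le_norm_cart[of "y - x" k] component_le_norm_cart[of x k] xy M(2)[OF xy] L(2)[OF xy] L(1) M(1)
      by (intro add_mono mult_mono) auto
    finally show ?thesis by (simp add: algebra_simps power2_eq_square)
  qed
  then show ?case using L(1) M(1) by (intro exI[of _ "M + \<bar>B\<bar> * L"]) auto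
qed

lemma hessian_eqI:
  fixes f :: "real ^ 'n::finite \<Rightarrow> real"
  assumes fg: "\<And>x. GDERIV f x :> (\<chi> i. g i x)" and gh: "\<And>i x. GDERIV (g i) x :> (\<chi> j. h i j x)"
  shows "hessian f x = (\<chi> i j. h i j x)"
proof -
  have gr: "grad f = (\<lambda>x. \<chi> i. g i x)" using grad_eqI[OF fg] by (simp add: fun_eq_iff)
  have "((\<lambda>x. \<chi> i. g i x) has_derivative (\<lambda>v. \<chi> i. v \<bullet> (\<chi> j. h i j x))) (at x)"
    using gh[unfolded gderiv_def]
    by (subst has_derivative_componentwise_within) (auto simp: Basis_vec_def inner_axis)
  then have "frechet_derivative (grad f) (at x) = (\<lambda>v. \<chi> i. v \<bullet> (\<chi> j. h i j x))"
    using frechet_derivative_at unfolding gr by metis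
  then show ?thesis
    by (simp add: hessian_def jacobian_def matrix_def inner_axis' vec_eq_iff)
qed

section \<open>Search direction and step length\<close>

lemma orthonormal_parseval:
  assumes "orthonormal_family (e :: 'n \<Rightarrow> real ^ 'n::finite)"
  shows "(\<Sum>i\<in>UNIV. (g \<bullet> e i)\<^sup>2) = (norm g)\<^sup>2"
proof -
  define Q where "Q = (\<chi> i. e i)"
  have "Q ** transpose Q = mat 1"
    using assms
    by (simp add: orthonormal_family_def vec_eq_iff matrix_matrix_mult_def transpose_def mat_def Q_def inner_vec_def)
  then have Q: "transpose Q ** Q = mat 1" by (simp add: matrix_left_right_inverse)
  have "(\<Sum>i\<in>UNIV. (g \<bullet> e i)\<^sup>2) = (Q *v g) \<bullet> (Q *v g)"
    by (simp add: Q_def inner_vec_def matrix_vector_mult_def power2_eq_square mult.commute)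
  also have "\<dots> = g \<bullet> (transpose Q *v (Q *v g))"
    by (metis dot_lmul_matrix inner_commute transpose_matrix_vector transpose_transpose)
  also have "\<dots> = g \<bullet> g" by (simp add: matrix_vector_mul_assoc Q)
  finally show ?thesis by (simp add: power2_norm_eq_inner)
qed

lemma orthonormal_sum_inner:
  assumes "orthonormal_family e"
  shows "(\<Sum>i\<in>UNIV. c i *\<^sub>R e i) \<bullet> e j = c j"
proof -
  have e_inner: "e i \<bullet> e j = (if i = j then 1 else 0)" for i
    using assms unfolding orthonormal_family_def by blast
  show ?thesis by (simp add: inner_sum_left e_inner if_distrib cong: if_cong)
qed

text \<open>In the basis \<open>e\<close> the inner product of \<open>w\<close> and \<open>g\<close>
  is the sum of \<open>(g \<bullet> e i)^2 / a i\<close>, and the squared norm of \<open>w\<close>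
  that of \<open>(g \<bullet> e i)^2 / (a i)^2\<close>; the bounds on \<open>a i\<close> are applied
  termwise.\<close>

lemma scaled_direction_estimates:
  fixes e :: "'n \<Rightarrow> real ^ 'n::finite" and g :: "real ^ 'n"
  assumes e: "orthonormal_family e" and a: "\<And>i. b \<le> a i" "\<And>i. a i \<le> M" and b: "b > 0"
    and w_def: "w = (\<Sum>i\<in>UNIV. ((g \<bullet> e i) / a i) *\<^sub>R e i)"
  shows "w \<bullet> g \<ge> b * (norm w)\<^sup>2" "w \<bullet> g \<ge> (norm g)\<^sup>2 / M" "b * norm w \<le> norm g"
proof -
  have apos: "a i > 0" for i using a(1)[of i] b by simp
  have Mpos: "M > 0" using apos a(2) by (meson less_le_trans)
  have wg: "w \<bullet> g = (\<Sum>i\<in>UNIV. (g \<bullet> e i)\<^sup>2 / a i)"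
    by (simp add: w_def inner_sum_left power2_eq_square inner_commute[of "e _" g])
  have nw: "(norm w)\<^sup>2 = (\<Sum>i\<in>UNIV. (g \<bullet> e i)\<^sup>2 / (a i)\<^sup>2)"
    unfolding orthonormal_parseval[OF e, of w, symmetric]
    by (simp add: w_def orthonormal_sum_inner[OF e] power_divide)
  have "b * ((g \<bullet> e i)\<^sup>2 / (a i)\<^sup>2) \<le> (g \<bullet> e i)\<^sup>2 / a i" for i
  proof -
    have "b * (g \<bullet> e i)\<^sup>2 \<le> a i * (g \<bullet> e i)\<^sup>2" using a(1) by (intro mult_right_mono) auto
    then show ?thesis using apos[of i] by (simp add: field_simps power2_eq_square)
  qed
  then show 1: "w \<bullet> g \<ge> b * (norm w)\<^sup>2" unfolding wg nw sum_distrib_left by (intro sum_mono)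
  have "(g \<bullet> e i)\<^sup>2 / M \<le> (g \<bullet> e i)\<^sup>2 / a i" for i
    using a(2) apos[of i] by (intro divide_left_mono mult_pos_pos Mpos) auto
  then show "w \<bullet> g \<ge> (norm g)\<^sup>2 / M"
    unfolding wg orthonormal_parseval[OF e, of g, symmetric] sum_divide_distrib by (intro sum_mono)
  have "b * (norm w)\<^sup>2 \<le> norm w * norm g" using 1 norm_cauchy_schwarz[of w g] by linarith
  then have "norm w * (b * norm w) \<le> norm w * norm g" by (simp add: power2_eq_square mult_ac)
  then show "b * norm w \<le> norm g" by (cases "w = 0") auto
qed

text \<open>The fourth bound is the product of the two lower bounds for the inner product. It
  controls the angle by \<open>sqrt (b / M)\<close> instead of \<open>b / M\<close>; for
  \<open>b\<close> proportional to the power \<tau> of the gradient norm this is the source of the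
  exponent 1 + \<tau>/2.\<close>

lemma unit_direction_estimates:
  fixes g :: "real ^ 'n::finite"
  assumes w: "w \<bullet> g \<ge> b * (norm w)\<^sup>2" "w \<bullet> g \<ge> (norm g)\<^sup>2 / M" "b * norm w \<le> norm g"
    and b: "b > 0" and M: "M > 0" and g: "g \<noteq> 0" and u_def: "u = w /\<^sub>R max 1 (norm w)"
  shows "norm u \<le> 1" "u \<bullet> g > 0" "u \<bullet> g \<ge> b * (norm u)\<^sup>2" "(u \<bullet> g)\<^sup>2 \<ge> b / M * (norm u)\<^sup>2 * (norm g)\<^sup>2"
    "u \<bullet> g \<ge> (norm g)\<^sup>2 / (M * max 1 (norm g / b))"
proof -
  define m where "m = max 1 (norm w)"
  have m: "m \<ge> 1" "m \<ge> norm w" by (simp_all add: m_def)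
  define t where "t = 1 / max 1 (norm w)"
  have t: "0 < t" "t \<le> 1" "t * norm w \<le> 1" unfolding t_def m_def[symmetric] using m by (auto simp: field_simps)
  have u: "u = t *\<^sub>R w" by (simp add: u_def t_def inverse_eq_divide)
  have nu: "norm u = t * norm w" using t by (simp add: u)
  have ug: "u \<bullet> g = t * (w \<bullet> g)" by (simp add: u)
  show "norm u \<le> 1" using t nu by simp
  have g2: "(norm g)\<^sup>2 / M > 0" using g M by simp
  then have wg: "w \<bullet> g > 0" using w(2) by linarith
  show "u \<bullet> g > 0" using wg t ug by simp
  have "b * (norm u)\<^sup>2 = t * t * (b * (norm w)\<^sup>2)" by (simp add: nu power2_eq_square)
  also have "\<dots> \<le> t * t * (w \<bullet> g)" using w(1) t by (intro mult_left_mono) auto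
  also have "\<dots> \<le> 1 * t * (w \<bullet> g)" using t wg by (intro mult_right_mono) auto
  finally show "u \<bullet> g \<ge> b * (norm u)\<^sup>2" by (simp add: ug)
  have "b / M * (norm u)\<^sup>2 * (norm g)\<^sup>2 = t\<^sup>2 * ((b * (norm w)\<^sup>2) * ((norm g)\<^sup>2 / M))"
    by (simp add: nu power_mult_distrib)
  also have "\<dots> \<le> t\<^sup>2 * ((w \<bullet> g) * (w \<bullet> g))"
    using w wg b g2 by (intro mult_left_mono mult_mono) auto
  finally show "(u \<bullet> g)\<^sup>2 \<ge> b / M * (norm u)\<^sup>2 * (norm g)\<^sup>2" by (simp add: ug power2_eq_square mult_ac)
  have "norm w \<le> norm g / b" using w(3) b by (simp add: field_simps)
  then have "1 / max 1 (norm g / b) \<le> t" unfolding t_def by (intro divide_left_mono) auto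
  then have "(1 / max 1 (norm g / b)) * ((norm g)\<^sup>2 / M) \<le> t * (w \<bullet> g)"
    using w(2) g2 wg t by (intro mult_mono) auto
  then show "u \<bullet> g \<ge> (norm g)\<^sup>2 / (M * max 1 (norm g / b))" by (simp add: ug field_simps)
qed

text \<open>If the accepted value is not the first one, its triple was rejected and therefore
  exceeds \<eta>.\<close>

lemma backtrack_least:
  assumes ok: "\<And>\<gamma>. 0 < \<gamma> \<Longrightarrow> \<gamma> \<le> \<eta> \<Longrightarrow> armijo f x w \<gamma>" and \<eta>: "\<eta> > 0" and \<gamma>0: "\<gamma>\<^sub>0 > 0"
  shows "armijo f x w (backtrack f \<gamma>\<^sub>0 x w)" "backtrack f \<gamma>\<^sub>0 x w \<ge> min \<gamma>\<^sub>0 (\<eta> / 3)"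
    "0 < backtrack f \<gamma>\<^sub>0 x w" "backtrack f \<gamma>\<^sub>0 x w \<le> \<gamma>\<^sub>0"
proof -
  define l where "l = (LEAST l. armijo f x w (\<gamma>\<^sub>0 / 3 ^ l))"
  have bt: "backtrack f \<gamma>\<^sub>0 x w = \<gamma>\<^sub>0 / 3 ^ l" by (simp add: backtrack_def l_def)
  obtain l0 where "(1 / 3 :: real) ^ l0 < \<eta> / \<gamma>\<^sub>0"
    using real_arch_pow_inv[of "\<eta> / \<gamma>\<^sub>0" "1 / 3"] \<eta> \<gamma>0 by auto
  then have "\<gamma>\<^sub>0 / 3 ^ l0 \<le> \<eta>" using \<gamma>0 by (simp add: power_one_over field_simps)
  then have "armijo f x w (\<gamma>\<^sub>0 / 3 ^ l0)" using ok \<gamma>0 by simp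
  then show "armijo f x w (backtrack f \<gamma>\<^sub>0 x w)" unfolding bt l_def by (rule LeastI)
  show "0 < backtrack f \<gamma>\<^sub>0 x w" using \<gamma>0 by (simp add: bt)
  have "\<gamma>\<^sub>0 * 1 \<le> \<gamma>\<^sub>0 * 3 ^ l" using \<gamma>0 by (intro mult_left_mono) auto
  then show "backtrack f \<gamma>\<^sub>0 x w \<le> \<gamma>\<^sub>0" by (simp add: bt field_simps)
  show "backtrack f \<gamma>\<^sub>0 x w \<ge> min \<gamma>\<^sub>0 (\<eta> / 3)"
  proof (cases l)
    case 0
    then show ?thesis by (simp add: bt)
  next
    case (Suc k)
    then have "\<not> armijo f x w (\<gamma>\<^sub>0 / 3 ^ k)" unfolding l_def using not_less_Least by (metis lessI)
    then have "\<gamma>\<^sub>0 / 3 ^ k > \<eta>" using ok[of "\<gamma>\<^sub>0 / 3 ^ k"] \<gamma>0 by force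
    then show ?thesis by (simp add: bt Suc)
  qed
qed

text \<open>\<open>M\<close> bounds the norms of the images of the basis vectors under the shifted
  Hessian, \<open>L\<close> the second-order remainder of \<open>f\<close>. Both depend only on the
  ball and not on \<open>x\<close>.\<close>

lemma nqn_step_estimates:
  fixes f :: "real ^ 'n::finite \<Rightarrow> real"
  assumes f: "polyfun D f" and inj: "inj_on \<delta> {0..CARD('n)}" and \<tau>: "\<tau> > 0"
    and \<gamma>0: "0 < \<gamma>\<^sub>0" "\<gamma>\<^sub>0 < 1" and e: "\<And>y. orthonormal_family (e y)"
  shows "\<exists>M>0. \<exists>L>0. \<forall>x. norm x \<le> B \<longrightarrow> grad f x \<noteq> 0 \<longrightarrow>
    (\<exists>u \<gamma>. nqn_step f \<delta> \<tau> \<gamma>\<^sub>0 e x = x - \<gamma> *\<^sub>R u \<and>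
       f (x - \<gamma> *\<^sub>R u) \<le> f x - (1/3) * \<gamma> * (u \<bullet> grad f x) \<and> u \<bullet> grad f x > 0 \<and>
       (u \<bullet> grad f x)\<^sup>2 \<ge> nqn_kappa CARD('n) \<delta> * norm (grad f x) powr \<tau> / M * (norm u)\<^sup>2 * (norm (grad f x))\<^sup>2 \<and>
       u \<bullet> grad f x \<ge> (norm (grad f x))\<^sup>2 / (M * max 1 (norm (grad f x) / (nqn_kappa CARD('n) \<delta> * norm (grad f x) powr \<tau>))) \<and>
       \<gamma> > 0 \<and> \<gamma> \<ge> min \<gamma>\<^sub>0 (min 1 (nqn_kappa CARD('n) \<delta> * norm (grad f x) powr \<tau> / L) / 3))"
proof -
  define \<kappa> where "\<kappa> = nqn_kappa CARD('n) \<delta>"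
  have \<kappa>: "\<kappa> > 0" unfolding \<kappa>_def by (rule nqn_kappa_pos[OF inj]) simp
  obtain g h where g: "\<And>i. polyfun D (g i)" and h: "\<And>i j. polyfun D (h i j)"
    and fg: "\<And>x. GDERIV f x :> (\<chi> i. g i x)" and gh: "\<And>i x. GDERIV (g i) x :> (\<chi> j. h i j x)"
    and hsym: "\<And>i j x. h i j x = h j i x"
    using polyfun_derivatives[OF f] by metis
  have gr: "grad f x = (\<chi> i. g i x)" for x by (rule grad_eqI[OF fg])
  have he: "hessian f x = (\<chi> i j. h i j x)" for x by (rule hessian_eqI[OF fg gh])
  have tr: "transpose (hessian f x) = hessian f x" for x by (simp add: he transpose_def vec_eq_iff hsym)
  have "\<forall>i. \<exists>M\<ge>0. \<forall>x. norm x \<le> B \<longrightarrow> \<bar>g i x\<bar> \<le> M" using polyfun_bounded[OF g] by blast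
  then obtain Mg where Mg: "\<And>i. Mg i \<ge> 0" "\<And>i x. norm x \<le> B \<Longrightarrow> \<bar>g i x\<bar> \<le> Mg i" by metis
  have "\<forall>i j. \<exists>M\<ge>0. \<forall>x. norm x \<le> B \<longrightarrow> \<bar>h i j x\<bar> \<le> M" using polyfun_bounded[OF h] by blast
  then obtain Mh where Mh: "\<And>i j. Mh i j \<ge> 0" "\<And>i j x. norm x \<le> B \<Longrightarrow> \<bar>h i j x\<bar> \<le> Mh i j" by metis
  define G where "G = (\<Sum>i\<in>UNIV. Mg i)"
  define \<Delta> where "\<Delta> = (\<Sum>j\<le>CARD('n). \<bar>\<delta> j\<bar>)"
  define M where "M = (\<Sum>i\<in>UNIV. \<Sum>j\<in>UNIV. Mh i j) + \<Delta> * G powr \<tau> + 1"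
  have \<Delta>0: "\<Delta> \<ge> 0" unfolding \<Delta>_def by (intro sum_nonneg) auto
  have "(\<Sum>i\<in>UNIV. \<Sum>j\<in>UNIV. Mh i j) \<ge> 0" by (intro sum_nonneg Mh(1))
  then have M: "M > 0" unfolding M_def using \<Delta>0 by (smt (verit) mult_nonneg_nonneg powr_ge_zero)
  \<comment> \<open>Radius \<open>B + 1\<close>, because directions and trial step lengths are at
    most 1.\<close>
  obtain L0 where L0: "L0 \<ge> 0" "\<And>x y. norm x \<le> B + 1 \<Longrightarrow> norm y \<le> B + 1 \<Longrightarrow>
      \<bar>f y - f x - (y - x) \<bullet> grad f x\<bar> \<le> L0 * (norm (y - x))\<^sup>2"
    using polyfun_second_order[OF f, of "B + 1"] by blast
  \<comment> \<open>Armijo's condition asks for one third of the linear decrease, so the remainder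
    may consume two thirds; \<open>L0 \<le> 2/3 * L\<close> arranges this for step lengths up to
    \<open>b / L\<close>. The added 1 keeps \<open>L\<close> positive.\<close>
  define L where "L = 3 / 2 * L0 + 1"
  have L: "L > 0" "L0 \<le> 2 / 3 * L" using L0(1) by (auto simp: L_def)
  have "\<exists>u \<gamma>. nqn_step f \<delta> \<tau> \<gamma>\<^sub>0 e x = x - \<gamma> *\<^sub>R u \<and>
       f (x - \<gamma> *\<^sub>R u) \<le> f x - (1/3) * \<gamma> * (u \<bullet> grad f x) \<and> u \<bullet> grad f x > 0 \<and>
       (u \<bullet> grad f x)\<^sup>2 \<ge> \<kappa> * norm (grad f x) powr \<tau> / M * (norm u)\<^sup>2 * (norm (grad f x))\<^sup>2 \<and>
       u \<bullet> grad f x \<ge> (norm (grad f x))\<^sup>2 / (M * max 1 (norm (grad f x) / (\<kappa> * norm (grad f x) powr \<tau>))) \<and>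
       \<gamma> > 0 \<and> \<gamma> \<ge> min \<gamma>\<^sub>0 (min 1 (\<kappa> * norm (grad f x) powr \<tau> / L) / 3)"
    if x: "norm x \<le> B" and nc: "grad f x \<noteq> 0" for x
  proof -
    define s where "s = norm (grad f x) powr \<tau>"
    have s: "s > 0" using nc by (simp add: s_def)
    define b where "b = \<kappa> * s"
    have b: "b > 0" using s \<kappa> by (simp add: b_def)
    have "norm (grad f x) \<le> (\<Sum>i\<in>UNIV. \<bar>grad f x $ i\<bar>)" by (rule norm_le_l1_cart)
    also have "\<dots> \<le> G" unfolding G_def gr using Mg(2)[OF x] by (intro sum_mono) simp
    finally have sG: "s \<le> G powr \<tau>" unfolding s_def using \<tau> by (intro powr_mono2) auto
    define P where "P j \<longleftrightarrow> j \<le> CARD('n) \<and> minsp (nqn_shift f \<delta> \<tau> x j) \<ge> \<kappa> * s" for j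
    have "\<exists>j. P j" using shift_index_exists[OF tr s inj, of x] by (auto simp: P_def \<kappa>_def s_def nqn_shift_def)
    then have PL: "P (LEAST j. P j)" by (rule LeastI_ex)
    define j where "j = (LEAST j. P j)"
    define A where "A = nqn_shift f \<delta> \<tau> x j"
    have A_eq: "nqn_matrix f \<delta> \<tau> x = A"
      by (simp add: nqn_matrix_def A_def j_def P_def \<kappa>_def s_def)
    have jP: "j \<le> CARD('n)" "minsp A \<ge> b" using PL[folded j_def] by (simp_all add: P_def A_def b_def)
    define a where "a i = norm (A *v e x i)" for i
    have ne: "norm (e x i) = 1" for i using e[of x] by (simp add: orthonormal_family_def norm_eq_1)
    have a1: "b \<le> a i" for i
    proof (rule minsp_attained[of A])
      fix v assume "\<And>u. minsp A * norm u \<le> norm (A *v u)"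
      from this[of "e x i"] show ?thesis using jP(2) ne by (simp add: a_def)
    qed
    have a2: "a i \<le> M" for i
    proof -
      have "norm (hessian f x *v e x i) \<le> (\<Sum>k\<in>UNIV. \<bar>(hessian f x *v e x i) $ k\<bar>)" by (rule norm_le_l1_cart)
      also have "\<dots> \<le> (\<Sum>k\<in>UNIV. \<Sum>l\<in>UNIV. Mh k l)"
      proof (rule sum_mono)
        fix k
        have "\<bar>(hessian f x *v e x i) $ k\<bar> \<le> (\<Sum>l\<in>UNIV. \<bar>h k l x * e x i $ l\<bar>)"
          by (simp add: he matrix_vector_mult_def sum_abs)
        also have "\<dots> \<le> (\<Sum>l\<in>UNIV. Mh k l * 1)"
          unfolding abs_mult using Mh x component_le_norm_cart[of "e x i"] ne[of i]
          by (intro sum_mono mult_mono) auto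
        finally show "\<bar>(hessian f x *v e x i) $ k\<bar> \<le> (\<Sum>l\<in>UNIV. Mh k l)" by simp
      qed
      finally have H: "norm (hessian f x *v e x i) \<le> (\<Sum>k\<in>UNIV. \<Sum>l\<in>UNIV. Mh k l)" .
      have "\<bar>\<delta> j\<bar> \<le> \<Delta>" unfolding \<Delta>_def using jP(1) by (intro member_le_sum) auto
      then have "\<bar>\<delta> j\<bar> * s \<le> \<Delta> * G powr \<tau>" using sG s \<Delta>0 by (intro mult_mono) auto
      moreover have "norm (mat (\<delta> j * s) *v e x i) = \<bar>\<delta> j\<bar> * s"
        using s by (simp add: mat_mult_vec ne abs_mult)
      ultimately have "norm (mat (\<delta> j * s) *v e x i) \<le> \<Delta> * G powr \<tau>" by simp
      then show ?thesis
        using H norm_triangle_ineq[of "hessian f x *v e x i" "mat (\<delta> j * s) *v e x i"]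
        by (simp add: a_def A_def nqn_shift_def matrix_vector_mult_add_rdistrib M_def s_def)
    qed
    define w where "w = nqn_direction f \<delta> \<tau> e x"
    have w_eq: "w = (\<Sum>i\<in>UNIV. ((grad f x \<bullet> e x i) / a i) *\<^sub>R e x i)"
      by (simp add: w_def nqn_direction_def A_eq a_def)
    define u where "u = nqn_unit_direction f \<delta> \<tau> e x"
    have u_eq: "u = w /\<^sub>R max 1 (norm w)" by (simp add: u_def nqn_unit_direction_def w_def)
    note dir = scaled_direction_estimates[OF e a1 a2 b w_eq]
    note est = unit_direction_estimates[OF dir b M nc u_eq]
    have arm: "armijo f x u \<gamma>" if \<gamma>: "0 < \<gamma>" "\<gamma> \<le> min 1 (b / L)" for \<gamma>
    proof -
      have nu: "norm (\<gamma> *\<^sub>R u) \<le> 1" using est(1) \<gamma> mult_mono[of \<gamma> 1 "norm u" 1] by simp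
      have "norm (x - \<gamma> *\<^sub>R u) \<le> B + 1" using norm_triangle_ineq4[of x "\<gamma> *\<^sub>R u"] nu x by linarith
      then have "\<bar>f (x - \<gamma> *\<^sub>R u) - f x - (x - \<gamma> *\<^sub>R u - x) \<bullet> grad f x\<bar> \<le> L0 * (norm (x - \<gamma> *\<^sub>R u - x))\<^sup>2"
        using x by (intro L0(2)) auto
      then have "f (x - \<gamma> *\<^sub>R u) - f x \<le> - (\<gamma> * (u \<bullet> grad f x)) + L0 * (\<gamma> * norm u)\<^sup>2"
        by (simp add: abs_le_iff power_mult_distrib)
      also have "L0 * (\<gamma> * norm u)\<^sup>2 \<le> (2 / 3 * L) * (\<gamma> * norm u)\<^sup>2" using L(2) by (intro mult_right_mono) auto
      also have "\<dots> = 2 / 3 * \<gamma> * ((L * \<gamma>) * (norm u)\<^sup>2)" by (simp add: power2_eq_square)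
      also have "\<dots> \<le> 2 / 3 * \<gamma> * (b * (norm u)\<^sup>2)"
        using \<gamma> L(1) by (intro mult_left_mono mult_right_mono) (auto simp: field_simps)
      also have "\<dots> \<le> 2 / 3 * \<gamma> * (u \<bullet> grad f x)" using est(3) \<gamma> by (intro mult_left_mono) auto
      finally show ?thesis by (simp add: armijo_def algebra_simps)
    qed
    have \<eta>: "min 1 (b / L) > 0" using b L(1) by simp
    note bt = backtrack_least[OF arm \<eta> \<gamma>0(1)]
    define \<gamma> where "\<gamma> = backtrack f \<gamma>\<^sub>0 x u"
    have "nqn_step f \<delta> \<tau> \<gamma>\<^sub>0 e x = x - \<gamma> *\<^sub>R u" using nc by (simp add: nqn_step_def Let_def u_def \<gamma>_def)
    moreover have "f (x - \<gamma> *\<^sub>R u) \<le> f x - (1/3) * \<gamma> * (u \<bullet> grad f x)"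
      using bt(1) by (simp add: armijo_def \<gamma>_def)
    ultimately show ?thesis
      using est bt by (intro exI[of _ u] exI[of _ \<gamma>]) (simp add: b_def s_def \<gamma>_def)
  qed
  then show ?thesis using M L(1) unfolding \<kappa>_def by blast
qed

subsection \<open>Convergence\<close>

text \<open>The tangent inequality for the concave function \<open>x powr \<eta>\<close>, read at
  the larger point \<open>a\<close>.\<close>

lemma powr_diff_concave:
  fixes a b \<eta> :: real
  assumes "0 < b" "b \<le> a" "0 < \<eta>" "\<eta> \<le> 1"
  shows "\<eta> * a powr (\<eta> - 1) * (a - b) \<le> a powr \<eta> - b powr \<eta>"
proof (cases "a = b")
  case False
  then have "b < a" using assms by simp
  have "((\<lambda>x. x powr \<eta>) has_real_derivative \<eta> * x powr (\<eta> - 1)) (at x)" if "b \<le> x" "x \<le> a" for x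
    by (rule has_real_derivative_powr) (use that assms in simp)
  from MVT2[OF \<open>b < a\<close> this] obtain c where c: "b < c" "c < a" "a powr \<eta> - b powr \<eta> = (a - b) * (\<eta> * c powr (\<eta> - 1))"
    by blast
  have "a powr (\<eta> - 1) \<le> c powr (\<eta> - 1)" using c assms by (intro powr_mono2') auto
  then have "(a - b) * (\<eta> * a powr (\<eta> - 1)) \<le> (a - b) * (\<eta> * c powr (\<eta> - 1))"
    using assms by (intro mult_left_mono) auto
  then show ?thesis using c(3) by (simp add: mult_ac)
qed simp

text \<open>Once the sequence is close to \<open>p\<close> with \<open>v\<close> small, the
  remaining path length is bounded by \<open>v\<close>, so it can never leave the ball in which the
  step estimate is valid.\<close>

lemma cluster_point_limit:
  fixes X :: "nat \<Rightarrow> 'a::metric_space" and v :: "nat \<Rightarrow> real"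
  assumes \<rho>: "\<rho> > 0"
    and step: "\<And>n. n \<ge> n0 \<Longrightarrow> dist (X n) p < \<rho> \<Longrightarrow> dist (X (Suc n)) (X n) \<le> v n - v (Suc n)"
    and v: "\<And>n. v n \<ge> 0" "v \<longlonglongrightarrow> 0"
    and cluster: "\<And>\<epsilon> N. \<epsilon> > 0 \<Longrightarrow> \<exists>n\<ge>N. dist (X n) p < \<epsilon>"
  shows "X \<longlonglongrightarrow> p"
proof (rule metric_LIMSEQ_I)
  fix \<epsilon>' :: real assume "\<epsilon>' > 0"
  define \<epsilon> where "\<epsilon> = min \<epsilon>' \<rho>"
  have \<epsilon>: "\<epsilon> > 0" "\<epsilon> \<le> \<rho>" using \<rho> \<open>\<epsilon>' > 0\<close> by (auto simp: \<epsilon>_def)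
  obtain N1 where N1: "\<And>n. n \<ge> N1 \<Longrightarrow> v n < \<epsilon> / 2"
    using order_tendstoD(2)[OF v(2), of "\<epsilon> / 2"] \<epsilon> unfolding eventually_sequentially by auto
  obtain N where N: "N \<ge> max n0 N1" "dist (X N) p < \<epsilon> / 2" using cluster[of "\<epsilon> / 2" "max n0 N1"] \<epsilon> by auto
  have near: "dist (X n) p < \<epsilon>" if "dist (X n) (X N) \<le> v N - v n" for n
    using dist_triangle[of "X n" p "X N"] that N N1[of N] v(1)[of n] by (simp add: dist_commute)
  have "dist (X (N + k)) (X N) \<le> v N - v (N + k)" for k
  proof (induction k)
    case (Suc k)
    have "dist (X (Suc (N + k))) (X (N + k)) \<le> v (N + k) - v (Suc (N + k))"
      using near[OF Suc] \<epsilon>(2) N(1) by (intro step) auto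
    then show ?case using Suc dist_triangle[of "X (Suc (N + k))" "X N" "X (N + k)"] by simp
  qed simp
  then have "dist (X n) p < \<epsilon>" if "n \<ge> N" for n using near[of n] that le_Suc_ex by blast
  then show "\<exists>N. \<forall>n\<ge>N. dist (X n) p < \<epsilon>'" by (auto simp: \<epsilon>_def)
qed

lemma unbounded_or_cluster_point:
  fixes X :: "nat \<Rightarrow> 'a::euclidean_space"
  assumes "\<not> filterlim (\<lambda>n. norm (X n)) at_top sequentially"
  obtains p r where "strict_mono r" "(X \<circ> r) \<longlonglongrightarrow> p"
proof -
  obtain Z where Z: "\<not> eventually (\<lambda>n. Z \<le> norm (X n)) sequentially"
    using assms unfolding filterlim_at_top by blast
  then have "infinite {n. norm (X n) < Z}"
    unfolding infinite_nat_iff_unbounded_le eventually_sequentially by (force simp: not_le)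
  from infinite_enumerate[OF this] obtain r :: "nat \<Rightarrow> nat" where r: "strict_mono r" "\<forall>k. norm (X (r k)) < Z" by auto
  then have "\<forall>k. (X \<circ> r) k \<in> cball 0 Z" by (simp add: less_imp_le)
  from compact_cball[of 0 Z, unfolded compact_def, THEN spec, THEN mp, OF this]
  obtain p r' where r': "strict_mono r'" "((X \<circ> r) \<circ> r') \<longlonglongrightarrow> p" by blast
  then show ?thesis using that[of "r \<circ> r'" p] strict_mono_o[OF r(1) r'(1)] r'(2) by (simp add: o_assoc)
qed

lemma GDERIV_shift:
  assumes "GDERIV f (p + y) :> D"
  shows "GDERIV (\<lambda>y. f (p + y) - c) y :> D"
proof -
  have "((\<lambda>y. p + y) has_derivative (\<lambda>h. h)) (at y)" by (auto intro!: derivative_eq_intros)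
  from has_derivative_compose[OF this, of f "\<lambda>h. h \<bullet> D"] assms
  have "((\<lambda>y. f (p + y)) has_derivative (\<lambda>h. h \<bullet> D)) (at y)" by (simp add: gderiv_def)
  from has_derivative_diff[OF this has_derivative_const] show ?thesis by (simp add: gderiv_def)
qed

text \<open>Translation of \<open>p\<close> to the origin and subtraction of \<open>f p\<close>
  reduce this to the cube, which contains the unit ball. The degree is unchanged, and so is
  \<open>K\<close>.\<close>

lemma gradient_inequality:
  fixes f :: "real ^ 'n::finite \<Rightarrow> real"
  assumes f: "polyfun D f" and K: "K > (2 * (2 * D + 1) + 1) * (2 * D + 3) ^ CARD('n)"
  obtains C s0 where "C > 0" "s0 > 0"
    "\<And>x. \<lbrakk>dist x p < 1; f p < f x; f x < f p + s0; grad f x \<noteq> 0\<rbrakk> \<Longrightarrow>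
        (norm (grad f x))\<^sup>2 \<ge> (f x - f p) powr (2 - 1 / real K) / C"
proof -
  obtain g h where g: "\<And>i. polyfun D (g i)" and h: "\<And>i j. polyfun D (h i j)"
    and fg: "\<And>x. GDERIV f x :> (\<chi> i. g i x)" and gh: "\<And>i x. GDERIV (g i) x :> (\<chi> j. h i j x)"
    and hsym: "\<And>i j x. h i j x = h j i x"
    using polyfun_derivatives[OF f] by metis
  have gr: "grad f x = (\<chi> i. g i x)" for x by (rule grad_eqI[OF fg])
  define F where "F y = f (p + y) - f p" for y
  have F: "polyfun D F" unfolding F_def[abs_def] by (intro polyfun_diff polyfun_shift[OF f] polyfun.const)
  have Fg: "GDERIV F y :> (\<chi> i. g i (p + y))" for y unfolding F_def[abs_def] by (rule GDERIV_shift[OF fg])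
  have gh': "GDERIV (\<lambda>y. g i (p + y)) y :> (\<chi> j. h i j (p + y))" for i y
    using GDERIV_shift[where f = "g i" and p = p and y = y and c = 0, OF gh] by simp
  show ?thesis
  proof (rule gradient_inequality_cube[OF F polyfun_shift[OF g, where p = p] polyfun_shift[OF h, where p = p] Fg gh' K])
    fix C s0 assume C: "C > 0" "s0 > 0" and
      ineq: "\<And>x. \<lbrakk>\<And>i. \<bar>x $ i\<bar> < 1; 0 < F x; F x < s0; (\<chi> i. g i (p + x)) \<noteq> 0\<rbrakk> \<Longrightarrow>
        F x powr (2 - 1 / real K) / C \<le> sq_norm_fun (\<lambda>i y. g i (p + y)) x"
    show ?thesis
    proof (rule that[OF C])
      fix x assume x: "dist x p < 1" "f p < f x" "f x < f p + s0" "grad f x \<noteq> 0"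
      have "F (x - p) powr (2 - 1 / real K) / C \<le> sq_norm_fun (\<lambda>i y. g i (p + y)) (x - p)"
      proof (rule ineq)
        show "\<bar>(x - p) $ i\<bar> < 1" for i
          using component_le_norm_cart[of "x - p" i] x(1) by (simp add: dist_norm)
      qed (use x in \<open>simp_all add: F_def gr\<close>)
      also have "\<dots> = (norm (grad f x))\<^sup>2"
        by (simp add: sq_norm_fun_def gr norm_vec_def L2_set_def sum_nonneg)
      finally show "(f x - f p) powr (2 - 1 / real K) / C \<le> (norm (grad f x))\<^sup>2" by (simp add: F_def)
    qed
  qed
qed

text \<open>At a noncritical limit the guaranteed decrease per step, a continuous function of the
  gradient norm, would have a positive limit, although \<open>f\<close> converges along the
  sequence.\<close>

lemma limit_is_critical:
  fixes f :: "real ^ 'n::finite \<Rightarrow> real"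
  assumes f: "polyfun D f" and lim: "X \<longlonglongrightarrow> p"
    and f_lim: "(\<lambda>n. f (X n)) \<longlonglongrightarrow> f p"
    and pos: "M > 0" "L > 0" "\<kappa> > 0" "\<gamma>\<^sub>0 > 0"
    and step: "\<And>n. n \<ge> n0 \<Longrightarrow> \<exists>u \<gamma>. X (Suc n) = X n - \<gamma> *\<^sub>R u \<and> f (X n - \<gamma> *\<^sub>R u) \<le> f (X n) - (1/3) * \<gamma> * (u \<bullet> grad f (X n)) \<and>
       u \<bullet> grad f (X n) \<ge> (norm (grad f (X n)))\<^sup>2 / (M * max 1 (norm (grad f (X n)) / (\<kappa> * norm (grad f (X n)) powr \<tau>))) \<and>
       \<gamma> > 0 \<and> \<gamma> \<ge> min \<gamma>\<^sub>0 (min 1 (\<kappa> * norm (grad f (X n)) powr \<tau> / L) / 3)"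
  shows "grad f p = 0"
proof (rule ccontr)
  assume "grad f p \<noteq> 0"
  then have z: "norm (grad f p) \<noteq> 0" by simp
  define A where "A t = t\<^sup>2 / (M * max 1 (t / (\<kappa> * t powr \<tau>)))" for t
  define B where "B t = min \<gamma>\<^sub>0 (min 1 (\<kappa> * t powr \<tau> / L) / 3)" for t
  obtain g where g: "\<And>i. polyfun D (g i)" and fg: "\<And>x. GDERIV f x :> (\<chi> i. g i x)"
    using polyfun_derivatives[OF f] by metis
  have gr: "grad f = (\<lambda>x. \<chi> i. g i x)" using grad_eqI[OF fg] by (simp add: fun_eq_iff)
  have "isCont (g i) p" for i
    using polyfun_continuous_on[OF g, of UNIV] by (simp add: continuous_on_eq_continuous_at)
  then have "(\<lambda>n. grad f (X n)) \<longlonglongrightarrow> grad f p"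
    unfolding gr by (intro tendsto_vec_lambda isCont_tendsto_compose[OF _ lim])
  then have nl: "(\<lambda>n. norm (grad f (X n))) \<longlonglongrightarrow> norm (grad f p)" by (rule tendsto_norm)
  have tp: "norm (grad f p) powr \<tau> > 0" using z by simp
  have "(\<lambda>n. A (norm (grad f (X n)))) \<longlonglongrightarrow> A (norm (grad f p))"
    unfolding A_def using z pos tp by (intro tendsto_intros nl) (auto simp: max_def)
  moreover have "(\<lambda>n. B (norm (grad f (X n)))) \<longlonglongrightarrow> B (norm (grad f p))"
    unfolding B_def using z pos by (intro tendsto_intros nl) auto
  ultimately have "(\<lambda>n. (1/3) * B (norm (grad f (X n))) * A (norm (grad f (X n)))) \<longlonglongrightarrow>
      (1/3) * B (norm (grad f p)) * A (norm (grad f p))" by (intro tendsto_intros)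
  moreover have "(\<lambda>n. f (X n) - f (X (Suc n))) \<longlonglongrightarrow> f p - f p"
    by (intro tendsto_diff f_lim LIMSEQ_Suc[OF f_lim])
  moreover have "\<forall>n\<ge>n0. (1/3) * B (norm (grad f (X n))) * A (norm (grad f (X n))) \<le> f (X n) - f (X (Suc n))"
  proof (intro allI impI)
    fix n assume "n \<ge> n0"
    from step[OF this] obtain u \<gamma> where u: "X (Suc n) = X n - \<gamma> *\<^sub>R u"
      "f (X n - \<gamma> *\<^sub>R u) \<le> f (X n) - (1/3) * \<gamma> * (u \<bullet> grad f (X n))"
      "u \<bullet> grad f (X n) \<ge> A (norm (grad f (X n)))" "\<gamma> > 0" "\<gamma> \<ge> B (norm (grad f (X n)))"
      unfolding A_def B_def by blast
    have A0: "A (norm (grad f (X n))) \<ge> 0" unfolding A_def using pos by (intro divide_nonneg_nonneg) auto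
    have "B (norm (grad f (X n))) * A (norm (grad f (X n))) \<le> \<gamma> * A (norm (grad f (X n)))"
      using u(5) A0 by (rule mult_right_mono)
    also have "\<dots> \<le> \<gamma> * (u \<bullet> grad f (X n))" using u(3,4) by (intro mult_left_mono) auto
    finally show "(1/3) * B (norm (grad f (X n))) * A (norm (grad f (X n))) \<le> f (X n) - f (X (Suc n))"
      using u(2) by (simp add: u(1))
  qed
  ultimately have "(1/3) * B (norm (grad f p)) * A (norm (grad f p)) \<le> f p - f p"
    using LIMSEQ_le by blast
  moreover have "A (norm (grad f p)) > 0" unfolding A_def using z pos by (intro divide_pos_pos mult_pos_pos) auto
  moreover have "B (norm (grad f p)) > 0" unfolding B_def using z pos by simp
  ultimately show False by (simp add: mult_le_0_iff)
qed

text \<open>Square root of the angle estimate: \<open>G powr \<tau> * G^2\<close> becomes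
  \<open>G powr (1 + \<tau>/2)\<close>.\<close>

lemma direction_gradient_powr:
  fixes q :: real
  assumes q: "q\<^sup>2 \<ge> \<kappa> * G powr \<tau> / M * U\<^sup>2 * G\<^sup>2" "q > 0" and pos: "\<kappa> > 0" "M > 0" "G > 0" "U \<ge> 0"
  shows "q \<ge> sqrt (\<kappa> / M) * U * G powr (1 + \<tau> / 2)"
proof (rule power2_le_imp_le)
  have "(G powr (1 + \<tau> / 2))\<^sup>2 = G powr (2 + \<tau>)"
    by (simp add: power2_eq_square powr_add[symmetric])
  also have "\<dots> = G powr \<tau> * G\<^sup>2" using pos by (simp add: powr_add)
  finally have "(sqrt (\<kappa> / M) * U * G powr (1 + \<tau> / 2))\<^sup>2 = \<kappa> / M * U\<^sup>2 * (G powr \<tau> * G\<^sup>2)"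
    using pos by (simp add: power_mult_distrib)
  then show "(sqrt (\<kappa> / M) * U * G powr (1 + \<tau> / 2))\<^sup>2 \<le> q\<^sup>2" using q(1) by (simp add: mult_ac)
qed (use q in simp)

lemma nqn_converges:
  fixes f :: "real ^ 'n::finite \<Rightarrow> real"
  assumes f: "polyfun D f" and K: "K > (2 * (2 * D + 1) + 1) * (2 * D + 3) ^ CARD('n)"
    and \<tau>: "\<tau> \<le> 1 / (2 * real K)" and seq: "nqn_sequence f \<delta> \<tau> \<gamma>\<^sub>0 e X"
  shows "filterlim (\<lambda>n. norm (X n)) at_top sequentially \<or> (\<exists>p. X \<longlonglongrightarrow> p \<and> grad f p = 0)"
proof (subst disj_commute, rule disjCI)
  assume "\<not> filterlim (\<lambda>n. norm (X n)) at_top sequentially"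
  then obtain p r where r: "strict_mono r" "(X \<circ> r) \<longlonglongrightarrow> p" by (rule unbounded_or_cluster_point)
  have sq: "inj_on \<delta> {0..CARD('n)}" "0 < \<tau>" "0 < \<gamma>\<^sub>0" "\<gamma>\<^sub>0 < 1" "\<And>y. orthonormal_family (e y)"
    "\<And>k. X (Suc k) = nqn_step f \<delta> \<tau> \<gamma>\<^sub>0 e (X k)"
    using seq unfolding nqn_sequence_def by blast+
  show "\<exists>p. X \<longlonglongrightarrow> p \<and> grad f p = 0"
  proof (cases "\<exists>n. grad f (X n) = 0")
    case True
    then obtain n where n: "grad f (X n) = 0" by blast
    have "X (k + n) = X n" for k by (induction k) (simp_all add: sq(6) nqn_step_def n)
    then have "(\<lambda>k. X (k + n)) \<longlonglongrightarrow> X n" by simp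
    then have "X \<longlonglongrightarrow> X n" by (rule LIMSEQ_offset)
    then show ?thesis using n by blast
  next
    case False
    then have nc: "grad f (X n) \<noteq> 0" for n by blast
    define \<kappa> where "\<kappa> = nqn_kappa CARD('n) \<delta>"
    have \<kappa>: "\<kappa> > 0" unfolding \<kappa>_def by (rule nqn_kappa_pos[OF sq(1)]) simp
    note est = nqn_step_estimates[where e = e, OF f sq(1-5), folded \<kappa>_def]
    \<comment> \<open>The constants on the ball of radius \<open>norm (X n)\<close> vary with
      \<open>n\<close>, but strict decrease needs only their existence.\<close>
    have dec: "f (X (Suc n)) < f (X n)" for n
    proof -
      obtain u \<gamma> where u: "X (Suc n) = X n - \<gamma> *\<^sub>R u" "f (X n - \<gamma> *\<^sub>R u) \<le> f (X n) - (1/3) * \<gamma> * (u \<bullet> grad f (X n))"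
        "u \<bullet> grad f (X n) > 0" "\<gamma> > 0"
        using est[of "norm (X n)"] nc[of n] sq(6)[of n] by fastforce
      have "\<gamma> * (u \<bullet> grad f (X n)) > 0" using u(3,4) by (intro mult_pos_pos)
      then show ?thesis using u(2) unfolding u(1) by linarith
    qed
    then have decs: "decseq (\<lambda>n. f (X n))" by (intro decseq_SucI less_imp_le)
    have contf: "isCont f p" using polyfun_continuous_on[OF f, of UNIV] by (simp add: continuous_on_eq_continuous_at)
    have fr: "(\<lambda>k. f (X (r k))) \<longlonglongrightarrow> f p"
      using isCont_tendsto_compose[OF contf r(2)] by (simp add: o_def)
    have ge: "f (X n) \<ge> f p" for n
    proof (rule LIMSEQ_le_const2[OF fr])
      show "\<exists>N. \<forall>k\<ge>N. f (X (r k)) \<le> f (X n)"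
        using decseqD[OF decs] seq_suble[OF r(1)] by (meson order_trans)
    qed
    have gt: "f (X n) > f p" for n using ge[of "Suc n"] dec[of n] by simp
    have flim: "(\<lambda>n. f (X n)) \<longlonglongrightarrow> f p"
    proof -
      obtain l where l: "(\<lambda>n. f (X n)) \<longlonglongrightarrow> l" using decseq_convergent[OF decs] ge by blast
      from LIMSEQ_subseq_LIMSEQ[OF l r(1)] fr have "l = f p" by (simp add: o_def LIMSEQ_unique)
      then show ?thesis using l by simp
    qed
    define B where "B = norm p + 1"
    have nB: "norm (X n) \<le> B" if "dist (X n) p < 1" for n
      using that norm_triangle_sub[of "X n" p] by (simp add: dist_norm B_def)
    obtain M L where M: "M > 0" and L: "L > 0" and
      est': "\<forall>x. norm x \<le> B \<longrightarrow> grad f x \<noteq> 0 \<longrightarrow>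
    (\<exists>u \<gamma>. nqn_step f \<delta> \<tau> \<gamma>\<^sub>0 e x = x - \<gamma> *\<^sub>R u \<and>
       f (x - \<gamma> *\<^sub>R u) \<le> f x - (1/3) * \<gamma> * (u \<bullet> grad f x) \<and> u \<bullet> grad f x > 0 \<and>
       (u \<bullet> grad f x)\<^sup>2 \<ge> \<kappa> * norm (grad f x) powr \<tau> / M * (norm u)\<^sup>2 * (norm (grad f x))\<^sup>2 \<and>
       u \<bullet> grad f x \<ge> (norm (grad f x))\<^sup>2 / (M * max 1 (norm (grad f x) / (\<kappa> * norm (grad f x) powr \<tau>))) \<and>
       \<gamma> > 0 \<and> \<gamma> \<ge> min \<gamma>\<^sub>0 (min 1 (\<kappa> * norm (grad f x) powr \<tau> / L) / 3))"
      using est[of B] by (elim exE conjE)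
    have step: "\<exists>u \<gamma>. X (Suc n) = X n - \<gamma> *\<^sub>R u \<and>
       f (X n - \<gamma> *\<^sub>R u) \<le> f (X n) - (1/3) * \<gamma> * (u \<bullet> grad f (X n)) \<and> u \<bullet> grad f (X n) > 0 \<and>
       (u \<bullet> grad f (X n))\<^sup>2 \<ge> \<kappa> * norm (grad f (X n)) powr \<tau> / M * (norm u)\<^sup>2 * (norm (grad f (X n)))\<^sup>2 \<and>
       u \<bullet> grad f (X n) \<ge> (norm (grad f (X n)))\<^sup>2 / (M * max 1 (norm (grad f (X n)) / (\<kappa> * norm (grad f (X n)) powr \<tau>))) \<and>
       \<gamma> > 0 \<and> \<gamma> \<ge> min \<gamma>\<^sub>0 (min 1 (\<kappa> * norm (grad f (X n)) powr \<tau> / L) / 3)" if "dist (X n) p < 1" for n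
      unfolding sq(6) by (rule est'[rule_format, OF nB[OF that] nc])
    obtain C s0 where C: "C > 0" and s0: "s0 > 0" and loj:
      "\<And>x. \<lbrakk>dist x p < 1; f p < f x; f x < f p + s0; grad f x \<noteq> 0\<rbrakk> \<Longrightarrow>
        (norm (grad f x))\<^sup>2 \<ge> (f x - f p) powr (2 - 1 / real K) / C"
      using gradient_inequality[OF f K, where p = p] by blast
    have K0: "real K \<ge> 1" using K by linarith
    \<comment> \<open>The gradient inequality concerns the squared norm, so raising it to the power
      \<open>(1 + \<tau>/2) / 2\<close> gives the exponent for \<open>G powr (1 + \<tau>/2)\<close>.
      This \<theta> already includes the factor \<open>1 + \<tau>/2\<close>.\<close>
    define \<theta> where "\<theta> = (2 - 1 / real K) * ((1 + \<tau> / 2) / 2)"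
    have \<theta>_eq: "\<theta> = (1 - 1 / (2 * real K)) * (1 + \<tau> / 2)"
      using K0 by (simp add: \<theta>_def field_simps)
    have "(1 - 1 / (2 * real K)) * (1 + \<tau> / 2) \<le> (1 - 1 / (2 * real K)) * (1 + 1 / (2 * real K))"
      using \<tau> K0 sq(2) by (intro mult_left_mono) (auto simp: field_simps)
    also have "\<dots> = 1 - (1 / (2 * real K))\<^sup>2" by (simp add: power2_eq_square algebra_simps)
    also have "\<dots> < 1" using K0 by simp
    finally have "\<theta> < 1" by (simp only: \<theta>_eq)
    moreover have "\<theta> > 0" unfolding \<theta>_def using K0 sq(2) by (intro mult_pos_pos) (auto simp: field_simps)
    ultimately have \<theta>: "0 < \<theta>" "\<theta> < 1" by simp_all
    define \<eta> where "\<eta> = 1 - \<theta>"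
    have \<eta>: "0 < \<eta>" "\<eta> \<le> 1" using \<theta> by (auto simp: \<eta>_def)
    \<comment> \<open>Product of the Armijo factor 1/3, the angle constant and the constant of the
      gradient inequality; it makes \<open>c * a powr \<theta> * dist (X (Suc n)) (X n)\<close> at
      most the decrease of \<open>f\<close>.\<close>
    define c where "c = sqrt (\<kappa> / M) / (3 * C powr ((1 + \<tau> / 2) / 2))"
    have c: "c > 0" unfolding c_def using \<kappa> M C by simp
    \<comment> \<open>The desingularised value: by concavity its decrease in one step dominates the
      length of this step.\<close>
    define v where "v n = (f (X n) - f p) powr \<eta> / (c * \<eta>)" for n
    obtain n0 where n0: "\<And>n. n \<ge> n0 \<Longrightarrow> f (X n) < f p + s0"
      using order_tendstoD(2)[OF flim, of "f p + s0"] s0 unfolding eventually_sequentially by auto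
    have "X \<longlonglongrightarrow> p"
    proof (rule cluster_point_limit[where \<rho> = 1 and ?n0.0 = n0 and v = v])
      show "v n \<ge> 0" for n using c \<eta> by (simp add: v_def)
      have "(\<lambda>n. (f (X n) - f p) powr \<eta>) \<longlonglongrightarrow> 0"
        by (rule tendsto_zero_powrI[OF _ tendsto_const]) (use tendsto_diff[OF flim tendsto_const[of "f p"]] \<eta> ge in auto)
      then show "v \<longlonglongrightarrow> 0" unfolding v_def[abs_def] by (rule tendsto_divide_zero)
      show "\<exists>n\<ge>N. dist (X n) p < \<epsilon>" if pos: "\<epsilon> > 0" for \<epsilon> N
      proof -
        obtain k0 where "\<And>k. k \<ge> k0 \<Longrightarrow> dist (X (r k)) p < \<epsilon>"
          using metric_LIMSEQ_D[OF r(2) pos] by auto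
        then show ?thesis using seq_suble[OF r(1), of "max k0 N"]
          by (intro exI[of _ "r (max k0 N)"]) auto
      qed
      fix n assume n: "n \<ge> n0" and near: "dist (X n) p < 1"
      define a where "a = f (X n) - f p"
      define b where "b = f (X (Suc n)) - f p"
      have ab: "0 < b" "b \<le> a" using gt[of "Suc n"] dec[of n] by (auto simp: a_def b_def)
      define G where "G = norm (grad f (X n))"
      have G: "G > 0" using nc[of n] by (simp add: G_def)
      obtain u \<gamma> where u: "X (Suc n) = X n - \<gamma> *\<^sub>R u" "f (X n - \<gamma> *\<^sub>R u) \<le> f (X n) - (1/3) * \<gamma> * (u \<bullet> grad f (X n))"
        "u \<bullet> grad f (X n) > 0" "(u \<bullet> grad f (X n))\<^sup>2 \<ge> \<kappa> * G powr \<tau> / M * (norm u)\<^sup>2 * G\<^sup>2" "\<gamma> > 0"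
        using step[OF near] unfolding G_def[symmetric] by (elim exE conjE)
      have q: "u \<bullet> grad f (X n) \<ge> sqrt (\<kappa> / M) * norm u * G powr (1 + \<tau> / 2)"
        by (rule direction_gradient_powr[OF u(4,3) \<kappa> M G]) simp
      have "a powr (2 - 1 / real K) / C \<le> G\<^sup>2"
        unfolding a_def G_def using n0[OF n] gt near nc by (intro loj) auto
      then have "(a powr (2 - 1 / real K) / C) powr ((1 + \<tau> / 2) / 2) \<le> (G\<^sup>2) powr ((1 + \<tau> / 2) / 2)"
        using C sq(2) by (intro powr_mono2) auto
      also have "(G\<^sup>2) powr ((1 + \<tau> / 2) / 2) = G powr (1 + \<tau> / 2)"
        using G by (simp add: powr_powr add_divide_distrib flip: powr_numeral)
      also have "(a powr (2 - 1 / real K) / C) powr ((1 + \<tau> / 2) / 2) = a powr \<theta> / C powr ((1 + \<tau> / 2) / 2)"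
        using C by (simp add: powr_divide powr_powr \<theta>_def)
      finally have aG: "a powr \<theta> / C powr ((1 + \<tau> / 2) / 2) \<le> G powr (1 + \<tau> / 2)" .
      have d: "dist (X (Suc n)) (X n) = \<gamma> * norm u" using u(1,5) by (simp add: dist_norm)
      have "c * a powr \<theta> * dist (X (Suc n)) (X n) =
          (1/3) * \<gamma> * (sqrt (\<kappa> / M) * norm u * (a powr \<theta> / C powr ((1 + \<tau> / 2) / 2)))"
        by (simp add: c_def d)
      also have "\<dots> \<le> (1/3) * \<gamma> * (sqrt (\<kappa> / M) * norm u * G powr (1 + \<tau> / 2))"
        using aG u(5) \<kappa> M by (intro mult_left_mono) auto
      also have "\<dots> \<le> (1/3) * \<gamma> * (u \<bullet> grad f (X n))" using q u(5) by (intro mult_left_mono) auto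
      also have "\<dots> \<le> a - b" using u(1,2) by (simp add: a_def b_def)
      finally have main: "c * a powr \<theta> * dist (X (Suc n)) (X n) \<le> a - b" .
      have "a > 0" using ab by simp
      have "c * \<eta> * dist (X (Suc n)) (X n) = \<eta> * a powr (\<eta> - 1) * (c * a powr \<theta> * dist (X (Suc n)) (X n))"
        using \<open>a > 0\<close> by (simp add: \<eta>_def powr_minus field_simps)
      also have "\<dots> \<le> \<eta> * a powr (\<eta> - 1) * (a - b)" using main \<eta> by (intro mult_left_mono) auto
      also have "\<dots> \<le> a powr \<eta> - b powr \<eta>" by (rule powr_diff_concave[OF ab \<eta>])
      finally show "dist (X (Suc n)) (X n) \<le> v n - v (Suc n)"
        using c \<eta> by (simp add: v_def a_def b_def field_simps)
    qed simp
    moreover have "grad f p = 0"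
    proof -
      obtain n1 where n1: "\<And>n. n \<ge> n1 \<Longrightarrow> dist (X n) p < 1"
        using metric_LIMSEQ_D[OF \<open>X \<longlonglongrightarrow> p\<close>, of 1] by auto
      show ?thesis
      proof (rule limit_is_critical[OF f \<open>X \<longlonglongrightarrow> p\<close> flim M L \<kappa> sq(3)])
        fix n assume "n \<ge> n1"
        from step[OF n1[OF this]] show "\<exists>u \<gamma>. X (Suc n) = X n - \<gamma> *\<^sub>R u \<and> f (X n - \<gamma> *\<^sub>R u) \<le> f (X n) - (1/3) * \<gamma> * (u \<bullet> grad f (X n)) \<and>
          u \<bullet> grad f (X n) \<ge> (norm (grad f (X n)))\<^sup>2 / (M * max 1 (norm (grad f (X n)) / (\<kappa> * norm (grad f (X n)) powr \<tau>))) \<and>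
          \<gamma> > 0 \<and> \<gamma> \<ge> min \<gamma>\<^sub>0 (min 1 (\<kappa> * norm (grad f (X n)) powr \<tau> / L) / 3)"
          by (elim exE conjE) (intro exI conjI)
      qed
    qed
    ultimately show ?thesis by blast
  qed
qed

subsection \<open>Multivariate polynomials as polynomial functions\<close>

lemma polyfun_sum_list: "(\<And>a. a \<in> set as \<Longrightarrow> polyfun d (f a)) \<Longrightarrow> polyfun d (\<lambda>x. \<Sum>a\<leftarrow>as. f a x)"
  by (induction as) (auto intro: polyfun.intros)

lemma monomial_degree_le:
  assumes "u \<in> Poly_Mapping.keys P"
  shows "(\<Sum>v\<in>UNIV. Poly_Mapping.lookup u v) \<le> mpoly_degree P"
  unfolding mpoly_degree_def by (rule Max_ge) (use assms in auto)

lemma polyfun_mpoly_eval: "polyfun (mpoly_degree P) (\<lambda>x. mpoly_eval P (\<lambda>i. x $ i))"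
  unfolding mpoly_eval_def
proof (intro polyfun_sum polyfun_cmult)
  fix u assume "u \<in> Poly_Mapping.keys P"
  have "polyfun (\<Sum>v\<in>UNIV. Poly_Mapping.lookup u v) (\<lambda>x. \<Prod>v\<in>UNIV. x $ v ^ Poly_Mapping.lookup u v)"
  proof (rule polyfun_prod)
    fix v
    show "polyfun (Poly_Mapping.lookup u v) (\<lambda>x. x $ v ^ Poly_Mapping.lookup u v)"
      using polyfun_power[OF polyfun_var[of 0 v], of "Poly_Mapping.lookup u v"] by simp
  qed
  then show "polyfun (mpoly_degree P) (\<lambda>x. \<Prod>v\<in>UNIV. x $ v ^ Poly_Mapping.lookup u v)"
    using monomial_degree_le[OF \<open>u \<in> _\<close>] by (rule polyfun_mono)
qed

definition complex_polyfun :: "nat \<Rightarrow> (real ^ 'n::finite \<Rightarrow> complex) \<Rightarrow> bool" where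
  "complex_polyfun d F \<longleftrightarrow> polyfun d (\<lambda>x. Re (F x)) \<and> polyfun d (\<lambda>x. Im (F x))"

lemma complex_polyfun_const: "complex_polyfun d (\<lambda>x. c)"
  by (simp add: complex_polyfun_def polyfun.const)

lemma complex_polyfun_mono: "complex_polyfun d F \<Longrightarrow> d \<le> e \<Longrightarrow> complex_polyfun e F"
  by (auto simp: complex_polyfun_def intro: polyfun_mono)

lemma complex_polyfun_mult:
  "complex_polyfun d F \<Longrightarrow> complex_polyfun e G \<Longrightarrow> complex_polyfun (d + e) (\<lambda>x. F x * G x)"
  by (auto simp: complex_polyfun_def intro: polyfun.add polyfun_diff polyfun_mult)

lemma complex_polyfun_power: "complex_polyfun d F \<Longrightarrow> complex_polyfun (n * d) (\<lambda>x. F x ^ n)"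
  by (induction n) (auto intro: complex_polyfun_const complex_polyfun_mult)

lemma complex_polyfun_prod:
  "(\<And>i. i \<in> I \<Longrightarrow> complex_polyfun (d i) (F i)) \<Longrightarrow> complex_polyfun (\<Sum>i\<in>I. d i) (\<lambda>x. \<Prod>i\<in>I. F i x)"
  by (induction I rule: infinite_finite_induct) (auto intro: complex_polyfun_const complex_polyfun_mult)

lemma complex_polyfun_sum:
  "(\<And>i. i \<in> I \<Longrightarrow> complex_polyfun d (F i)) \<Longrightarrow> complex_polyfun d (\<lambda>x. \<Sum>i\<in>I. F i x)"
  by (simp add: complex_polyfun_def polyfun_sum)

lemma complex_polyfun_mpoly_eval: "complex_polyfun (mpoly_degree P) (\<lambda>x. mpoly_eval P (complex_coords \<iota> x))"
  unfolding mpoly_eval_def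
proof (rule complex_polyfun_sum)
  fix u assume "u \<in> Poly_Mapping.keys P"
  have "complex_polyfun (\<Sum>v\<in>UNIV. Poly_Mapping.lookup u v)
     (\<lambda>x. \<Prod>v\<in>UNIV. complex_coords \<iota> x v ^ Poly_Mapping.lookup u v)"
  proof (rule complex_polyfun_prod)
    fix v
    have "complex_polyfun 1 (\<lambda>x. complex_coords \<iota> x v)"
      using polyfun_var[of 0 "\<iota> (Inl v)"] polyfun_var[of 0 "\<iota> (Inr v)"]
      by (simp add: complex_polyfun_def complex_coords_def)
    from complex_polyfun_power[OF this, of "Poly_Mapping.lookup u v"]
    show "complex_polyfun (Poly_Mapping.lookup u v) (\<lambda>x. complex_coords \<iota> x v ^ Poly_Mapping.lookup u v)"
      by simp
  qed
  from complex_polyfun_mult[OF complex_polyfun_const this, of 0 "Poly_Mapping.lookup P u"]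
  show "complex_polyfun (mpoly_degree P)
     (\<lambda>x. Poly_Mapping.lookup P u * (\<Prod>v\<in>UNIV. complex_coords \<iota> x v ^ Poly_Mapping.lookup u v))"
    by (rule complex_polyfun_mono) (simp add: monomial_degree_le[OF \<open>u \<in> _\<close>])
qed

text \<open>The sum of the degrees serves as a common bound for all of them, and squaring doubles
  it. The bound is read off from \<open>degs\<close> alone.\<close>

lemma polyfun_sum_sq_norm_real:
  assumes "map mpoly_degree Ps = degs"
  shows "polyfun (2 * sum_list degs) (\<lambda>x. sum_sq_norm Ps (\<lambda>i. x $ i))"
  unfolding sum_sq_norm_def
proof (rule polyfun_sum_list)
  fix P assume "P \<in> set Ps"
  then have "mpoly_degree P \<le> sum_list degs" using assms by (auto intro!: member_le_sum_list)
  from polyfun_power[OF polyfun_mono[OF polyfun_mpoly_eval this], of 2]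
  show "polyfun (2 * sum_list degs) (\<lambda>x. (norm (mpoly_eval P (\<lambda>i. x $ i)))\<^sup>2)" by simp
qed

lemma polyfun_sum_sq_norm_complex:
  assumes "map mpoly_degree Ps = degs"
  shows "polyfun (2 * sum_list degs) (\<lambda>x. sum_sq_norm Ps (complex_coords \<iota> x))"
  unfolding sum_sq_norm_def
proof (rule polyfun_sum_list)
  fix P assume "P \<in> set Ps"
  then have "mpoly_degree P \<le> sum_list degs" using assms by (auto intro!: member_le_sum_list)
  from complex_polyfun_mono[OF complex_polyfun_mpoly_eval[of P \<iota>] this]
  have "polyfun (sum_list degs) (\<lambda>x. Re (mpoly_eval P (complex_coords \<iota> x)))"
    "polyfun (sum_list degs) (\<lambda>x. Im (mpoly_eval P (complex_coords \<iota> x)))"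
    by (simp_all add: complex_polyfun_def)
  then show "polyfun (2 * sum_list degs) (\<lambda>x. (norm (mpoly_eval P (complex_coords \<iota> x)))\<^sup>2)"
    unfolding cmod_power2 by (intro polyfun.add polyfun_power)
qed

theorem theorem1p4:
  fixes degs :: "nat list"
  shows "\<exists>\<tau>\<^sub>0::real. 0 < \<tau>\<^sub>0 \<and> \<tau>\<^sub>0 < 1 \<and>
    (\<forall>f :: real ^ 'n::finite \<Rightarrow> real.
      (\<exists>Ps :: ('n, real) mpoly list.
          map mpoly_degree Ps = degs \<and> f = (\<lambda>x. sum_sq_norm Ps (\<lambda>i. x $ i))) \<or>
      (\<exists>(Ps :: ('k::finite, complex) mpoly list) (\<iota> :: 'k + 'k \<Rightarrow> 'n).
          map mpoly_degree Ps = degs \<and> bij \<iota> \<and> f = (\<lambda>x. sum_sq_norm Ps (complex_coords \<iota> x)))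
      \<longrightarrow>
      (\<forall>\<delta> \<tau> \<gamma>\<^sub>0 e x.
          0 < \<tau> \<and> \<tau> \<le> \<tau>\<^sub>0 \<and> nqn_sequence f \<delta> \<tau> \<gamma>\<^sub>0 e x \<longrightarrow>
          filterlim (\<lambda>n. norm (x n)) at_top sequentially \<or>
          (\<exists>p. x \<longlonglongrightarrow> p \<and> grad f p = 0)))"
proof -
  define D where "D = 2 * sum_list degs"
  \<comment> \<open>Only \<open>degs\<close> and \<open>CARD('n)\<close> enter, and so the exponent
    bound \<open>1 / (2 * real K)\<close> is uniform over all admissible \<open>f\<close>, real or
    complex.\<close>
  define K where "K = (2 * (2 * D + 1) + 1) * (2 * D + 3) ^ CARD('n) + 1"
  have K: "K > (2 * (2 * D + 1) + 1) * (2 * D + 3) ^ CARD('n)" by (simp add: K_def)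
  have "real K \<ge> 1" by (simp add: K_def)
  then have \<tau>0: "0 < 1 / (2 * real K)" "1 / (2 * real K) < 1" by (auto simp: field_simps)
  show ?thesis
  proof (intro exI[of _ "1 / (2 * real K)"] conjI allI impI \<tau>0)
    fix f :: "real ^ 'n \<Rightarrow> real" and \<delta> \<tau> \<gamma>\<^sub>0 e x
    assume "(\<exists>Ps :: ('n, real) mpoly list.
          map mpoly_degree Ps = degs \<and> f = (\<lambda>x. sum_sq_norm Ps (\<lambda>i. x $ i))) \<or>
      (\<exists>(Ps :: ('k, complex) mpoly list) (\<iota> :: 'k + 'k \<Rightarrow> 'n).
          map mpoly_degree Ps = degs \<and> bij \<iota> \<and> f = (\<lambda>x. sum_sq_norm Ps (complex_coords \<iota> x)))"
    then have f: "polyfun D f"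
      unfolding D_def by (elim disjE exE conjE) (simp_all add: polyfun_sum_sq_norm_real polyfun_sum_sq_norm_complex)
    assume "0 < \<tau> \<and> \<tau> \<le> 1 / (2 * real K) \<and> nqn_sequence f \<delta> \<tau> \<gamma>\<^sub>0 e x"
    then show "filterlim (\<lambda>n. norm (x n)) at_top sequentially \<or> (\<exists>p. x \<longlonglongrightarrow> p \<and> grad f p = 0)"
      by (intro nqn_converges[OF f K]) auto
  qed
qed

end
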